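(* Assume $\mathsf{ZF}+\mathsf{AC}_\omega$ (the countable axiom of choice). Then surjective cardinals form a surjective cardinal algebra; that is, the class of surjective cardinals, equipped with the finitary addition $+$ and the countable sum $\sum_{n\in\omega}$, satisfies the postulates I, II, III, IV, V, VI$'$ and VII listed in the context.
   Context: For sets $X,Y$, a partial surjection from $X$ onto $Y$ is a function $f$ with $\mathrm{dom}(f)\subseteq X$ and $\mathrm{ran}(f)=Y$. For cardinals $\mathfrak{a},\mathfrak{b}$ write $\mathfrak{a}=^\ast\mathfrak{b}$ if there are sets $X,Y$ of cardinalities $\mathfrak{a},\mathfrak{b}$ such that there are partial surjections from $X$ onto $Y$ and from $Y$ onto $X$. A surjective cardinal is an $=^\ast$-equivalence class of cardinals (made into a set by Scott's trick: the members of minimal rank). Addition and countable sums of surjective cardinals are induced by cardinal addition (disjoint unions) and countable cardinal sums $\sum_{n\in\omega}\mathfrak{a}_n$ (cardinality of $\bigcup_n X_n\times\{n\}$ with $|X_n|=\mathfrak{a}_n$). A surjective cardinal algebra is a system $\langle A,+,\sum\rangle$ satisfying: I: if $a,b\in A$ then $a+b\in A$. II: if $a_n\in A$ for all $n\in\omega$ then $\sum_{n\in\omega}a_n\in A$. III: if $a_n\in A$ for all $n$ then $\sum_{n\in\omega}a_n=a_0+\sum_{n\in\omega}a_{n+1}$. IV: if $a_n,b_n\in A$ for all $n$ then $\sum_{n}(a_n+b_n)=\sum_n a_n+\sum_n b_n$. V: there is $0\in A$ with $a+0=0+a=a$ for all $a\in A$. VI$'$ (finite refinement): if $a_1,a_2,b_1,b_2\in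 A$ and $a_1+a_2=b_1+b_2$, then there are $c_1,c_2,c_3,c_4\in A$ with $a_1=c_1+c_2$, $a_2=c_3+c_4$, $b_1=c_1+c_3$, $b_2=c_2+c_4$. VII (remainder): if $a_n,b_n\in A$ and $a_n=a_{n+1}+b_n$ for all $n\in\omega$, then there is $c\in A$ with $a_m=c+\sum_{n\in\omega}b_{m+n}$ for all $m\in\omega$. *)

theory Defs
  imports Main
begin

text \<open>
  HOL has a global choice operator, so a theorem of ZF plus countable choice cannot be stated
  about HOL sets without silently assuming full choice. It is therefore stated about an
  arbitrary first-order structure whose universe is a type and whose membership relation is
  \<open>mem\<close>. Separation and Replacement range over first-order formulas only, given by the datatype
  \<open>fm\<close>; if they ranged over all HOL predicates, every model would satisfy full choice.
  All sets, functions and sequences below are elements of the structure.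
\<close>

datatype fm = FMem nat nat | FEq nat nat | FNeg fm | FConj fm fm | FAll nat fm

context
  fixes mem :: "'a \<Rightarrow> 'a \<Rightarrow> bool" (infix "\<^bold>\<in>" 50)
begin

primrec sat :: "fm \<Rightarrow> (nat \<Rightarrow> 'a) \<Rightarrow> bool" where
  "sat (FMem i j) s \<longleftrightarrow> s i \<^bold>\<in> s j"
| "sat (FEq i j) s \<longleftrightarrow> s i = s j"
| "sat (FNeg p) s \<longleftrightarrow> \<not> sat p s"
| "sat (FConj p q) s \<longleftrightarrow> sat p s \<and> sat q s"
| "sat (FAll i p) s \<longleftrightarrow> (\<forall>x. sat p (s(i := x)))"

text \<open>In the two schemes the assignment \<open>s\<close> supplies the parameters.\<close>

definition ZF :: bool where
  "ZF \<longleftrightarrow>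
    \<comment> \<open>Extensionality\<close>
    (\<forall>x y. (\<forall>z. z \<^bold>\<in> x \<longleftrightarrow> z \<^bold>\<in> y) \<longrightarrow> x = y) \<and>
    \<comment> \<open>Foundation\<close>
    (\<forall>x. (\<exists>y. y \<^bold>\<in> x) \<longrightarrow> (\<exists>y. y \<^bold>\<in> x \<and> \<not> (\<exists>z. z \<^bold>\<in> x \<and> z \<^bold>\<in> y))) \<and>
    \<comment> \<open>Pairing\<close>
    (\<forall>x y. \<exists>u. \<forall>z. z \<^bold>\<in> u \<longleftrightarrow> z = x \<or> z = y) \<and>
    \<comment> \<open>Union\<close>
    (\<forall>x. \<exists>u. \<forall>z. z \<^bold>\<in> u \<longleftrightarrow> (\<exists>y. y \<^bold>\<in> x \<and> z \<^bold>\<in> y)) \<and>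
    \<comment> \<open>Power set\<close>
    (\<forall>x. \<exists>u. \<forall>z. z \<^bold>\<in> u \<longleftrightarrow> (\<forall>y. y \<^bold>\<in> z \<longrightarrow> y \<^bold>\<in> x)) \<and>
    \<comment> \<open>Infinity\<close>
    (\<exists>u. (\<exists>e. e \<^bold>\<in> u \<and> (\<forall>z. \<not> z \<^bold>\<in> e)) \<and>
         (\<forall>n. n \<^bold>\<in> u \<longrightarrow> (\<exists>m. m \<^bold>\<in> u \<and> (\<forall>z. z \<^bold>\<in> m \<longleftrightarrow> z \<^bold>\<in> n \<or> z = n)))) \<and>
    \<comment> \<open>Separation\<close>
    (\<forall>p s x. \<exists>u. \<forall>z. z \<^bold>\<in> u \<longleftrightarrow> z \<^bold>\<in> x \<and> sat p (s(0 := z))) \<and>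
    \<comment> \<open>Replacement\<close>
    (\<forall>p s x. (\<forall>y. y \<^bold>\<in> x \<longrightarrow> (\<exists>!z. sat p (s(0 := y, 1 := z)))) \<longrightarrow>
       (\<exists>u. \<forall>z. z \<^bold>\<in> u \<longleftrightarrow> (\<exists>y. y \<^bold>\<in> x \<and> sat p (s(0 := y, 1 := z)))))"

text \<open>Unspecified if no element of the structure has extension \<open>P\<close>.\<close>

definition the_set :: "('a \<Rightarrow> bool) \<Rightarrow> 'a" where
  "the_set P = (THE u. \<forall>z. z \<^bold>\<in> u \<longleftrightarrow> P z)"

definition subset_of :: "'a \<Rightarrow> 'a \<Rightarrow> bool" (infix "\<^bold>\<subseteq>" 50) where
  "x \<^bold>\<subseteq> y \<longleftrightarrow> (\<forall>z. z \<^bold>\<in> x \<longrightarrow> z \<^bold>\<in> y)"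

definition zero :: 'a where
  "zero = the_set (\<lambda>z. False)"

definition succ :: "'a \<Rightarrow> 'a" where
  "succ x = the_set (\<lambda>z. z \<^bold>\<in> x \<or> z = x)"

definition omega :: 'a where
  "omega = the_set (\<lambda>n. \<forall>u. zero \<^bold>\<in> u \<and> (\<forall>k. k \<^bold>\<in> u \<longrightarrow> succ k \<^bold>\<in> u) \<longrightarrow> n \<^bold>\<in> u)"

definition upair :: "'a \<Rightarrow> 'a \<Rightarrow> 'a" where
  "upair x y = the_set (\<lambda>z. z = x \<or> z = y)"

definition opair :: "'a \<Rightarrow> 'a \<Rightarrow> 'a" where
  "opair x y = upair (upair x x) (upair x y)"

definition is_function :: "'a \<Rightarrow> bool" where
  "is_function f \<longleftrightarrow>
    (\<forall>p. p \<^bold>\<in> f \<longrightarrow> (\<exists>x y. p = opair x y)) \<and>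
    (\<forall>x y z. opair x y \<^bold>\<in> f \<and> opair x z \<^bold>\<in> f \<longrightarrow> y = z)"

definition domain_of :: "'a \<Rightarrow> 'a" where
  "domain_of f = the_set (\<lambda>x. \<exists>y. opair x y \<^bold>\<in> f)"

definition range_of :: "'a \<Rightarrow> 'a" where
  "range_of f = the_set (\<lambda>y. \<exists>x. opair x y \<^bold>\<in> f)"

definition app :: "'a \<Rightarrow> 'a \<Rightarrow> 'a" (infixl "\<^bold>`" 90) where
  "f \<^bold>` x = (THE y. opair x y \<^bold>\<in> f)"

definition sequence :: "'a \<Rightarrow> bool" where
  "sequence a \<longleftrightarrow> is_function a \<and> domain_of a = omega"

text \<open>The sequence \<open>\<langle>t n : n \<in> \<omega>\<rangle>\<close> as an element of the structure.\<close>

definition seq_of :: "('a \<Rightarrow> 'a) \<Rightarrow> 'a" where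
  "seq_of t = the_set (\<lambda>p. \<exists>n. n \<^bold>\<in> omega \<and> p = opair n (t n))"

definition nat_add :: "'a \<Rightarrow> 'a \<Rightarrow> 'a" where
  "nat_add m n = (THE k. \<exists>f. sequence f \<and> f \<^bold>` zero = m \<and>
     (\<forall>i. i \<^bold>\<in> omega \<longrightarrow> f \<^bold>` succ i = succ (f \<^bold>` i)) \<and> k = f \<^bold>` n)"

definition AC_omega :: bool where
  "AC_omega \<longleftrightarrow>
    (\<forall>X. sequence X \<and> (\<forall>n. n \<^bold>\<in> omega \<longrightarrow> (\<exists>x. x \<^bold>\<in> X \<^bold>` n)) \<longrightarrow>
      (\<exists>f. sequence f \<and> (\<forall>n. n \<^bold>\<in> omega \<longrightarrow> f \<^bold>` n \<^bold>\<in> X \<^bold>` n)))"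

text \<open>\<open>rank x = \<Union>{succ (rank y) | y \<in> x}\<close>, by recursion on a transitive set containing \<open>x\<close>.\<close>

definition rank_function :: "'a \<Rightarrow> 'a \<Rightarrow> bool" where
  "rank_function r t \<longleftrightarrow> is_function r \<and> domain_of r = t \<and>
    (\<forall>x. x \<^bold>\<in> t \<longrightarrow> (\<forall>z. z \<^bold>\<in> r \<^bold>` x \<longleftrightarrow> (\<exists>y. y \<^bold>\<in> x \<and> z \<^bold>\<in> succ (r \<^bold>` y))))"

definition rank :: "'a \<Rightarrow> 'a" where
  "rank x = (THE k. \<exists>t r. (\<forall>y. y \<^bold>\<in> t \<longrightarrow> y \<^bold>\<subseteq> t) \<and> x \<^bold>\<in> t \<and> rank_function r t \<and> k = r \<^bold>` x)"

text \<open>Scott's trick: the elements of minimal rank of the class \<open>P\<close>.\<close>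

definition scott :: "('a \<Rightarrow> bool) \<Rightarrow> 'a" where
  "scott P = the_set (\<lambda>x. P x \<and> (\<forall>y. P y \<longrightarrow> rank x \<^bold>\<subseteq> rank y))"

definition equipotent :: "'a \<Rightarrow> 'a \<Rightarrow> bool" where
  "equipotent X Y \<longleftrightarrow> (\<exists>f. is_function f \<and> domain_of f = X \<and> range_of f = Y \<and>
     (\<forall>x x'. x \<^bold>\<in> X \<and> x' \<^bold>\<in> X \<and> f \<^bold>` x = f \<^bold>` x' \<longrightarrow> x = x'))"

definition card_of :: "'a \<Rightarrow> 'a" where
  "card_of X = scott (\<lambda>Y. equipotent X Y)"

definition cardinal :: "'a \<Rightarrow> bool" where
  "cardinal a \<longleftrightarrow> (\<exists>X. a = card_of X)"

definition card_add :: "'a \<Rightarrow> 'a \<Rightarrow> 'a" where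
  "card_add a b = (THE c. \<exists>X Y. card_of X = a \<and> card_of Y = b \<and>
     c = card_of (the_set (\<lambda>p. (\<exists>x. x \<^bold>\<in> X \<and> p = opair x zero) \<or>
                               (\<exists>y. y \<^bold>\<in> Y \<and> p = opair y (succ zero)))))"

definition card_sum :: "'a \<Rightarrow> 'a" where
  "card_sum a = (THE c. \<exists>X. sequence X \<and> (\<forall>n. n \<^bold>\<in> omega \<longrightarrow> card_of (X \<^bold>` n) = a \<^bold>` n) \<and>
     c = card_of (the_set (\<lambda>p. \<exists>n x. n \<^bold>\<in> omega \<and> x \<^bold>\<in> X \<^bold>` n \<and> p = opair x n)))"

definition partial_surjection :: "'a \<Rightarrow> 'a \<Rightarrow> 'a \<Rightarrow> bool" where
  "partial_surjection f X Y \<longleftrightarrow> is_function f \<and> domain_of f \<^bold>\<subseteq> X \<and> range_of f = Y"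

definition eq_star :: "'a \<Rightarrow> 'a \<Rightarrow> bool" where
  "eq_star a b \<longleftrightarrow> (\<exists>X Y. card_of X = a \<and> card_of Y = b \<and>
     (\<exists>f. partial_surjection f X Y) \<and> (\<exists>g. partial_surjection g Y X))"

definition surj_class :: "'a \<Rightarrow> 'a" where
  "surj_class a = scott (\<lambda>b. cardinal b \<and> eq_star a b)"

definition surjective_cardinal :: "'a \<Rightarrow> bool" where
  "surjective_cardinal A \<longleftrightarrow> (\<exists>a. cardinal a \<and> A = surj_class a)"

text \<open>
  The operations induced on surjective cardinals. Each description denotes only if the result
  does not depend on the representatives.
\<close>

definition surj_add :: "'a \<Rightarrow> 'a \<Rightarrow> 'a" where
  "surj_add A B = (THE C. \<exists>a b. cardinal a \<and> cardinal b \<and> surj_class a = A \<and> surj_class b = B \<and>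
     C = surj_class (card_add a b))"

definition surj_sum :: "'a \<Rightarrow> 'a" where
  "surj_sum A = (THE C. \<exists>a. sequence a \<and>
     (\<forall>n. n \<^bold>\<in> omega \<longrightarrow> cardinal (a \<^bold>` n) \<and> surj_class (a \<^bold>` n) = A \<^bold>` n) \<and>
     C = surj_class (card_sum a))"

definition sequence_in :: "('a \<Rightarrow> bool) \<Rightarrow> 'a \<Rightarrow> bool" where
  "sequence_in A a \<longleftrightarrow> sequence a \<and> (\<forall>n. n \<^bold>\<in> omega \<longrightarrow> A (a \<^bold>` n))"

text \<open>
  The carrier \<open>A\<close> may be a proper class of the structure, hence a predicate; \<open>S\<close> maps a sequence
  (an element of the structure) to its sum.
\<close>

definition surjective_cardinal_algebra ::
  "('a \<Rightarrow> bool) \<Rightarrow> ('a \<Rightarrow> 'a \<Rightarrow> 'a) \<Rightarrow> ('a \<Rightarrow> 'a) \<Rightarrow> bool" where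
  "surjective_cardinal_algebra A add S \<longleftrightarrow>
    (\<forall>a b. A a \<and> A b \<longrightarrow> A (add a b)) \<and>
    (\<forall>a. sequence_in A a \<longrightarrow> A (S a)) \<and>
    (\<forall>a. sequence_in A a \<longrightarrow> S a = add (a \<^bold>` zero) (S (seq_of (\<lambda>n. a \<^bold>` succ n)))) \<and>
    (\<forall>a b. sequence_in A a \<and> sequence_in A b \<longrightarrow>
       S (seq_of (\<lambda>n. add (a \<^bold>` n) (b \<^bold>` n))) = add (S a) (S b)) \<and>
    (\<exists>z. A z \<and> (\<forall>a. A a \<longrightarrow> add a z = a \<and> add z a = a)) \<and>
    \<comment> \<open>finite refinement\<close>
    (\<forall>a1 a2 b1 b2. A a1 \<and> A a2 \<and> A b1 \<and> A b2 \<and> add a1 a2 = add b1 b2 \<longrightarrow>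
       (\<exists>c1 c2 c3 c4. A c1 \<and> A c2 \<and> A c3 \<and> A c4 \<and>
          a1 = add c1 c2 \<and> a2 = add c3 c4 \<and> b1 = add c1 c3 \<and> b2 = add c2 c4)) \<and>
    \<comment> \<open>remainder\<close>
    (\<forall>a b. sequence_in A a \<and> sequence_in A b \<and>
       (\<forall>n. n \<^bold>\<in> omega \<longrightarrow> a \<^bold>` n = add (a \<^bold>` succ n) (b \<^bold>` n)) \<longrightarrow>
       (\<exists>c. A c \<and> (\<forall>m. m \<^bold>\<in> omega \<longrightarrow>
          a \<^bold>` m = add c (S (seq_of (\<lambda>n. b \<^bold>` nat_add m n))))))"

end

end

theory Submission
  imports Defs
begin

text \<open>
  Write \<open>X \<preceq> Y\<close> if some partial function maps \<open>Y\<close> onto \<open>X\<close>, and say that \<open>A\<close> absorbs \<open>Y\<close> if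
  \<open>A + Y \<preceq> A\<close>. Three facts about absorption carry the proof. Countably many absorbed sets are
  absorbed simultaneously. A set absorbed by \<open>A\<^sub>1 + A\<^sub>2\<close> splits into a part absorbed by \<open>A\<^sub>1\<close> and a
  part absorbed by \<open>A\<^sub>2\<close>. If \<open>f\<close> maps \<open>A\<close> onto \<open>B\<close> and \<open>g\<close> maps \<open>B\<close> onto \<open>A\<close>, then every
  \<open>T \<subseteq> B\<close> and its preimage under \<open>f\<close> agree up to subsets absorbed by \<open>A\<close>: the points of the
  preimage without a predecessor of the same kind under the iterates of \<open>g f\<close> sit below infinite
  trees outside the preimage, which absorb them. Finite refinement follows by distributing the
  absorbed pieces. For the remainder postulate, the points of \<open>A\<^sub>m\<close> that never reach any
  \<open>B\<^sub>n\<close> form, after removal of absorbed parts, an increasing chain in \<open>m\<close>; its limit,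
  enlarged by a set that every \<open>A\<^sub>m\<close> absorbs, is the remainder.

  The natural numbers of the structure may be nonstandard, so induction and recursion apply to
  first-order definable properties only, and each of them needs a definability proof.
\<close>

section \<open>Definability with parameters\<close>

primrec fm_vars :: "fm \<Rightarrow> nat set" where
  "fm_vars (FMem i j) = {i, j}"
| "fm_vars (FEq i j) = {i, j}"
| "fm_vars (FNeg p) = fm_vars p"
| "fm_vars (FConj p q) = fm_vars p \<union> fm_vars q"
| "fm_vars (FAll i p) = insert i (fm_vars p)"

primrec fm_rename :: "(nat \<Rightarrow> nat) \<Rightarrow> fm \<Rightarrow> fm" where
  "fm_rename r (FMem i j) = FMem (r i) (r j)"
| "fm_rename r (FEq i j) = FEq (r i) (r j)"
| "fm_rename r (FNeg p) = FNeg (fm_rename r p)"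
| "fm_rename r (FConj p q) = FConj (fm_rename r p) (fm_rename r q)"
| "fm_rename r (FAll i p) = FAll (r i) (fm_rename r p)"

lemma finite_fm_vars: "finite (fm_vars p)"
  by (induction p) auto

lemma sat_cong: "(\<And>i. i \<in> fm_vars p \<Longrightarrow> s i = s' i) \<Longrightarrow> sat mem p s = sat mem p s'"
proof (induction p arbitrary: s s')
  case (FNeg p)
  have "sat mem p s = sat mem p s'" by (rule FNeg.IH) (use FNeg.prems in simp)
  then show ?case by simp
next
  case (FConj p q)
  have "sat mem p s = sat mem p s'" by (rule FConj.IH(1)) (use FConj.prems in simp)
  moreover have "sat mem q s = sat mem q s'" by (rule FConj.IH(2)) (use FConj.prems in simp)
  ultimately show ?case by simp
next
  case (FAll i p)
  have "sat mem p (s(i := x)) = sat mem p (s'(i := x))" for x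
    by (rule FAll.IH) (use FAll.prems in auto)
  then show ?case by simp
qed simp_all

lemma sat_rename: "inj_on r (fm_vars p) \<Longrightarrow> sat mem (fm_rename r p) s = sat mem p (s \<circ> r)"
proof (induction p arbitrary: s)
  case (FConj p q)
  then show ?case by (simp add: inj_on_Un)
next
  case (FAll i p)
  have "sat mem (fm_rename r p) (s(r i := x)) = sat mem p ((s \<circ> r)(i := x))" for x
  proof -
    have "sat mem (fm_rename r p) (s(r i := x)) = sat mem p (s(r i := x) \<circ> r)"
      by (rule FAll.IH) (use FAll.prems in \<open>auto simp: inj_on_def\<close>)
    also have "\<dots> = sat mem p ((s \<circ> r)(i := x))"
      by (rule sat_cong) (use FAll.prems in \<open>auto simp: inj_on_def\<close>)
    finally show ?thesis .
  qed
  then show ?case by (simp add: o_def)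
qed auto

text \<open>Even positions hold the variables, odd positions the parameters.\<close>

definition interleave :: "(nat \<Rightarrow> 'a) \<Rightarrow> (nat \<Rightarrow> 'a) \<Rightarrow> nat \<Rightarrow> 'a" where
  "interleave s c n = (if even n then s (n div 2) else c (n div 2))"

lemma interleave_even [simp]: "interleave s c (2 * n) = s n"
  and interleave_odd [simp]: "interleave s c (Suc (2 * n)) = c n"
  by (simp_all add: interleave_def)

named_theorems definable_intros

locale zf =
  fixes mem :: "'a \<Rightarrow> 'a \<Rightarrow> bool" (infix "\<epsilon>" 50)
  assumes ZF: "ZF mem"
begin

definition definable :: "((nat \<Rightarrow> 'a) \<Rightarrow> bool) \<Rightarrow> bool" where
  "definable P \<longleftrightarrow> (\<exists>p c. \<forall>s. P s = sat mem p (interleave s c))"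

text \<open>Variables are de Bruijn indices: a quantifier puts the bound variable at position 0.\<close>

definition definable_term :: "((nat \<Rightarrow> 'a) \<Rightarrow> 'a) \<Rightarrow> bool" where
  "definable_term t \<longleftrightarrow> definable (\<lambda>s. s 0 = t (\<lambda>i. s (Suc i)))"

lemma definable_rename:
  assumes "definable P" "inj r"
  shows "definable (\<lambda>s. P (\<lambda>i. s (r i)))"
proof -
  obtain p c where p: "\<And>s. P s = sat mem p (interleave s c)"
    using assms(1) unfolding definable_def by blast
  define r' where "r' n = (if even n then 2 * r (n div 2) else n)" for n
  have "inj_on r' (fm_vars p)"
  proof (rule inj_onI)
    fix m n
    assume eq: "r' m = r' n"
    have "even (r' k) \<longleftrightarrow> even k" for k
      by (simp add: r'_def)
    then have "even m \<longleftrightarrow> even n"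
      using eq by metis
    moreover have "m div 2 = n div 2" if "even m" "even n"
      by (rule injD[OF assms(2)]) (use eq that in \<open>simp add: r'_def\<close>)
    ultimately show "m = n"
      using eq by (cases "even m") (auto simp: r'_def elim!: evenE)
  qed
  then have "sat mem (fm_rename r' p) (interleave s c) = sat mem p (interleave s c \<circ> r')" for s
    by (rule sat_rename)
  moreover have "interleave s c \<circ> r' = interleave (\<lambda>i. s (r i)) c" for s
    by (auto simp: interleave_def r'_def fun_eq_iff)
  ultimately show ?thesis
    unfolding definable_def by (metis p)
qed

lemma definable_mem_var: "definable (\<lambda>s. s i \<epsilon> s j)"
  unfolding definable_def by (rule exI[of _ "FMem (2 * i) (2 * j)"]) simp

lemma definable_eq_var: "definable (\<lambda>s. s i = s j)"
  unfolding definable_def by (rule exI[of _ "FEq (2 * i) (2 * j)"]) simp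

lemma definable_eq_param: "definable (\<lambda>s. s i = c)"
  unfolding definable_def
  by (rule exI[of _ "FEq (2 * i) 1"], rule exI[of _ "\<lambda>_. c"]) (simp add: interleave_def)

lemma definable_not [definable_intros]: "definable P \<Longrightarrow> definable (\<lambda>s. \<not> P s)"
  unfolding definable_def by (metis sat.simps(3))

lemma definable_conj [definable_intros]:
  assumes "definable P" "definable Q"
  shows "definable (\<lambda>s. P s \<and> Q s)"
proof -
  obtain p c where p: "\<And>s. P s = sat mem p (interleave s c)"
    using assms(1) unfolding definable_def by blast
  obtain q d where q: "\<And>s. Q s = sat mem q (interleave s d)"
    using assms(2) unfolding definable_def by blast
  define a where "a n = (if even n then n else 2 * (2 * (n div 2)) + 1)" for n :: nat
  define b where "b n = (if even n then n else 2 * (2 * (n div 2) + 1) + 1)" for n :: nat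
  define e where "e = interleave c d"
  have "inj_on a (fm_vars p)" "inj_on b (fm_vars q)"
    unfolding a_def b_def inj_on_def by (auto, presburger+)
  moreover have "interleave s e \<circ> a = interleave s c" for s
    by (rule ext) (auto simp: interleave_def a_def e_def elim!: oddE)
  moreover have "interleave s e \<circ> b = interleave s d" for s
    by (rule ext) (auto simp: interleave_def b_def e_def)
  ultimately have "sat mem (FConj (fm_rename a p) (fm_rename b q)) (interleave s e) \<longleftrightarrow> P s \<and> Q s"
    for s by (simp add: sat_rename p q)
  then show ?thesis
    unfolding definable_def by blast
qed

lemma definable_all [definable_intros]:
  assumes "definable (\<lambda>s. Q (\<lambda>i. s (Suc i)) (s 0))"
  shows "definable (\<lambda>s. \<forall>x. Q s x)"
proof -
  obtain p c where p: "\<And>s. Q (\<lambda>i. s (Suc i)) (s 0) = sat mem p (interleave s c)"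
    using assms unfolding definable_def by blast
  obtain m where m: "\<And>v. v \<in> fm_vars p \<Longrightarrow> v < m"
    using finite_fm_vars[of p] unfolding finite_nat_set_iff_bounded by blast
  define r where "r n = (if n = 0 then 2 * m else if even n then n - 2 else n)" for n :: nat
  have inj: "inj_on r (fm_vars p)"
  proof (rule inj_onI)
    fix u v
    assume "u \<in> fm_vars p" "v \<in> fm_vars p" "r u = r v"
    with m[of u] m[of v] show "u = v"
      unfolding r_def by (auto split: if_splits) presburger+
  qed
  have "sat mem (fm_rename r p) ((interleave s c)(2 * m := x)) = Q s x" for s x
  proof -
    have "sat mem (fm_rename r p) ((interleave s c)(2 * m := x)) =
        sat mem p ((interleave s c)(2 * m := x) \<circ> r)"
      by (rule sat_rename[OF inj])
    also have "\<dots> = sat mem p (interleave (case_nat x s) c)"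
    proof (rule sat_cong)
      fix i
      assume "i \<in> fm_vars p"
      then have "i < m" by (rule m)
      consider "i = 0" | j where "i = 2 * Suc j" | j where "i = Suc (2 * j)"
        by (metis dvd_mult_div_cancel mult_0_right not0_implies_Suc odd_two_times_div_two_succ
            Suc_eq_plus1)
      then show "((interleave s c)(2 * m := x) \<circ> r) i = interleave (case_nat x s) c i"
        using \<open>i < m\<close> by cases (simp_all add: r_def interleave_def)
    qed
    also have "\<dots> = Q s x"
      using p[of "case_nat x s"] by simp
    finally show ?thesis .
  qed
  then have "sat mem (FAll (2 * m) (fm_rename r p)) (interleave s c) \<longleftrightarrow> (\<forall>x. Q s x)" for s
    by simp
  then show ?thesis
    unfolding definable_def by metis
qed

lemma definable_ex [definable_intros]:
  assumes "definable (\<lambda>s. Q (\<lambda>i. s (Suc i)) (s 0))"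
  shows "definable (\<lambda>s. \<exists>x. Q s x)"
proof -
  have "definable (\<lambda>s. \<not> (\<forall>x. \<not> Q s x))"
    by (rule definable_not, rule definable_all, rule definable_not) (rule assms)
  then show ?thesis by simp
qed

lemma definable_const [definable_intros]: "definable (\<lambda>s. B)"
  using definable_eq_var[of 0 0] definable_not[OF definable_eq_var[of 0 0]] by (cases B) simp_all

lemma definable_disj [definable_intros]:
  assumes "definable P" "definable Q"
  shows "definable (\<lambda>s. P s \<or> Q s)"
proof -
  have "definable (\<lambda>s. \<not> (\<not> P s \<and> \<not> Q s))"
    by (intro definable_not definable_conj assms)
  then show ?thesis by simp
qed

lemma definable_imp [definable_intros]:
  assumes "definable P" "definable Q"
  shows "definable (\<lambda>s. P s \<longrightarrow> Q s)"
  unfolding imp_conv_disj by (intro definable_not definable_disj assms)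

lemma definable_iff [definable_intros]:
  assumes "definable P" "definable Q"
  shows "definable (\<lambda>s. P s = Q s)"
  unfolding iff_conv_conj_imp by (intro definable_imp definable_conj assms)

lemma definable_ball [definable_intros]:
  "definable (\<lambda>s. \<forall>x. x \<in> A s \<longrightarrow> Q s x) \<Longrightarrow> definable (\<lambda>s. \<forall>x\<in>A s. Q s x)"
  by (simp add: Ball_def)

lemma definable_bex [definable_intros]:
  "definable (\<lambda>s. \<exists>x. x \<in> A s \<and> Q s x) \<Longrightarrow> definable (\<lambda>s. \<exists>x\<in>A s. Q s x)"
  by (simp add: Bex_def)

lemma definable_term_var [definable_intros]: "definable_term (\<lambda>s. s i)"
  unfolding definable_term_def by (rule definable_eq_var)

lemma definable_term_const [definable_intros]: "definable_term (\<lambda>s. c)"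
  unfolding definable_term_def by (rule definable_eq_param)

lemma definable_term_shift: "definable_term t \<Longrightarrow> definable_term (\<lambda>s. t (\<lambda>i. s (Suc i)))"
  unfolding definable_term_def
  by (drule definable_rename[where r = "case_nat 0 (\<lambda>i. Suc (Suc i))"])
    (auto simp: inj_def split: nat.splits)

lemma definable_subst:
  assumes "definable_term t" "definable (\<lambda>s. Q (\<lambda>i. s (Suc i)) (s 0))"
  shows "definable (\<lambda>s. Q s (t s))"
proof -
  have "definable (\<lambda>s. \<exists>x. x = t s \<and> Q s x)"
    by (rule definable_ex, rule definable_conj) (use assms in \<open>auto simp: definable_term_def\<close>)
  then show ?thesis by simp
qed

definition definable1 :: "('a \<Rightarrow> bool) \<Rightarrow> bool" where
  "definable1 P \<longleftrightarrow> definable (\<lambda>s. P (s 0))"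

definition definable2 :: "('a \<Rightarrow> 'a \<Rightarrow> bool) \<Rightarrow> bool" where
  "definable2 P \<longleftrightarrow> definable (\<lambda>s. P (s 0) (s 1))"

definition definable3 :: "('a \<Rightarrow> 'a \<Rightarrow> 'a \<Rightarrow> bool) \<Rightarrow> bool" where
  "definable3 P \<longleftrightarrow> definable (\<lambda>s. P (s 0) (s 1) (s 2))"

definition definable_fun :: "('a \<Rightarrow> 'a) \<Rightarrow> bool" where
  "definable_fun F \<longleftrightarrow> definable_term (\<lambda>s. F (s 0))"

definition definable_fun2 :: "('a \<Rightarrow> 'a \<Rightarrow> 'a) \<Rightarrow> bool" where
  "definable_fun2 F \<longleftrightarrow> definable_term (\<lambda>s. F (s 0) (s 1))"

lemma definable1I [definable_intros]: "definable (\<lambda>s. P (s 0)) \<Longrightarrow> definable1 P"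
  by (simp add: definable1_def)

lemma definable2I [definable_intros]: "definable (\<lambda>s. P (s 0) (s 1)) \<Longrightarrow> definable2 P"
  by (simp add: definable2_def)

lemma definable3I [definable_intros]: "definable (\<lambda>s. P (s 0) (s 1) (s 2)) \<Longrightarrow> definable3 P"
  by (simp add: definable3_def)

lemma definable_funI [definable_intros]: "definable_term (\<lambda>s. F (s 0)) \<Longrightarrow> definable_fun F"
  by (simp add: definable_fun_def)

lemma definable_fun2I [definable_intros]:
  "definable_term (\<lambda>s. F (s 0) (s 1)) \<Longrightarrow> definable_fun2 F"
  by (simp add: definable_fun2_def)

lemma definable1_app: "definable1 P \<Longrightarrow> definable_term t \<Longrightarrow> definable (\<lambda>s. P (t s))"
  by (rule definable_subst) (simp_all add: definable1_def)

lemma definable2_app: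
  assumes "definable2 P" "definable_term t" "definable_term u"
  shows "definable (\<lambda>s. P (t s) (u s))"
proof (rule definable_subst[OF assms(3), where Q = "\<lambda>s y. P (t s) y"])
  show "definable (\<lambda>s. P (t (\<lambda>i. s (Suc i))) (s 0))"
    by (rule definable_subst[OF definable_term_shift[OF assms(2)], where Q = "\<lambda>s x. P x (s 0)"])
      (use assms(1) in \<open>simp add: definable2_def\<close>)
qed

lemma definable3_app:
  assumes "definable3 P" "definable_term t" "definable_term u" "definable_term v"
  shows "definable (\<lambda>s. P (t s) (u s) (v s))"
proof (rule definable_subst[OF assms(4), where Q = "\<lambda>s z. P (t s) (u s) z"])
  note shift = definable_term_shift
  show "definable (\<lambda>s. P (t (\<lambda>i. s (Suc i))) (u (\<lambda>i. s (Suc i))) (s 0))"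
  proof (rule definable_subst[OF shift[OF assms(3)],
        where Q = "\<lambda>s y. P (t (\<lambda>i. s (Suc i))) y (s 0)"])
    show "definable (\<lambda>s. P (t (\<lambda>i. s (Suc (Suc i)))) (s 0) (s (Suc 0)))"
      by (rule definable_subst[OF shift[OF shift[OF assms(2)]],
            where Q = "\<lambda>s x. P x (s 0) (s (Suc 0))"])
        (use assms(1) in \<open>simp add: definable3_def numeral_2_eq_2\<close>)
  qed
qed

lemma definable_fun2_app:
  assumes "definable_fun2 F" "definable_term t" "definable_term u"
  shows "definable_term (\<lambda>s. F (t s) (u s))"
proof -
  have "definable3 (\<lambda>z x y. z = F x y)"
    using assms(1) by (simp add: definable_fun2_def definable_term_def definable3_def numeral_2_eq_2)
  from definable3_app[OF this definable_term_var[of 0] definable_term_shift[OF assms(2)]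
      definable_term_shift[OF assms(3)]]
  show ?thesis
    unfolding definable_term_def .
qed

lemma definable_fun_app:
  assumes "definable_fun F" "definable_term t"
  shows "definable_term (\<lambda>s. F (t s))"
proof -
  have "definable2 (\<lambda>y x. y = F x)"
    using assms(1) by (simp add: definable_fun_def definable_term_def definable2_def)
  from definable2_app[OF this definable_term_var[of 0] definable_term_shift[OF assms(2)]]
  show ?thesis
    unfolding definable_term_def .
qed

lemma definable_mem [definable_intros]:
  "definable_term t \<Longrightarrow> definable_term u \<Longrightarrow> definable (\<lambda>s. t s \<epsilon> u s)"
  by (rule definable2_app[of mem]) (simp_all add: definable2_def definable_mem_var)

lemma definable_eq [definable_intros]:
  "definable_term t \<Longrightarrow> definable_term u \<Longrightarrow> definable (\<lambda>s. t s = u s)"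
  by (rule definable2_app[of "(=)"]) (simp_all add: definable2_def definable_eq_var)

lemma definable_relcompp [definable_intros]:
  "definable (\<lambda>s. \<exists>y. R s (t s) y \<and> S s y (u s)) \<Longrightarrow> definable (\<lambda>s. (R s OO S s) (t s) (u s))"
  by (simp add: relcompp_apply)

lemma definable_conversep [definable_intros]:
  "definable (\<lambda>s. R s (u s) (t s)) \<Longrightarrow> definable (\<lambda>s. (R s)\<inverse>\<inverse> (t s) (u s))"
  by simp

section \<open>Sets of the structure as HOL sets\<close>

definition elts :: "'a \<Rightarrow> 'a set" where
  "elts u = {z. z \<epsilon> u}"

definition small :: "'a set \<Rightarrow> bool" where
  "small A \<longleftrightarrow> (\<exists>u. A = elts u)"

definition set_of :: "'a set \<Rightarrow> 'a" where
  "set_of A = the_set mem (\<lambda>z. z \<in> A)"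

lemma elts_iff: "z \<in> elts u \<longleftrightarrow> z \<epsilon> u"
  by (simp add: elts_def)

lemma
  shows extensionality: "\<forall>x y. (\<forall>z. z \<in> elts x \<longleftrightarrow> z \<in> elts y) \<longrightarrow> x = y"
    and regularity: "\<forall>x. (\<exists>y. y \<in> elts x) \<longrightarrow> (\<exists>y. y \<in> elts x \<and> \<not> (\<exists>z. z \<in> elts x \<and> z \<in> elts y))"
    and pairing: "\<forall>x y. \<exists>u. \<forall>z. z \<in> elts u \<longleftrightarrow> z = x \<or> z = y"
    and union: "\<forall>x. \<exists>u. \<forall>z. z \<in> elts u \<longleftrightarrow> (\<exists>y. y \<in> elts x \<and> z \<in> elts y)"
    and power_set: "\<forall>x. \<exists>u. \<forall>z. z \<in> elts u \<longleftrightarrow> (\<forall>y. y \<in> elts z \<longrightarrow> y \<in> elts x)"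
    and infinity: "\<exists>u. (\<exists>e. e \<in> elts u \<and> (\<forall>z. z \<notin> elts e)) \<and>
      (\<forall>n. n \<in> elts u \<longrightarrow> (\<exists>m. m \<in> elts u \<and> (\<forall>z. z \<in> elts m \<longleftrightarrow> z \<in> elts n \<or> z = n)))"
    and separation: "\<forall>p s x. \<exists>u. \<forall>z. z \<in> elts u \<longleftrightarrow> z \<in> elts x \<and> sat mem p (s(0 := z))"
    and replacement: "\<forall>p s x. (\<forall>y. y \<in> elts x \<longrightarrow> (\<exists>!z. sat mem p (s(0 := y, 1 := z)))) \<longrightarrow>
      (\<exists>u. \<forall>z. z \<in> elts u \<longleftrightarrow> (\<exists>y. y \<in> elts x \<and> sat mem p (s(0 := y, 1 := z))))"
  using ZF unfolding ZF_def elts_iff by simp_all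

lemma subset_of_iff [simp]: "subset_of mem x y \<longleftrightarrow> elts x \<subseteq> elts y"
  by (auto simp: subset_of_def elts_iff)

lemma elts_eqI: "(\<And>z. z \<in> elts u \<longleftrightarrow> z \<in> elts v) \<Longrightarrow> u = v"
  using extensionality by blast

lemma elts_inject [simp]: "elts u = elts v \<longleftrightarrow> u = v"
  by (metis elts_eqI)

lemma small_elts [simp]: "small (elts u)"
  unfolding small_def by blast

lemma smallE:
  assumes "small A"
  obtains u where "A = elts u"
  using assms unfolding small_def by blast

lemma set_of_elts [simp]: "set_of (elts u) = u"
proof -
  have "(\<forall>z. z \<epsilon> v \<longleftrightarrow> z \<in> elts u) \<longleftrightarrow> v = u" for v
    using elts_inject[of v u] by (simp add: set_eq_iff elts_iff)
  then show ?thesis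
    by (simp add: set_of_def the_set_def)
qed

lemma elts_set_of [simp]: "small A \<Longrightarrow> elts (set_of A) = A"
  by (auto elim: smallE)

lemma small_iff_elts_set_of: "small A \<longleftrightarrow> elts (set_of A) = A"
  by (metis elts_set_of small_elts)

lemma the_set_eq_set_of: "the_set mem P = set_of {z. P z}"
  by (simp add: set_of_def)

lemma definable_elts [definable_intros]:
  "definable_term t \<Longrightarrow> definable_term u \<Longrightarrow> definable (\<lambda>s. t s \<in> elts (u s))"
  using definable_mem by (simp add: elts_iff)

lemma definable_small_set: "small A \<Longrightarrow> definable_term t \<Longrightarrow> definable (\<lambda>s. t s \<in> A)"
  by (elim smallE) (simp add: definable_elts definable_term_const)

lemma definable_Collect [definable_intros]:
  "definable (\<lambda>s. P s (t s)) \<Longrightarrow> definable (\<lambda>s. t s \<in> {x. P s x})"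
  by simp

lemma definable_Un [definable_intros]:
  "definable (\<lambda>s. t s \<in> A s) \<Longrightarrow> definable (\<lambda>s. t s \<in> B s) \<Longrightarrow> definable (\<lambda>s. t s \<in> A s \<union> B s)"
  by (simp add: definable_disj)

lemma definable_Int [definable_intros]:
  "definable (\<lambda>s. t s \<in> A s) \<Longrightarrow> definable (\<lambda>s. t s \<in> B s) \<Longrightarrow> definable (\<lambda>s. t s \<in> A s \<inter> B s)"
  by (simp add: definable_conj)

lemma definable_Diff [definable_intros]:
  "definable (\<lambda>s. t s \<in> A s) \<Longrightarrow> definable (\<lambda>s. t s \<in> B s) \<Longrightarrow> definable (\<lambda>s. t s \<in> A s - B s)"
  by (simp add: definable_conj definable_not)

lemma definable_empty [definable_intros]: "definable (\<lambda>s. t s \<in> {})"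
  by (simp add: definable_const)

lemma definable_insert [definable_intros]:
  "definable_term t \<Longrightarrow> definable_term u \<Longrightarrow> definable (\<lambda>s. t s \<in> A s) \<Longrightarrow>
    definable (\<lambda>s. t s \<in> insert (u s) (A s))"
  by (simp add: definable_disj definable_eq)

lemma definable_subset [definable_intros]:
  "definable (\<lambda>s. \<forall>x. x \<in> A s \<longrightarrow> x \<in> B s) \<Longrightarrow> definable (\<lambda>s. A s \<subseteq> B s)"
  by (simp add: subset_eq Ball_def)

lemma definable_UN [definable_intros]:
  "definable (\<lambda>s. \<exists>i. i \<in> I s \<and> t s \<in> F s i) \<Longrightarrow> definable (\<lambda>s. t s \<in> (\<Union>i\<in>I s. F s i))"
  by (simp add: Bex_def)

lemma definable_image [definable_intros]:
  "definable (\<lambda>s. \<exists>x. x \<in> A s \<and> t s = f s x) \<Longrightarrow> definable (\<lambda>s. t s \<in> f s ` A s)"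
  by (simp add: image_iff Bex_def)

lemma small_Collect:
  assumes "small A" "definable1 P"
  shows "small {x \<in> A. P x}"
proof -
  obtain u where u: "A = elts u"
    using assms(1) by (elim smallE)
  obtain p c where p: "\<And>s. P (s 0) = sat mem p (interleave s c)"
    using assms(2) unfolding definable1_def definable_def by blast
  obtain v where v: "\<forall>z. z \<in> elts v \<longleftrightarrow> z \<in> elts u \<and> sat mem p ((interleave undefined c)(0 := z))"
    using separation by blast
  have "(interleave undefined c)(0 := z) = interleave (undefined(0 := z)) c" for z :: 'a
    by (auto simp: interleave_def fun_eq_iff elim!: evenE)
  then have "{x \<in> A. P x} = elts v"
    using v p[of "undefined(0 := z)" for z] u by (simp add: set_eq_iff)
  then show ?thesis by simp
qed

lemma small_subset: "small A \<Longrightarrow> B \<subseteq> A \<Longrightarrow> definable1 (\<lambda>x. x \<in> B) \<Longrightarrow> small B"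
  using small_Collect[of A "\<lambda>x. x \<in> B"] by (simp add: Int_absorb1 flip: Int_def)

lemma small_doubleton: "small {x, y}"
proof -
  obtain u where "\<forall>z. z \<in> elts u \<longleftrightarrow> z = x \<or> z = y"
    using pairing by metis
  then have "{x, y} = elts u" by (simp add: set_eq_iff)
  then show ?thesis by simp
qed

lemma small_Union_elts:
  assumes "small A"
  shows "small (\<Union>x\<in>A. elts x)"
proof -
  obtain v where v: "A = elts v"
    using assms by (elim smallE)
  obtain u where "\<forall>z. z \<in> elts u \<longleftrightarrow> (\<exists>y. y \<in> elts v \<and> z \<in> elts y)"
    using union by metis
  then have "(\<Union>x\<in>A. elts x) = elts u"
    using v by auto
  then show ?thesis by simp
qed

lemma small_Pow:
  assumes "small A"
  shows "small {u. elts u \<subseteq> A}"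
proof -
  obtain v where v: "A = elts v"
    using assms by (elim smallE)
  obtain u where "\<forall>z. z \<in> elts u \<longleftrightarrow> (\<forall>y. y \<in> elts z \<longrightarrow> y \<in> elts v)"
    using power_set by metis
  then have "{u. elts u \<subseteq> A} = elts u"
    using v by auto
  then show ?thesis by simp
qed

lemma small_empty [simp]: "small {}"
  by (rule small_subset[OF small_elts]) (auto intro: definable_intros)

lemma small_Un [simp]:
  assumes "small A" "small B"
  shows "small (A \<union> B)"
  using small_Union_elts[OF small_doubleton[of "set_of A" "set_of B"]] assms by simp

lemma small_insert [simp]: "small B \<Longrightarrow> small (insert x B)"
  using small_Un[OF small_doubleton[of x x]] by simp

lemma small_Int [simp]: "small A \<Longrightarrow> small B \<Longrightarrow> small (A \<inter> B)"
  by (rule small_subset[of A]) (auto intro!: definable_intros definable_small_set)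

lemma small_Diff [simp]: "small A \<Longrightarrow> small B \<Longrightarrow> small (A - B)"
  by (rule small_subset[of A]) (auto intro!: definable_intros definable_small_set)

lemma foundation:
  assumes "small A" "x \<in> A"
  obtains y where "y \<in> A" "elts y \<inter> A = {}"
proof -
  obtain u where u: "A = elts u"
    using assms(1) by (elim smallE)
  have "\<exists>y. y \<in> elts u \<and> \<not> (\<exists>z. z \<in> elts u \<and> z \<in> elts y)"
    using regularity assms(2) u by auto
  then show thesis
    using that u by auto
qed

text \<open>Formulas of the replacement scheme have their two variables at positions 0 and 1,
  definable relations at positions 0 and 2.\<close>

lemma small_image_rel:
  assumes "small A" "definable2 R" "\<And>x. x \<in> A \<Longrightarrow> \<exists>!y. R x y"
  shows "small {y. \<exists>x\<in>A. R x y}"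
proof -
  obtain u where u: "A = elts u"
    using assms(1) by (elim smallE)
  obtain p c where p: "\<And>s. R (s 0) (s 1) = sat mem p (interleave s c)"
    using assms(2) unfolding definable2_def definable_def by blast
  define r where "r n = (if n = 1 then 2 else if n = 2 then 1 else n)" for n :: nat
  define e where "e = interleave undefined c \<circ> r"
  have "inj_on r (fm_vars p)"
    by (auto simp: inj_on_def r_def split: if_splits)
  moreover have "e(0 := y, 1 := z) \<circ> r = interleave (undefined(0 := y, 1 := z)) c" for y z
  proof
    fix n :: nat
    consider "n = 0" | "n = 1" | "n = 2" | "2 < n"
      by linarith
    then show "(e(0 := y, 1 := z) \<circ> r) n = interleave (undefined(0 := y, 1 := z)) c n"
      by cases (auto simp: e_def r_def interleave_def elim!: evenE)
  qed
  ultimately have sat_R: "sat mem (fm_rename r p) (e(0 := y, 1 := z)) \<longleftrightarrow> R y z" for y z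
    using p[of "undefined(0 := y, 1 := z)"] by (simp add: sat_rename)
  from replacement[rule_format, of u "fm_rename r p" e] obtain v where
    "\<forall>z. z \<in> elts v \<longleftrightarrow> (\<exists>y. y \<in> elts u \<and> R y z)"
    using assms(3) u unfolding sat_R by auto
  then have "{y. \<exists>x\<in>A. R x y} = elts v"
    using u by (simp add: set_eq_iff Bex_def)
  then show ?thesis by simp
qed

lemma small_image:
  assumes "small A" "definable_fun F"
  shows "small (F ` A)"
proof -
  have "definable2 (\<lambda>x y. y = F x)"
    by (intro definable_intros definable_fun_app[OF assms(2)])
  then have "small {y. \<exists>x\<in>A. y = F x}"
    by (rule small_image_rel[OF assms(1)]) simp
  then show ?thesis
    by (simp add: image_def)
qed

lemma definable_term_set_of [definable_intros]:
  assumes "definable (\<lambda>s. s 0 \<in> A (\<lambda>i. s (Suc i)))"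
  shows "definable_term (\<lambda>s. set_of (A s))"
proof -
  have tail: "definable (\<lambda>s. s 0 \<in> A (\<lambda>i. s (Suc (Suc i))))"
    using definable_rename[OF assms, of "case_nat 0 (\<lambda>i. Suc (Suc i))"]
    by (auto simp: inj_def split: nat.splits)
  have tail2: "definable (\<lambda>s. s 0 \<in> A (\<lambda>i. s (Suc (Suc (Suc i)))))"
    using definable_rename[OF assms, of "case_nat 0 (\<lambda>i. Suc (Suc (Suc i)))"]
    by (auto simp: inj_def split: nat.splits)
  have not_small: "set_of A = (THE u. False)" if "\<not> small A" for A
  proof -
    have "(\<lambda>u. \<forall>z. z \<epsilon> u \<longleftrightarrow> z \<in> A) = (\<lambda>u. False)"
      using that unfolding small_def set_eq_iff by (intro ext) (auto simp: elts_iff)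
    then show ?thesis
      unfolding set_of_def the_set_def by (rule arg_cong)
  qed
  have "u = set_of A \<longleftrightarrow> (\<forall>z. z \<in> elts u \<longleftrightarrow> z \<in> A) \<or>
      \<not> (\<exists>u. \<forall>z. z \<in> elts u \<longleftrightarrow> z \<in> A) \<and> u = (THE u. False)" for u A
  proof (cases "small A")
    case True
    then show ?thesis
      by (auto simp: small_def simp flip: set_eq_iff)
  next
    case False
    then show ?thesis
      using not_small[OF False] by (auto simp: small_def simp flip: set_eq_iff)
  qed
  then show ?thesis
    unfolding definable_term_def by simp (intro definable_intros tail tail2)
qed

lemma definable_term_the_set [definable_intros]:
  "definable (\<lambda>s. P (\<lambda>i. s (Suc i)) (s 0)) \<Longrightarrow> definable_term (\<lambda>s. the_set mem (P s))"
  unfolding the_set_eq_set_of by (intro definable_intros)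

lemma definable_small [definable_intros]:
  assumes "definable (\<lambda>s. s 0 \<in> A (\<lambda>i. s (Suc i)))"
  shows "definable (\<lambda>s. small (A s))"
proof -
  have "definable (\<lambda>s. \<forall>x. x \<in> elts (set_of (A s)) \<longleftrightarrow> x \<in> A s)"
    by (intro definable_intros assms definable_term_shift[OF definable_term_set_of[OF assms]])
  then show ?thesis
    by (simp add: small_iff_elts_set_of set_eq_iff)
qed

lemma small_UN:
  assumes "small I" "\<And>i. i \<in> I \<Longrightarrow> small (F i)" "definable2 (\<lambda>i x. x \<in> F i)"
  shows "small (\<Union>i\<in>I. F i)"
proof -
  have "definable_fun (\<lambda>i. set_of (F i))"
    by (intro definable_intros definable2_app[OF assms(3)])
  from small_Union_elts[OF small_image[OF assms(1) this]] show ?thesis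
    using assms(2) by (simp cong: SUP_cong)
qed

subsection \<open>Ordered pairs and functions\<close>

abbreviation pair :: "'a \<Rightarrow> 'a \<Rightarrow> 'a" ("\<langle>_,/ _\<rangle>") where
  "\<langle>x, y\<rangle> \<equiv> opair mem x y"

abbreviation graph :: "'a \<Rightarrow> 'a \<Rightarrow> 'a \<Rightarrow> bool" where
  "graph r \<equiv> (\<lambda>x y. \<langle>x, y\<rangle> \<in> elts r)"

lemma elts_upair [simp]: "elts (upair mem x y) = {x, y}"
proof -
  have "{z. z = x \<or> z = y} = {x, y}" by auto
  then show ?thesis
    by (simp add: upair_def the_set_eq_set_of small_doubleton)
qed

lemma upair_inject: "upair mem x y = upair mem x' y' \<longleftrightarrow> {x, y} = {x', y'}"
  by (metis elts_inject elts_upair)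

lemma pair_inject [simp]: "\<langle>x, y\<rangle> = \<langle>x', y'\<rangle> \<longleftrightarrow> x = x' \<and> y = y'"
  by (auto simp: opair_def upair_inject doubleton_eq_iff)

lemma definable_term_upair [definable_intros]:
  assumes "definable_term t" "definable_term u"
  shows "definable_term (\<lambda>s. upair mem (t s) (u s))"
  by (rule definable_fun2_app[OF _ assms]) (unfold upair_def, intro definable_intros)

lemma definable_term_pair [definable_intros]:
  "definable_term t \<Longrightarrow> definable_term u \<Longrightarrow> definable_term (\<lambda>s. \<langle>t s, u s\<rangle>)"
  unfolding opair_def by (intro definable_intros)

definition times :: "'a set \<Rightarrow> 'a set \<Rightarrow> 'a set" (infixr "\<otimes>" 80) where
  "A \<otimes> B = {p. \<exists>x y. p = \<langle>x, y\<rangle> \<and> x \<in> A \<and> y \<in> B}"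

lemma pair_in_times [simp]: "\<langle>x, y\<rangle> \<in> A \<otimes> B \<longleftrightarrow> x \<in> A \<and> y \<in> B"
  by (auto simp: times_def)

lemma in_timesE:
  assumes "p \<in> A \<otimes> B"
  obtains x y where "p = \<langle>x, y\<rangle>" "x \<in> A" "y \<in> B"
  using assms unfolding times_def by blast

lemma definable_times [definable_intros]:
  "definable (\<lambda>s. \<exists>x y. t s = \<langle>x, y\<rangle> \<and> x \<in> A s \<and> y \<in> B s) \<Longrightarrow> definable (\<lambda>s. t s \<in> A s \<otimes> B s)"
  by (simp add: times_def)

lemma small_times [simp]:
  assumes "small A" "small B"
  shows "small (A \<otimes> B)"
proof -
  have "small (\<Union>x\<in>A. pair x ` B)"
    by (rule small_UN)
      (intro assms small_image definable_intros definable_small_set[OF assms(2)])+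
  moreover have "A \<otimes> B = (\<Union>x\<in>A. pair x ` B)"
    by (auto simp: times_def)
  ultimately show ?thesis by simp
qed

lemma small_graph:
  assumes "small A" "small B" "definable2 R" "\<And>x y. R x y \<Longrightarrow> x \<in> A \<and> y \<in> B"
  obtains r where "graph r = R" "\<forall>p\<in>elts r. \<exists>x y. p = \<langle>x, y\<rangle>"
proof -
  let ?r = "{p \<in> A \<otimes> B. \<exists>x y. p = \<langle>x, y\<rangle> \<and> R x y}"
  have "small ?r"
    by (intro small_Collect small_times assms definable_intros definable2_app[OF assms(3)])
  then show thesis
    using assms(4) by (intro that[of "set_of ?r"]) (auto simp: fun_eq_iff)
qed

lemma small_field: "small {x. \<exists>y. \<langle>x, y\<rangle> \<in> elts f \<or> \<langle>y, x\<rangle> \<in> elts f}"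
proof (rule small_subset)
  show "small (\<Union>v\<in>(\<Union>u\<in>elts f. elts u). elts v)"
    by (intro small_Union_elts small_elts)
  have "upair mem x y \<in> elts \<langle>x, y\<rangle>" for x y
    by (simp add: opair_def)
  then show "{x. \<exists>y. \<langle>x, y\<rangle> \<in> elts f \<or> \<langle>y, x\<rangle> \<in> elts f} \<subseteq> (\<Union>v\<in>(\<Union>u\<in>elts f. elts u). elts v)"
    by fastforce
qed (intro definable_intros)

lemma elts_domain_of: "elts (domain_of mem f) = {x. \<exists>y. graph f x y}"
proof -
  have "small {x. \<exists>y. graph f x y}"
    by (rule small_subset[OF small_field[of f]]) (blast, intro definable_intros)
  then show ?thesis
    by (simp add: domain_of_def the_set_eq_set_of elts_iff)
qed

lemma elts_range_of: "elts (range_of mem f) = {y. \<exists>x. graph f x y}"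
proof -
  have "small {y. \<exists>x. graph f x y}"
    by (rule small_subset[OF small_field[of f]]) (blast, intro definable_intros)
  then show ?thesis
    by (simp add: range_of_def the_set_eq_set_of elts_iff)
qed

lemma is_function_iff:
  "is_function mem f \<longleftrightarrow> (\<forall>p\<in>elts f. \<exists>x y. p = \<langle>x, y\<rangle>) \<and> right_unique (graph f)"
  by (auto simp: is_function_def right_unique_def elts_iff)

lemma definable_is_function [definable_intros]:
  "definable_term t \<Longrightarrow> definable (\<lambda>s. is_function mem (t s))"
  by (rule definable1_app) (unfold is_function_def, intro definable_intros)

lemma app_eq_The_graph: "app mem f x = (THE y. graph f x y)"
  by (simp add: app_def elts_iff)

lemma graph_iff_app:
  assumes "is_function mem f"
  shows "graph f x y \<longleftrightarrow> x \<in> elts (domain_of mem f) \<and> app mem f x = y"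
proof -
  have "app mem f x = y" if "graph f x y" for y
    unfolding app_eq_The_graph using that assms
    by (intro the_equality) (auto simp: is_function_iff dest: right_uniqueD)
  then show ?thesis
    by (auto simp: elts_domain_of)
qed

lemma definable_fun_app_of_function:
  assumes "is_function mem f"
  shows "definable_fun (app mem f)"
proof -
  have "y = app mem f x \<longleftrightarrow> graph f x y \<or> \<not> (\<exists>y. graph f x y) \<and> y = (THE y. False)" for x y
  proof (cases "\<exists>y. graph f x y")
    case True
    then show ?thesis
      using graph_iff_app[OF assms, of x] by auto
  next
    case False
    then show ?thesis
      by (auto simp: app_eq_The_graph)
  qed
  then show ?thesis
    unfolding definable_fun_def definable_term_def by simp (intro definable_intros)
qed

section \<open>Recursion along membership\<close>

definition trans_set :: "'a \<Rightarrow> bool" where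
  "trans_set t \<longleftrightarrow> (\<forall>y\<in>elts t. elts y \<subseteq> elts t)"

lemma trans_setD: "trans_set t \<Longrightarrow> y \<in> elts t \<Longrightarrow> z \<in> elts y \<Longrightarrow> z \<in> elts t"
  unfolding trans_set_def by blast

lemma definable_trans_set [definable_intros]:
  "definable_term t \<Longrightarrow> definable (\<lambda>s. trans_set (t s))"
  by (rule definable1_app) (unfold trans_set_def, intro definable_intros)

lemma trans_set_induct:
  assumes "trans_set t" "x \<in> elts t" "definable1 P"
    and step: "\<And>x. x \<in> elts t \<Longrightarrow> (\<And>y. y \<in> elts x \<Longrightarrow> P y) \<Longrightarrow> P x"
  shows "P x"
proof (rule ccontr)
  let ?C = "{y \<in> elts t. \<not> P y}"
  assume "\<not> P x"
  have "small ?C"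
    by (intro small_Collect small_elts definable_intros definable1_app[OF assms(3)])
  moreover have "x \<in> ?C"
    using assms(2) \<open>\<not> P x\<close> by simp
  ultimately obtain y where "y \<in> ?C" "elts y \<inter> ?C = {}"
    by (rule foundation)
  then show False
    using step[of y] trans_setD[OF assms(1)] by blast
qed

definition recursor :: "('a \<Rightarrow> ('a \<Rightarrow> 'a \<Rightarrow> bool) \<Rightarrow> 'a) \<Rightarrow> bool" where
  "recursor G \<longleftrightarrow> definable_fun2 (\<lambda>x f. G x (graph f)) \<and>
    (\<forall>x R S. (\<forall>y\<in>elts x. \<forall>z. R y z \<longleftrightarrow> S y z) \<longrightarrow> G x R = G x S)"

context
  fixes G :: "'a \<Rightarrow> ('a \<Rightarrow> 'a \<Rightarrow> bool) \<Rightarrow> 'a"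
  assumes G: "recursor G"
begin

lemma definable_recursor: "definable_fun2 (\<lambda>x f. G x (graph f))"
  using G by (simp add: recursor_def)

lemma recursor_cong: "(\<And>y z. y \<in> elts x \<Longrightarrow> R y z \<longleftrightarrow> S y z) \<Longrightarrow> G x R = G x S"
  using G by (simp add: recursor_def)

definition attempt :: "'a \<Rightarrow> 'a \<Rightarrow> bool" where
  "attempt f t \<longleftrightarrow> trans_set t \<and> is_function mem f \<and>
    (\<forall>x y. graph f x y \<longleftrightarrow> x \<in> elts t \<and> y = G x (graph f))"

definition rec_value :: "'a \<Rightarrow> 'a \<Rightarrow> bool" where
  "rec_value x y \<longleftrightarrow> (\<exists>f t. attempt f t \<and> graph f x y)"

definition mem_rec :: "'a \<Rightarrow> 'a" where
  "mem_rec x = (if \<exists>y. rec_value x y then THE y. rec_value x y else x)"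

lemma definable_attempt:
  "definable_term t \<Longrightarrow> definable_term u \<Longrightarrow> definable (\<lambda>s. attempt (t s) (u s))"
  by (rule definable2_app)
    (unfold attempt_def, intro definable_intros definable_fun2_app[OF definable_recursor])

lemma definable_rec_value:
  "definable_term t \<Longrightarrow> definable_term u \<Longrightarrow> definable (\<lambda>s. rec_value (t s) (u s))"
  by (rule definable2_app) (unfold rec_value_def, intro definable_intros definable_attempt)

lemma attempt_graph_iff: "attempt f t \<Longrightarrow> graph f x y \<longleftrightarrow> x \<in> elts t \<and> y = G x (graph f)"
  unfolding attempt_def by blast

lemma domain_of_attempt:
  assumes "attempt f t"
  shows "domain_of mem f = t"
proof (rule elts_eqI)
  show "x \<in> elts (domain_of mem f) \<longleftrightarrow> x \<in> elts t" for x
    unfolding elts_domain_of using attempt_graph_iff[OF assms, of x] by blast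
qed

lemma attempts_agree:
  assumes f: "attempt f t" and g: "attempt g u" and x: "x \<in> elts t" "x \<in> elts u"
  shows "graph f x y \<longleftrightarrow> graph g x y"
proof -
  have t: "trans_set t" and u: "trans_set u"
    using f g unfolding attempt_def by blast+
  have "x \<in> elts u \<longrightarrow> (\<forall>y. graph f x y \<longleftrightarrow> graph g x y)"
  proof (rule trans_set_induct[OF t x(1)])
    show "definable1 (\<lambda>x. x \<in> elts u \<longrightarrow> (\<forall>y. graph f x y \<longleftrightarrow> graph g x y))"
      by (intro definable_intros)
  next
    fix x
    assume "x \<in> elts t" and IH: "\<And>w. w \<in> elts x \<Longrightarrow> w \<in> elts u \<longrightarrow> (\<forall>y. graph f w y \<longleftrightarrow> graph g w y)"
    show "x \<in> elts u \<longrightarrow> (\<forall>y. graph f x y \<longleftrightarrow> graph g x y)"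
    proof
      assume "x \<in> elts u"
      then have "G x (graph f) = G x (graph g)"
        using IH trans_setD[OF u] by (intro recursor_cong) blast
      then show "\<forall>y. graph f x y \<longleftrightarrow> graph g x y"
        using \<open>x \<in> elts t\<close> \<open>x \<in> elts u\<close>
        unfolding attempt_graph_iff[OF f, of x] attempt_graph_iff[OF g, of x] by simp
    qed
  qed
  then show ?thesis
    using x(2) by blast
qed

lemma rec_value_iff_attempt:
  assumes "attempt f t" "x \<in> elts t"
  shows "rec_value x y \<longleftrightarrow> graph f x y"
proof
  assume "rec_value x y"
  then obtain g u where g: "attempt g u" "graph g x y"
    unfolding rec_value_def by blast
  then have "x \<in> elts u"
    unfolding attempt_def by blast
  then show "graph f x y"
    using attempts_agree[OF assms(1) g(1) assms(2)] g(2) by blast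
qed (use assms in \<open>auto simp: rec_value_def\<close>)

lemma rec_valueD:
  assumes "rec_value x y"
  shows "y = G x rec_value" and "\<And>w. w \<in> elts x \<Longrightarrow> \<exists>z. rec_value w z"
proof -
  obtain f t where f: "attempt f t" and xy: "graph f x y"
    using assms unfolding rec_value_def by blast
  then have x: "x \<in> elts t" "y = G x (graph f)" and t: "trans_set t"
    unfolding attempt_def by blast+
  have rec_value: "rec_value w z \<longleftrightarrow> graph f w z" if "w \<in> elts x" for w z
    using rec_value_iff_attempt[OF f trans_setD[OF t x(1) that]] .
  then have "G x (graph f) = G x rec_value"
    by (intro recursor_cong) blast
  with x(2) show "y = G x rec_value" by simp
  show "\<exists>z. rec_value w z" if "w \<in> elts x" for w
  proof -
    have "w \<in> elts t"
      using trans_setD[OF t x(1) that] .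
    then have "graph f w (G w (graph f))"
      unfolding attempt_graph_iff[OF f, of w] by blast
    then show ?thesis
      using rec_value[OF that] by blast
  qed
qed

lemma rec_value_set:
  assumes "small T" "\<And>z. z \<in> T \<Longrightarrow> \<exists>k. rec_value z k"
  obtains f where "elts f = {p. \<exists>z\<in>T. \<exists>k. rec_value z k \<and> p = \<langle>z, k\<rangle>}"
proof -
  have "definable2 (\<lambda>z p. \<exists>k. rec_value z k \<and> p = \<langle>z, k\<rangle>)"
    by (intro definable_intros definable_rec_value)
  moreover have "\<exists>!p. \<exists>k. rec_value z k \<and> p = \<langle>z, k\<rangle>" if "z \<in> T" for z
    using assms(2)[OF that] rec_valueD(1) by metis
  ultimately have "small {p. \<exists>z\<in>T. \<exists>k. rec_value z k \<and> p = \<langle>z, k\<rangle>}"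
    by (rule small_image_rel[OF assms(1)])
  then show thesis
    using that elts_set_of by blast
qed

lemma attempt_extends:
  assumes T: "small T" "x \<notin> T" "\<And>z. z \<in> T \<Longrightarrow> \<exists>k. rec_value z k"
    and below: "\<And>y z. y \<in> insert x T \<Longrightarrow> z \<in> elts y \<Longrightarrow> z \<in> T"
  shows "\<exists>y. rec_value x y"
proof -
  obtain g where g: "elts g = {p. \<exists>z\<in>T. \<exists>k. rec_value z k \<and> p = \<langle>z, k\<rangle>}"
    using rec_value_set[OF T(1,3)] .
  define f where "f = set_of (insert \<langle>x, G x (graph g)\<rangle> (elts g))"
  define u where "u = set_of (insert x T)"
  have u: "elts u = insert x T" and f: "elts f = insert \<langle>x, G x (graph g)\<rangle> (elts g)"
    using T(1) by (simp_all add: u_def f_def)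
  have graph_g: "graph g y z \<longleftrightarrow> y \<in> T \<and> rec_value y z" for y z
    by (auto simp: g)
  have graph_f: "graph f y z \<longleftrightarrow> y = x \<and> z = G x (graph g) \<or> y \<in> T \<and> rec_value y z" for y z
    unfolding f insert_iff graph_g by simp
  have "G y (graph f) = G y rec_value" if "y \<in> T" for y
    using below[of y] that T(2) by (intro recursor_cong) (auto simp: graph_f)
  moreover have "G x (graph f) = G x (graph g)"
    using below[of x] T(2) by (intro recursor_cong) (auto simp: graph_f graph_g)
  moreover have "rec_value y z \<longleftrightarrow> z = G y rec_value" if "y \<in> T" for y z
    using T(3)[OF that] rec_valueD(1) by blast
  ultimately have "graph f y z \<longleftrightarrow> y \<in> elts u \<and> z = G y (graph f)" for y z
    using T(2) graph_f[of y z] unfolding u by auto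
  moreover have "right_unique (graph f)"
    unfolding right_unique_def graph_f using T(2) rec_valueD(1) by blast
  then have "is_function mem f"
    unfolding is_function_iff f g by blast
  moreover have "trans_set u"
    using below unfolding trans_set_def u by blast
  ultimately have "attempt f u \<and> graph f x (G x (graph f))"
    unfolding attempt_def u by blast
  then show ?thesis
    unfolding rec_value_def by blast
qed

lemma rec_value_exists:
  assumes t: "trans_set t" and x: "x \<in> elts t"
  shows "\<exists>y. rec_value x y"
proof (rule trans_set_induct[OF t x])
  show "definable1 (\<lambda>x. \<exists>y. rec_value x y)"
    by (intro definable_intros definable_rec_value)
next
  fix x
  assume "x \<in> elts t" and IH: "\<And>y. y \<in> elts x \<Longrightarrow> \<exists>z. rec_value y z"
  show "\<exists>y. rec_value x y"
  proof (rule ccontr)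
    assume no_value: "\<nexists>y. rec_value x y"
    define T where "T = {z \<in> elts t. \<exists>k. rec_value z k}"
    have "small T"
      unfolding T_def by (intro small_Collect small_elts definable_intros definable_rec_value)
    moreover have "x \<notin> T" "\<And>z. z \<in> T \<Longrightarrow> \<exists>k. rec_value z k"
      using no_value unfolding T_def by blast+
    moreover have "z \<in> T" if "y \<in> insert x T" "z \<in> elts y" for y z
      using that \<open>x \<in> elts t\<close> IH rec_valueD(2) trans_setD[OF t] unfolding T_def by blast
    ultimately have "\<exists>y. rec_value x y"
      by (rule attempt_extends)
    then show False
      using no_value by blast
  qed
qed

lemma rec_value_eq_singleton: "rec_value x z \<Longrightarrow> rec_value x = (\<lambda>y. y = z)"
  using rec_valueD(1) by (metis (full_types))

lemma rec_value_iff: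
  assumes "trans_set t" "x \<in> elts t"
  shows "rec_value x y \<longleftrightarrow> y = mem_rec x"
proof -
  obtain z where "rec_value x z"
    using rec_value_exists[OF assms] by blast
  then have "rec_value x = (\<lambda>y. y = z)"
    by (rule rec_value_eq_singleton)
  then show ?thesis
    by (simp add: mem_rec_def)
qed

lemma mem_rec:
  assumes t: "trans_set t" and x: "x \<in> elts t"
  shows "mem_rec x = G x (\<lambda>y z. z = mem_rec y)"
proof -
  have "mem_rec x = G x rec_value"
    using rec_value_iff[OF t x] rec_valueD(1) by blast
  also have "\<dots> = G x (\<lambda>y z. z = mem_rec y)"
    using rec_value_iff[OF t trans_setD[OF t x]] by (rule recursor_cong)
  finally show ?thesis .
qed

lemma definable_mem_rec: "definable_fun mem_rec"
proof -
  have "y = mem_rec x \<longleftrightarrow> rec_value x y \<or> \<not> (\<exists>y. rec_value x y) \<and> y = x" for x y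
  proof (cases "\<exists>y. rec_value x y")
    case True
    then obtain z where "rec_value x = (\<lambda>y. y = z)"
      using rec_value_eq_singleton by blast
    then show ?thesis
      by (simp add: mem_rec_def)
  qed (auto simp: mem_rec_def)
  then show ?thesis
    unfolding definable_fun_def definable_term_def
    by simp (intro definable_intros definable_rec_value)
qed

end

section \<open>The natural numbers of the structure\<close>

abbreviation zero_nat :: 'a ("\<zero>") where "\<zero> \<equiv> zero mem"
abbreviation suc :: "'a \<Rightarrow> 'a" where "suc \<equiv> succ mem"
abbreviation one_nat :: 'a ("\<one>") where "\<one> \<equiv> suc \<zero>"
abbreviation nats :: "'a set" ("\<omega>") where "\<omega> \<equiv> elts (omega mem)"

lemma elts_zero [simp]: "elts \<zero> = {}"
  by (simp add: zero_def the_set_eq_set_of)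

lemma elts_suc [simp]: "elts (suc x) = insert x (elts x)"
proof -
  have "{z. z \<in> elts x \<or> z = x} = insert x (elts x)" by auto
  then show ?thesis
    by (simp add: succ_def the_set_eq_set_of elts_iff)
qed

lemma definable_term_suc [definable_intros]:
  "definable_term t \<Longrightarrow> definable_term (\<lambda>s. suc (t s))"
  by (rule definable_fun_app) (unfold succ_def, intro definable_intros)

definition successor_closed :: "'a \<Rightarrow> bool" where
  "successor_closed u \<longleftrightarrow> \<zero> \<in> elts u \<and> (\<forall>k\<in>elts u. suc k \<in> elts u)"

lemma successor_closed_exists: "\<exists>u. successor_closed u"
proof -
  obtain e u where e: "e \<in> elts u" "\<forall>z. z \<notin> elts e"
    and u: "\<forall>n. n \<in> elts u \<longrightarrow> (\<exists>m. m \<in> elts u \<and> (\<forall>z. z \<in> elts m \<longleftrightarrow> z \<in> elts n \<or> z = n))"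
    using infinity by (elim exE conjE) (rule that)
  have "e = \<zero>"
    by (rule elts_eqI) (simp add: e(2))
  moreover have "suc n \<in> elts u" if n: "n \<in> elts u" for n
  proof -
    obtain m where m: "m \<in> elts u" "\<And>z. z \<in> elts m \<longleftrightarrow> z \<in> elts n \<or> z = n"
      using u[rule_format, OF n] by blast
    then have "m = suc n"
      by (intro elts_eqI) (simp add: m(2) disj_commute)
    then show ?thesis
      using m(1) by simp
  qed
  ultimately have "successor_closed u"
    using e(1) by (simp add: successor_closed_def)
  then show ?thesis ..
qed

lemma in_omega_iff: "n \<in> \<omega> \<longleftrightarrow> (\<forall>u. successor_closed u \<longrightarrow> n \<in> elts u)"
proof -
  obtain u where u: "successor_closed u"
    using successor_closed_exists by blast
  have "small {n. \<forall>u. successor_closed u \<longrightarrow> n \<in> elts u}"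
  proof (rule small_subset[OF small_elts[of u]])
    show "definable1 (\<lambda>n. n \<in> {n. \<forall>u. successor_closed u \<longrightarrow> n \<in> elts u})"
      unfolding successor_closed_def by (intro definable_intros)
  qed (use u in blast)
  moreover have "omega mem = set_of {n. \<forall>u. successor_closed u \<longrightarrow> n \<in> elts u}"
    by (simp add: elts_iff omega_def the_set_eq_set_of successor_closed_def Ball_def)
  ultimately show ?thesis
    by simp
qed

lemma zero_in_omega [simp]: "\<zero> \<in> \<omega>"
  by (simp add: in_omega_iff successor_closed_def)

lemma suc_in_omega [simp]: "n \<in> \<omega> \<Longrightarrow> suc n \<in> \<omega>"
  by (simp add: in_omega_iff successor_closed_def)

lemma omega_induct [consumes 1, case_names definable zero suc]:
  assumes "n \<in> \<omega>" "definable1 P" "P \<zero>" "\<And>n. n \<in> \<omega> \<Longrightarrow> P n \<Longrightarrow> P (suc n)"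
  shows "P n"
proof -
  have small: "small {n \<in> \<omega>. P n}"
    by (intro small_Collect small_elts assms(2))
  then have "successor_closed (set_of {n \<in> \<omega>. P n})"
    unfolding successor_closed_def using assms(3,4) by simp
  then show ?thesis
    using assms(1) small unfolding in_omega_iff[of n] by fastforce
qed

lemma mem_irrefl [simp]: "x \<notin> elts x"
  by (rule foundation[of "{x}" x]) auto

lemma mem_asym: "x \<in> elts y \<Longrightarrow> y \<notin> elts x"
  by (rule foundation[of "{x, y}" x]) auto

lemma suc_inject [simp]: "suc x = suc y \<longleftrightarrow> x = y"
  by (metis elts_suc insertE insertI1 mem_asym)

lemma suc_neq_zero [simp]: "suc x \<noteq> \<zero>" "\<zero> \<noteq> suc x"
  by (metis elts_suc elts_zero insert_not_empty)+

lemma suc_neq_self [simp]: "suc x \<noteq> x" "x \<noteq> suc x"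
  by (metis elts_suc insertI1 mem_irrefl)+

lemma omega_cases:
  assumes "n \<in> \<omega>"
  obtains (zero) "n = \<zero>" | (successor) m where "m \<in> \<omega>" "n = suc m"
proof -
  have "n = \<zero> \<or> (\<exists>m\<in>\<omega>. n = suc m)"
    using assms
  proof (induction rule: omega_induct)
    case definable
    show ?case by (intro definable_intros)
  qed auto
  then show thesis
    using that by blast
qed

lemma trans_set_omega: "trans_set (omega mem)"
proof -
  have "elts n \<subseteq> \<omega>" if "n \<in> \<omega>" for n
    using that
  proof (induction rule: omega_induct)
    case definable
    show ?case by (intro definable_intros)
  qed auto
  then show ?thesis
    unfolding trans_set_def by blast
qed

lemma zero_in_suc:
  assumes "n \<in> \<omega>"
  shows "\<zero> \<in> elts (suc n)"
  using assms
proof (induction rule: omega_induct)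
  case definable
  show ?case by (intro definable_intros)
qed simp_all

lemma suc_mono:
  assumes "n \<in> \<omega>" "k \<in> elts n"
  shows "suc k \<in> elts (suc n)"
proof -
  have "\<forall>k\<in>elts n. suc k \<in> elts (suc n)"
    using assms(1)
  proof (induction rule: omega_induct)
    case definable
    show ?case by (intro definable_intros)
  next
    case (suc n)
    then show ?case by simp
  qed simp
  then show ?thesis
    using assms(2) by blast
qed

lemma omega_linear:
  assumes "m \<in> \<omega>" "n \<in> \<omega>"
  shows "m \<in> elts n \<or> m = n \<or> n \<in> elts m"
  using assms(2)
proof (induction rule: omega_induct)
  case definable
  show ?case by (intro definable_intros)
next
  case zero
  show ?case
    using zero_in_suc[OF assms(1)] by auto
next
  case (suc n)
  then show ?case
    using suc_mono[OF assms(1), of n] by auto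
qed

definition omega_rec_step :: "('a \<Rightarrow> 'a \<Rightarrow> 'a) \<Rightarrow> 'a \<Rightarrow> 'a \<Rightarrow> ('a \<Rightarrow> 'a \<Rightarrow> bool) \<Rightarrow> 'a" where
  "omega_rec_step H a x R = set_of {z. x = \<zero> \<and> z \<in> elts a \<or>
    (\<exists>n k. n \<in> elts x \<and> x = suc n \<and> R n k \<and> z \<in> elts (H n k))}"

definition omega_rec :: "('a \<Rightarrow> 'a \<Rightarrow> 'a) \<Rightarrow> 'a \<Rightarrow> 'a \<Rightarrow> 'a" where
  "omega_rec H a = mem_rec (omega_rec_step H a)"

lemma
  assumes "definable_fun2 H"
  shows definable_omega_rec: "definable_fun (omega_rec H a)"
    and omega_rec_zero: "omega_rec H a \<zero> = a"
    and omega_rec_suc: "n \<in> \<omega> \<Longrightarrow> omega_rec H a (suc n) = H n (omega_rec H a n)"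
proof -
  have "definable_fun2 (\<lambda>x f. omega_rec_step H a x (graph f))"
    unfolding omega_rec_step_def by (intro definable_intros definable_fun2_app[OF assms])
  then have recursor: "recursor (omega_rec_step H a)"
    unfolding recursor_def omega_rec_step_def
    by (intro conjI allI impI arg_cong[where f = set_of]) blast+
  show "definable_fun (omega_rec H a)"
    unfolding omega_rec_def by (rule definable_mem_rec[OF recursor])
  have rec: "omega_rec H a n = omega_rec_step H a n (\<lambda>y z. z = omega_rec H a y)" if "n \<in> \<omega>" for n
    unfolding omega_rec_def by (rule mem_rec[OF recursor trans_set_omega that])
  show "omega_rec H a \<zero> = a"
    using rec[of \<zero>] by (simp add: omega_rec_step_def)
  show "omega_rec H a (suc n) = H n (omega_rec H a n)" if "n \<in> \<omega>"
  proof -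
    have "{z. \<exists>m k. m \<in> elts (suc n) \<and> suc n = suc m \<and> k = omega_rec H a m \<and> z \<in> elts (H m k)} =
        elts (H n (omega_rec H a n))"
      by auto
    then show ?thesis
      using rec[of "suc n"] that by (simp add: omega_rec_step_def)
  qed
qed

lemma trans_set_exists: "\<exists>t. trans_set t \<and> x \<in> elts t"
proof -
  define H where "H n u = set_of (\<Union>y\<in>elts u. elts y)" for n u :: 'a
  define F where "F = omega_rec H (set_of {x})"
  have H: "definable_fun2 H"
    unfolding H_def by (intro definable_intros)
  have F: "definable_fun F" "elts (F \<zero>) = {x}"
    unfolding F_def by (simp_all add: definable_omega_rec[OF H] omega_rec_zero[OF H])
  have F_suc: "elts (F (suc n)) = (\<Union>y\<in>elts (F n). elts y)" if "n \<in> \<omega>" for n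
    unfolding F_def by (simp add: omega_rec_suc[OF H that] H_def small_Union_elts)
  have "small (\<Union>n\<in>\<omega>. elts (F n))"
    by (intro small_UN small_elts definable_intros definable_fun_app[OF F(1)])
  then obtain t where t: "elts t = (\<Union>n\<in>\<omega>. elts (F n))"
    by (metis elts_set_of)
  have "z \<in> elts t" if "y \<in> elts t" "z \<in> elts y" for y z
  proof -
    obtain n where n: "n \<in> \<omega>" "y \<in> elts (F n)"
      using \<open>y \<in> elts t\<close> by (auto simp: t)
    then have "z \<in> elts (F (suc n))"
      using F_suc \<open>z \<in> elts y\<close> by auto
    then show ?thesis
      using suc_in_omega[OF n(1)] unfolding t by blast
  qed
  then have "trans_set t"
    unfolding trans_set_def by blast
  moreover have "x \<in> elts t"
    using F(2) zero_in_omega unfolding t by blast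
  ultimately show ?thesis by blast
qed

lemma mem_induct [case_names definable step]:
  assumes "definable1 P" "\<And>x. (\<And>y. y \<in> elts x \<Longrightarrow> P y) \<Longrightarrow> P x"
  shows "P x"
  using trans_set_exists[of x] trans_set_induct assms by metis

subsection \<open>Sequences\<close>

lemma sequence_iff: "sequence mem f \<longleftrightarrow> is_function mem f \<and> (\<forall>n. n \<in> \<omega> \<longleftrightarrow> (\<exists>y. graph f n y))"
  unfolding sequence_def elts_inject[symmetric] elts_domain_of by (auto simp: set_eq_iff)

lemma sequence_graph_iff: "sequence mem f \<Longrightarrow> graph f n y \<longleftrightarrow> n \<in> \<omega> \<and> app mem f n = y"
  using graph_iff_app by (simp add: sequence_def)

lemma definable_fun_app_sequence: "sequence mem f \<Longrightarrow> definable_fun (app mem f)"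
  by (simp add: sequence_def definable_fun_app_of_function)

lemma app_outside_omega: "sequence mem f \<Longrightarrow> n \<notin> \<omega> \<Longrightarrow> app mem f n = (THE y. False)"
  by (subst app_eq_The_graph) (simp add: sequence_graph_iff)

lemma elts_seq_of:
  assumes "definable_fun t"
  shows "elts (seq_of mem t) = (\<lambda>n. \<langle>n, t n\<rangle>) ` \<omega>"
proof -
  have "{p. \<exists>n. n \<in> \<omega> \<and> p = \<langle>n, t n\<rangle>} = (\<lambda>n. \<langle>n, t n\<rangle>) ` \<omega>" by auto
  moreover have "small ((\<lambda>n. \<langle>n, t n\<rangle>) ` \<omega>)"
    by (intro small_image small_elts definable_intros definable_fun_app[OF assms])
  ultimately show ?thesis
    by (simp add: seq_of_def the_set_eq_set_of elts_iff)
qed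

lemma
  assumes "definable_fun t"
  shows sequence_seq_of: "sequence mem (seq_of mem t)"
    and app_seq_of: "n \<in> \<omega> \<Longrightarrow> app mem (seq_of mem t) n = t n"
proof -
  show seq: "sequence mem (seq_of mem t)"
    unfolding sequence_iff is_function_iff elts_seq_of[OF assms] by (auto simp: right_unique_def)
  show "app mem (seq_of mem t) n = t n" if "n \<in> \<omega>"
    using sequence_graph_iff[OF seq, of n "t n"] that by (auto simp: elts_seq_of[OF assms])
qed

lemma seq_of_cong: "(\<And>n. n \<in> \<omega> \<Longrightarrow> t n = t' n) \<Longrightarrow> seq_of mem t = seq_of mem t'"
  unfolding seq_of_def by (intro arg_cong[where f = "the_set mem"] ext) (auto simp: elts_iff)

subsection \<open>Addition\<close>

abbreviation add_nat :: "'a \<Rightarrow> 'a \<Rightarrow> 'a" (infixl "+\<^sub>\<omega>" 65) where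
  "m +\<^sub>\<omega> n \<equiv> nat_add mem m n"

definition counts_from :: "'a \<Rightarrow> 'a \<Rightarrow> bool" where
  "counts_from m f \<longleftrightarrow> sequence mem f \<and> app mem f \<zero> = m \<and>
    (\<forall>i\<in>\<omega>. app mem f (suc i) = suc (app mem f i))"

lemma counts_from_exists: "\<exists>f. counts_from m f"
proof -
  let ?F = "omega_rec (\<lambda>_. suc) m"
  have suc: "definable_fun2 (\<lambda>_. suc)"
    by (intro definable_intros)
  have "counts_from m (seq_of mem ?F)"
    unfolding counts_from_def
    using sequence_seq_of[OF definable_omega_rec[OF suc]]
    by (simp add: app_seq_of[OF definable_omega_rec[OF suc]] omega_rec_zero[OF suc]
        omega_rec_suc[OF suc])
  then show ?thesis ..
qed

lemma counts_from_unique: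
  assumes f: "counts_from m f" and g: "counts_from m g"
  shows "app mem f n = app mem g n"
proof (cases "n \<in> \<omega>")
  have seq: "definable_fun (app mem f)" "definable_fun (app mem g)"
    using f g by (simp_all add: counts_from_def definable_fun_app_sequence)
  case True
  then show ?thesis
  proof (induction rule: omega_induct)
    case definable
    show ?case
      by (intro definable_intros definable_fun_app[OF seq(1)] definable_fun_app[OF seq(2)])
  qed (use f g in \<open>simp_all add: counts_from_def\<close>)
next
  case False
  then show ?thesis
    using f g app_outside_omega by (simp add: counts_from_def)
qed

lemma nat_add_eq_app:
  assumes "counts_from m f"
  shows "m +\<^sub>\<omega> n = app mem f n"
proof -
  have "m +\<^sub>\<omega> n = (THE k. \<exists>f. counts_from m f \<and> k = app mem f n)"
    by (simp add: nat_add_def counts_from_def elts_iff Ball_def)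
  also have "\<dots> = app mem f n"
    using assms counts_from_unique by (intro the_equality) blast+
  finally show ?thesis .
qed

lemma nat_add_zero [simp]: "m +\<^sub>\<omega> \<zero> = m"
  and nat_add_suc [simp]: "n \<in> \<omega> \<Longrightarrow> m +\<^sub>\<omega> suc n = suc (m +\<^sub>\<omega> n)"
proof -
  obtain f where "counts_from m f"
    using counts_from_exists by blast
  then show "m +\<^sub>\<omega> \<zero> = m" "n \<in> \<omega> \<Longrightarrow> m +\<^sub>\<omega> suc n = suc (m +\<^sub>\<omega> n)"
    by (simp_all add: nat_add_eq_app counts_from_def)
qed

text \<open>For \<open>n\<close> outside \<open>\<omega>\<close> the sum \<open>m +\<^sub>\<omega> n\<close> is a junk value that does not depend on \<open>m\<close>.\<close>

lemma definable_term_nat_add [definable_intros]: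
  assumes "definable_term t" "definable_term u"
  shows "definable_term (\<lambda>s. t s +\<^sub>\<omega> u s)"
proof (rule definable_fun2_app[OF _ assms])
  have counts_from_iff: "counts_from m f \<longleftrightarrow>
      is_function mem f \<and> (\<forall>n. n \<in> \<omega> \<longleftrightarrow> (\<exists>y. graph f n y)) \<and> graph f \<zero> m \<and>
      (\<forall>i\<in>\<omega>. \<forall>j. graph f i j \<longrightarrow> graph f (suc i) (suc j))" for m f
  proof (cases "sequence mem f")
    case True
    then show ?thesis
      unfolding counts_from_def sequence_graph_iff[OF True] by (auto simp: sequence_iff)
  qed (auto simp: counts_from_def sequence_iff)
  have "y = m +\<^sub>\<omega> n \<longleftrightarrow> (\<exists>f. counts_from m f \<and> (graph f n y \<or> n \<notin> \<omega> \<and> y = (THE y. False)))"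
    for y m n
  proof -
    have "y = m +\<^sub>\<omega> n \<longleftrightarrow> graph f n y \<or> n \<notin> \<omega> \<and> y = (THE y. False)" if "counts_from m f" for f
      using that app_outside_omega[of f n] sequence_graph_iff[of f n y]
      by (auto simp: nat_add_eq_app[OF that] counts_from_def)
    then show ?thesis
      using counts_from_exists by blast
  qed
  then show "definable_fun2 (+\<^sub>\<omega>)"
    unfolding definable_fun2_def definable_term_def counts_from_iff
    by simp (intro definable_intros)
qed

lemma nat_add_in_omega [simp]:
  assumes "m \<in> \<omega>" "n \<in> \<omega>"
  shows "m +\<^sub>\<omega> n \<in> \<omega>"
  using assms(2)
proof (induction rule: omega_induct)
  case definable
  show ?case by (intro definable_intros)
qed (use assms(1) in simp_all)

lemma nat_add_suc_left [simp]:
  assumes "n \<in> \<omega>"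
  shows "suc m +\<^sub>\<omega> n = suc (m +\<^sub>\<omega> n)"
  using assms
proof (induction rule: omega_induct)
  case definable
  show ?case by (intro definable_intros)
qed simp_all

lemma nat_add_zero_left [simp]:
  assumes "n \<in> \<omega>"
  shows "\<zero> +\<^sub>\<omega> n = n"
  using assms
proof (induction rule: omega_induct)
  case definable
  show ?case by (intro definable_intros)
qed simp_all

lemma omega_le_cases:
  assumes "m \<in> \<omega>" "n \<in> \<omega>"
  obtains (le) i where "i \<in> \<omega>" "n = m +\<^sub>\<omega> i" | (ge) i where "i \<in> \<omega>" "m = n +\<^sub>\<omega> i"
proof -
  have "(\<exists>i\<in>\<omega>. n = m +\<^sub>\<omega> i) \<or> (\<exists>i\<in>\<omega>. m = n +\<^sub>\<omega> i)"
    using assms(2)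
  proof (induction rule: omega_induct)
    case definable
    show ?case by (intro definable_intros)
  next
    case zero
    show ?case
      using assms(1) by (intro disjI2 bexI[of _ m]) simp_all
  next
    case (suc n)
    then consider (le) i where "i \<in> \<omega>" "n = m +\<^sub>\<omega> i" | (eq) "m = n"
      | (gt) i where "i \<in> \<omega>" "m = n +\<^sub>\<omega> suc i"
      by (metis nat_add_zero omega_cases)
    then show ?case
    proof cases
      case (le i)
      then show ?thesis by (intro disjI1 bexI[of _ "suc i"]) simp_all
    next
      case eq
      then show ?thesis by (intro disjI1 bexI[of _ \<one>]) simp_all
    next
      case (gt i)
      then show ?thesis by (intro disjI2 bexI[of _ i]) simp_all
    qed
  qed
  then show thesis
    using that by blast
qed

section \<open>Rank and Scott's trick\<close>

definition rank_step :: "'a \<Rightarrow> ('a \<Rightarrow> 'a \<Rightarrow> bool) \<Rightarrow> 'a" where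
  "rank_step x R = set_of {z. \<exists>y\<in>elts x. \<exists>k. R y k \<and> z \<in> elts (suc k)}"

lemma recursor_rank_step: "recursor rank_step"
proof -
  have "definable_fun2 (\<lambda>x f. rank_step x (graph f))"
    unfolding rank_step_def by (intro definable_intros)
  then show ?thesis
    unfolding recursor_def rank_step_def
    by (intro conjI allI impI arg_cong[where f = set_of]) blast+
qed

lemmas rank_attempt_def = attempt_def[OF recursor_rank_step]
  and rank_value_def = rec_value_def[OF recursor_rank_step]

lemma small_rank_step_graph:
  assumes "right_unique (graph f)"
  shows "small {z. \<exists>y\<in>elts x. \<exists>k. graph f y k \<and> z \<in> elts (suc k)}"
proof -
  have "small (\<Union>y\<in>elts x. {z. \<exists>k. graph f y k \<and> z \<in> elts (suc k)})"
  proof (rule small_UN[OF small_elts])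
    show "small {z. \<exists>k. graph f y k \<and> z \<in> elts (suc k)}" for y
    proof (cases "\<exists>k. graph f y k")
      case True
      then obtain k where "graph f y k" ..
      then have "{z. \<exists>k. graph f y k \<and> z \<in> elts (suc k)} = elts (suc k)"
        using right_uniqueD[OF assms] by blast
      then show ?thesis
        using small_elts[of "suc k"] by simp
    qed simp
  qed (intro definable_intros)
  then show ?thesis
    by (simp add: UNION_eq Bex_def)
qed

lemma rank_function_iff: "rank_function mem r t \<longleftrightarrow> is_function mem r \<and> domain_of mem r = t \<and>
    (\<forall>x\<in>elts t. \<forall>z. z \<in> elts (app mem r x) \<longleftrightarrow> (\<exists>y\<in>elts x. z \<in> elts (suc (app mem r y))))"
  by (simp add: rank_function_def elts_iff Ball_def Bex_def del: elts_suc)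

lemma rank_function_iff_attempt:
  assumes "trans_set t"
  shows "rank_function mem r t \<longleftrightarrow> attempt rank_step r t"
proof (cases "is_function mem r \<and> domain_of mem r = t")
  case True
  then have r: "is_function mem r" and app: "\<And>x y. graph r x y \<longleftrightarrow> x \<in> elts t \<and> app mem r x = y"
    using graph_iff_app by auto
  have step: "(\<forall>z. z \<in> elts (app mem r x) \<longleftrightarrow> (\<exists>y\<in>elts x. z \<in> elts (suc (app mem r y)))) \<longleftrightarrow>
      app mem r x = rank_step x (graph r)" if "x \<in> elts t" for x
  proof -
    have "elts (rank_step x (graph r)) = {z. \<exists>y\<in>elts x. \<exists>k. graph r y k \<and> z \<in> elts (suc k)}"
      using small_rank_step_graph r by (simp add: rank_step_def is_function_iff del: elts_suc)
    also have "\<dots> = {z. \<exists>y\<in>elts x. z \<in> elts (suc (app mem r y))}"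
      using trans_setD[OF assms that] unfolding app by blast
    finally have "z \<in> elts (rank_step x (graph r)) \<longleftrightarrow> (\<exists>y\<in>elts x. z \<in> elts (suc (app mem r y)))" for z
      by blast
    then show ?thesis
      using elts_eqI[of "app mem r x" "rank_step x (graph r)"] by metis
  qed
  have "rank_function mem r t \<longleftrightarrow> (\<forall>x\<in>elts t. app mem r x = rank_step x (graph r))"
    unfolding rank_function_iff using True step by blast
  also have "\<dots> \<longleftrightarrow> (\<forall>x y. graph r x y \<longleftrightarrow> x \<in> elts t \<and> y = rank_step x (graph r))"
    using app by metis
  also have "\<dots> \<longleftrightarrow> attempt rank_step r t"
    unfolding rank_attempt_def using assms r by blast
  finally show ?thesis .
next
  case False
  moreover have "is_function mem r \<and> domain_of mem r = t" if "attempt rank_step r t"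
  proof
    show "is_function mem r"
      using that unfolding rank_attempt_def by blast
    show "domain_of mem r = t"
      by (rule domain_of_attempt[OF recursor_rank_step that])
  qed
  ultimately show ?thesis
    unfolding rank_function_iff by blast
qed

lemma rank_attempt_graph_iff:
  assumes "attempt rank_step r t"
  shows "graph r x k \<longleftrightarrow> x \<in> elts t \<and> k = app mem r x"
proof -
  have "is_function mem r"
    using assms unfolding rank_attempt_def by blast
  then show ?thesis
    using graph_iff_app[of r x k] domain_of_attempt[OF recursor_rank_step assms] by auto
qed

lemma rank_eq_mem_rec: "rank mem x = mem_rec rank_step x"
proof -
  have "rank mem x = (THE k. \<exists>t r. trans_set t \<and> x \<in> elts t \<and> rank_function mem r t \<and> k = app mem r x)"
    by (simp add: rank_def trans_set_def elts_iff Ball_def)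
  also have "\<dots> = (THE k. rec_value rank_step x k)"
  proof (rule arg_cong[where f = The], rule ext, rule iffI)
    fix k
    assume "\<exists>t r. trans_set t \<and> x \<in> elts t \<and> rank_function mem r t \<and> k = app mem r x"
    then obtain t r where "attempt rank_step r t" "x \<in> elts t" "k = app mem r x"
      using rank_function_iff_attempt by blast
    then show "rec_value rank_step x k"
      unfolding rank_value_def using rank_attempt_graph_iff by blast
  next
    fix k
    assume "rec_value rank_step x k"
    then obtain r t where r: "attempt rank_step r t" "graph r x k"
      unfolding rank_value_def by blast
    then have "trans_set t"
      unfolding rank_attempt_def by blast
    then show "\<exists>t r. trans_set t \<and> x \<in> elts t \<and> rank_function mem r t \<and> k = app mem r x"
      using r rank_attempt_graph_iff[OF r(1)] rank_function_iff_attempt by blast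
  qed
  also obtain t where "trans_set t" "x \<in> elts t"
    using trans_set_exists by blast
  then have "(THE k. rec_value rank_step x k) = mem_rec rank_step x"
    by (simp add: rec_value_iff[OF recursor_rank_step])
  finally show ?thesis .
qed

lemma definable_term_rank [definable_intros]:
  "definable_term t \<Longrightarrow> definable_term (\<lambda>s. rank mem (t s))"
  unfolding rank_eq_mem_rec
  by (rule definable_fun_app[OF definable_mem_rec[OF recursor_rank_step]])

lemma elts_rank: "elts (rank mem x) = (\<Union>y\<in>elts x. elts (suc (rank mem y)))"
proof -
  obtain t where t: "trans_set t" "x \<in> elts t"
    using trans_set_exists by blast
  have "small (\<Union>y\<in>elts x. elts (suc (rank mem y)))"
    by (intro small_UN small_elts definable_intros)
  then show ?thesis
    unfolding rank_eq_mem_rec by (subst mem_rec[OF recursor_rank_step t])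
      (simp_all add: rank_step_def UNION_eq)
qed

lemma rank_mem: "y \<in> elts x \<Longrightarrow> rank mem y \<in> elts (rank mem x)"
  unfolding elts_rank[of x] by auto

lemma rank_trans: "z \<in> elts (rank mem x) \<Longrightarrow> w \<in> elts z \<Longrightarrow> w \<in> elts (rank mem x)"
proof -
  have "\<forall>z\<in>elts (rank mem x). elts z \<subseteq> elts (rank mem x)"
  proof (induction x rule: mem_induct)
    case definable
    show ?case by (intro definable_intros)
  next
    case (step x)
    then show ?case
      unfolding elts_rank[of x] by fastforce
  qed
  then show "z \<in> elts (rank mem x) \<Longrightarrow> w \<in> elts z \<Longrightarrow> w \<in> elts (rank mem x)" by blast
qed

lemma rank_subset:
  "(\<And>y. y \<in> elts x \<Longrightarrow> rank mem y \<in> elts (rank mem u)) \<Longrightarrow> elts (rank mem x) \<subseteq> elts (rank mem u)"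
  unfolding elts_rank[of x] using rank_trans by auto

lemma rank_linear:
  "rank mem x \<in> elts (rank mem y) \<or> rank mem x = rank mem y \<or> rank mem y \<in> elts (rank mem x)"
proof -
  let ?comparable = "\<lambda>x y. rank mem x \<in> elts (rank mem y) \<or> rank mem x = rank mem y \<or>
    rank mem y \<in> elts (rank mem x)"
  have "\<forall>y. ?comparable x y"
  proof (induction x rule: mem_induct)
    case definable
    show ?case by (intro definable_intros)
  next
    case (step x)
    have "?comparable x y" for y
    proof (induction y rule: mem_induct)
      case definable
      show ?case by (intro definable_intros)
    next
      case (step y)
      show ?case
      proof (rule ccontr)
        assume not: "\<not> ?comparable x y"
        have "rank mem u \<in> elts (rank mem y)" if "u \<in> elts x" for u
          using \<open>\<And>u. u \<in> elts x \<Longrightarrow> \<forall>y. ?comparable u y\<close>[OF that] rank_mem[OF that] rank_trans not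
          by metis
        moreover have "rank mem v \<in> elts (rank mem x)" if "v \<in> elts y" for v
          using step[OF that] rank_mem[OF that] rank_trans not by metis
        ultimately have "elts (rank mem x) = elts (rank mem y)"
          by (intro equalityI rank_subset)
        then show False
          using not by simp
      qed
    qed
    then show ?case ..
  qed
  then show ?thesis ..
qed

lemma small_rank_le: "small {x. elts (rank mem x) \<subseteq> elts (rank mem u)}"
proof (induction u rule: mem_induct)
  case definable
  show ?case by (intro definable_intros)
next
  case (step u)
  define M where "M = (\<Union>y\<in>elts u. {x. elts (rank mem x) \<subseteq> elts (rank mem y)})"
  have M: "small M"
    unfolding M_def by (intro small_UN small_elts step definable_intros)
  have "{x. elts (rank mem x) \<subseteq> elts (rank mem u)} \<subseteq> {x. elts x \<subseteq> M}"
  proof clarify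
    fix x w
    assume "elts (rank mem x) \<subseteq> elts (rank mem u)" "w \<in> elts x"
    then have "rank mem w \<in> elts (rank mem u)"
      using rank_mem by blast
    then obtain y where "y \<in> elts u" "rank mem w = rank mem y \<or> rank mem w \<in> elts (rank mem y)"
      unfolding elts_rank[of u] by auto
    then show "w \<in> M"
      unfolding M_def using rank_trans by auto
  qed
  then show ?case
    by (rule small_subset[OF small_Pow[OF M]]) (intro definable_intros)
qed

lemma minimal_rank_exists:
  assumes P: "definable1 P" and "P a"
  obtains x where "P x" "\<forall>y. P y \<longrightarrow> elts (rank mem x) \<subseteq> elts (rank mem y)"
proof -
  define S where "S = rank mem ` {x \<in> {x. elts (rank mem x) \<subseteq> elts (rank mem a)}. P x}"
  have "small S"
    unfolding S_def by (intro small_image small_Collect small_rank_le P definable_intros)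
  moreover have "rank mem a \<in> S"
    using \<open>P a\<close> by (simp add: S_def)
  ultimately obtain k where k: "k \<in> S" "elts k \<inter> S = {}"
    by (rule foundation)
  then obtain x where x: "P x" "k = rank mem x" "elts (rank mem x) \<subseteq> elts (rank mem a)"
    unfolding S_def by blast
  have "elts (rank mem x) \<subseteq> elts (rank mem y)" if "P y" for y
  proof -
    have "rank mem y \<notin> elts (rank mem x)"
    proof
      assume y: "rank mem y \<in> elts (rank mem x)"
      then have "elts (rank mem y) \<subseteq> elts (rank mem a)"
        using rank_trans x(3) by blast
      then have "rank mem y \<in> S"
        using \<open>P y\<close> by (simp add: S_def)
      with y k(2) show False
        unfolding x(2) by blast
    qed
    then show ?thesis
      using rank_linear[of x y] rank_trans by auto
  qed
  with x(1) show thesis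
    using that by blast
qed

lemma elts_scott:
  assumes P: "definable1 P" and "P a"
  shows "elts (scott mem P) = {x. P x \<and> (\<forall>y. P y \<longrightarrow> elts (rank mem x) \<subseteq> elts (rank mem y))}"
proof -
  have "small {x. P x \<and> (\<forall>y. P y \<longrightarrow> elts (rank mem x) \<subseteq> elts (rank mem y))}"
    by (rule small_subset[OF small_rank_le[of a]])
      (use \<open>P a\<close> in blast, intro definable_intros definable1_app[OF P])
  then show ?thesis
    by (simp add: scott_def the_set_eq_set_of)
qed

lemma scott_nonempty:
  assumes "definable1 P" "P a"
  obtains x where "x \<in> elts (scott mem P)" "P x"
proof -
  obtain x where "P x" "\<forall>y. P y \<longrightarrow> elts (rank mem x) \<subseteq> elts (rank mem y)"
    by (rule minimal_rank_exists[of P, OF assms])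
  then show thesis
    by (intro that[of x]) (simp_all add: elts_scott[of P, OF assms])
qed

lemma scott_eq_iff:
  assumes "definable1 P" "definable1 Q" "P a" "Q b"
    and classes: "\<And>x. P x \<Longrightarrow> Q x \<Longrightarrow> P = Q"
  shows "scott mem P = scott mem Q \<longleftrightarrow> P = Q"
proof
  assume eq: "scott mem P = scott mem Q"
  obtain x where x: "x \<in> elts (scott mem P)" "P x"
    using scott_nonempty[of P, OF assms(1,3)] .
  then have "Q x"
    unfolding eq elts_scott[of Q, OF assms(2,4)] by simp
  with x(2) show "P = Q"
    by (rule classes)
qed simp

lemma definable_term_scott [definable_intros]:
  assumes "definable (\<lambda>s. P (\<lambda>i. s (Suc i)) (s 0))"
  shows "definable_term (\<lambda>s. scott mem (P s))"
proof -
  have "definable (\<lambda>s. P (\<lambda>i. s (Suc (Suc i))) (s 0))"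
    using definable_rename[OF assms, of "case_nat 0 (\<lambda>i. Suc (Suc i))"]
    by (auto simp: inj_def split: nat.splits)
  then show ?thesis
    unfolding scott_def subset_of_iff by (intro definable_intros assms)
qed

end

locale zf_ac = zf +
  assumes AC: "AC_omega mem"
begin

lemma countable_choice:
  assumes P: "definable2 P" and ex: "\<And>n. n \<in> \<omega> \<Longrightarrow> \<exists>x. P n x"
  obtains F where "definable_fun F" "\<forall>n\<in>\<omega>. P n (F n)"
proof -
  define X where "X n = scott mem (P n)" for n
  have X: "definable_fun X"
    unfolding X_def by (intro definable_intros definable2_app[OF P])
  have P_n: "definable1 (P n)" for n
    by (intro definable_intros definable2_app[OF P])
  have "\<exists>x. x \<in> elts (app mem (seq_of mem X) n)" if n: "n \<in> \<omega>" for n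
  proof -
    obtain a where "P n a"
      using ex[OF n] by blast
    then obtain x where "x \<in> elts (scott mem (P n))"
      by (rule scott_nonempty[of "P n", OF P_n])
    then show ?thesis
      unfolding app_seq_of[OF X n] X_def by blast
  qed
  moreover have "sequence mem X \<and> (\<forall>n. n \<in> \<omega> \<longrightarrow> (\<exists>x. x \<in> elts (app mem X n))) \<longrightarrow>
      (\<exists>f. sequence mem f \<and> (\<forall>n. n \<in> \<omega> \<longrightarrow> app mem f n \<in> elts (app mem X n)))" for X
    using AC unfolding AC_omega_def elts_iff by blast
  ultimately obtain f where f: "sequence mem f"
    "\<And>n. n \<in> \<omega> \<Longrightarrow> app mem f n \<in> elts (app mem (seq_of mem X) n)"
    using sequence_seq_of[OF X] by blast
  have "P n (app mem f n)" if n: "n \<in> \<omega>" for n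
  proof -
    obtain a where "P n a"
      using ex[OF n] by blast
    then show ?thesis
      using f(2)[OF n] elts_scott[of "P n", OF P_n] by (simp add: app_seq_of[OF X n] X_def)
  qed
  then show thesis
    using that[OF definable_fun_app_sequence[OF f(1)]] by blast
qed

end

context zf
begin

section \<open>Surjections and bijections between small sets\<close>

definition onto :: "('a \<Rightarrow> 'a \<Rightarrow> bool) \<Rightarrow> 'a set \<Rightarrow> 'a set \<Rightarrow> bool" where
  "onto R A B \<longleftrightarrow> (\<forall>x y. R x y \<longrightarrow> x \<in> A \<and> y \<in> B) \<and> right_unique R \<and> (\<forall>y\<in>B. \<exists>x. R x y)"

definition bij_rel :: "('a \<Rightarrow> 'a \<Rightarrow> bool) \<Rightarrow> 'a set \<Rightarrow> 'a set \<Rightarrow> bool" where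
  "bij_rel R A B \<longleftrightarrow> onto R A B \<and> onto R\<inverse>\<inverse> B A"

definition surj_le :: "'a set \<Rightarrow> 'a set \<Rightarrow> bool" (infix "\<preceq>" 50) where
  "B \<preceq> A \<longleftrightarrow> small A \<and> small B \<and> (\<exists>r. onto (graph r) A B)"

definition surj_eqv :: "'a set \<Rightarrow> 'a set \<Rightarrow> bool" (infix "\<approx>" 50) where
  "A \<approx> B \<longleftrightarrow> A \<preceq> B \<and> B \<preceq> A"

definition equipollent :: "'a set \<Rightarrow> 'a set \<Rightarrow> bool" (infix "\<simeq>" 50) where
  "A \<simeq> B \<longleftrightarrow> small A \<and> small B \<and> (\<exists>r. bij_rel (graph r) A B)"

lemma ontoD:
  assumes "onto R A B"
  shows "\<And>x y. R x y \<Longrightarrow> x \<in> A" "\<And>x y. R x y \<Longrightarrow> y \<in> B" "right_unique R"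
    "\<And>y. y \<in> B \<Longrightarrow> \<exists>x. R x y"
  using assms unfolding onto_def by blast+

lemma onto_relcompp: "onto R A B \<Longrightarrow> onto S B C \<Longrightarrow> onto (R OO S) A C"
  unfolding onto_def right_unique_def relcompp_apply by metis

lemma bij_rel_relcompp: "bij_rel R A B \<Longrightarrow> bij_rel S B C \<Longrightarrow> bij_rel (R OO S) A C"
  unfolding bij_rel_def converse_relcompp using onto_relcompp by blast

lemma bij_rel_conversep: "bij_rel R A B \<Longrightarrow> bij_rel R\<inverse>\<inverse> B A"
  by (simp add: bij_rel_def)

lemma definable2_graph [simp]: "definable2 (graph r)"
  by (intro definable_intros)

lemma definable2_relcompp:
  assumes R: "definable2 R" and S: "definable2 S"
  shows "definable2 (R OO S)"
  by (intro definable_intros definable2_app[OF R] definable2_app[OF S])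

lemma definable2_conversep:
  assumes R: "definable2 R"
  shows "definable2 R\<inverse>\<inverse>"
  by (intro definable_intros definable2_app[OF R])

lemma surj_leE:
  assumes "B \<preceq> A"
  obtains R where "definable2 R" "onto R A B"
proof -
  obtain r where "onto (graph r) A B"
    using assms unfolding surj_le_def by blast
  then show thesis
    by (rule that[OF definable2_graph])
qed

lemma surj_le_onto:
  assumes "small A" "small B" "definable2 R" "onto R A B"
  shows "B \<preceq> A"
proof -
  have "x \<in> A \<and> y \<in> B" if "R x y" for x y
    using that ontoD(1,2)[OF assms(4)] by blast
  then obtain r where "graph r = R"
    by (rule small_graph[OF assms(1-3)])
  then have "onto (graph r) A B"
    using assms(4) by simp
  then show ?thesis
    using assms(1,2) unfolding surj_le_def by blast
qed

lemma equipollentE: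
  assumes "A \<simeq> B"
  obtains R where "definable2 R" "bij_rel R A B"
proof -
  obtain r where "bij_rel (graph r) A B"
    using assms unfolding equipollent_def by blast
  then show thesis
    by (rule that[OF definable2_graph])
qed

lemma equipollent_bij_rel:
  assumes "small A" "small B" "definable2 R" "bij_rel R A B"
  shows "A \<simeq> B"
proof -
  have "x \<in> A \<and> y \<in> B" if "R x y" for x y
    using that assms(4) unfolding bij_rel_def onto_def by blast
  then obtain r where "graph r = R"
    by (rule small_graph[OF assms(1-3)])
  then have "bij_rel (graph r) A B"
    using assms(4) by simp
  then show ?thesis
    using assms(1,2) unfolding equipollent_def by blast
qed

lemma surj_leI:
  assumes "small A" "small B" and R: "definable2 R"
    and "\<And>x y z. x \<in> A \<Longrightarrow> y \<in> B \<Longrightarrow> z \<in> B \<Longrightarrow> R x y \<Longrightarrow> R x z \<Longrightarrow> y = z"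
    and "\<And>y. y \<in> B \<Longrightarrow> \<exists>x\<in>A. R x y"
  shows "B \<preceq> A"
proof (rule surj_le_onto)
  show "definable2 (\<lambda>x y. x \<in> A \<and> y \<in> B \<and> R x y)"
    by (intro definable_intros definable_small_set assms(1,2) definable2_app[OF R])
  show "onto (\<lambda>x y. x \<in> A \<and> y \<in> B \<and> R x y) A B"
    using assms(4,5) unfolding onto_def right_unique_def by blast
qed (use assms(1,2) in simp_all)

lemma image_surj_le:
  assumes "small A" and R: "definable2 R" and unique: "right_unique R"
  shows "{y. \<exists>x\<in>A. R x y} \<preceq> A"
proof (rule surj_leI[OF assms(1) _ R])
  have "definable1 (\<lambda>x. \<exists>y. R x y)"
    by (intro definable_intros definable2_app[OF R])
  then have "small {x \<in> A. \<exists>y. R x y}"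
    by (rule small_Collect[OF assms(1)])
  then have "small {y. \<exists>x\<in>{x \<in> A. \<exists>y. R x y}. R x y}"
    by (rule small_image_rel[OF _ R]) (use right_uniqueD[OF unique] in blast)
  moreover have "{y. \<exists>x\<in>{x \<in> A. \<exists>y. R x y}. R x y} = {y. \<exists>x\<in>A. R x y}"
    by blast
  ultimately show "small {y. \<exists>x\<in>A. R x y}"
    by simp
qed (use right_uniqueD[OF unique] in auto)

lemma equipollentI:
  assumes "small A" "small B" and R: "definable2 R"
    and "\<And>x. x \<in> A \<Longrightarrow> \<exists>y\<in>B. R x y" "\<And>y. y \<in> B \<Longrightarrow> \<exists>x\<in>A. R x y"
    and "\<And>x y z. R x y \<Longrightarrow> R x z \<Longrightarrow> y = z" "\<And>x y z. R x z \<Longrightarrow> R y z \<Longrightarrow> x = y"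
  shows "A \<simeq> B"
proof (rule equipollent_bij_rel)
  show "definable2 (\<lambda>x y. x \<in> A \<and> y \<in> B \<and> R x y)"
    by (intro definable_intros definable_small_set assms(1,2) definable2_app[OF R])
  show "bij_rel (\<lambda>x y. x \<in> A \<and> y \<in> B \<and> R x y) A B"
    using assms(4-7) unfolding bij_rel_def onto_def right_unique_def by blast
qed (use assms(1,2) in simp_all)

lemma surj_le_small: "A \<preceq> B \<Longrightarrow> small A" "A \<preceq> B \<Longrightarrow> small B"
  by (simp_all add: surj_le_def)

lemma small_fibre:
  assumes "small S"
  shows "small {x. \<langle>x, i\<rangle> \<in> S}"
proof -
  have "{x. \<exists>p\<in>S. p = \<langle>x, i\<rangle>} \<preceq> S"
    by (rule image_surj_le[OF assms]) (intro definable_intros, auto simp: right_unique_def)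
  then have "small {x. \<exists>p\<in>S. p = \<langle>x, i\<rangle>}"
    by (rule surj_le_small)
  then show ?thesis by simp
qed

lemma surj_le_refl: "small A \<Longrightarrow> A \<preceq> A"
  by (rule surj_leI[of A A "(=)"]) (simp_all, intro definable_intros)

lemma surj_le_trans [trans]: "A \<preceq> B \<Longrightarrow> B \<preceq> C \<Longrightarrow> A \<preceq> C"
  by (meson definable2_relcompp onto_relcompp surj_leE surj_le_onto surj_le_small)

lemma subset_imp_surj_le: "small A \<Longrightarrow> small B \<Longrightarrow> B \<subseteq> A \<Longrightarrow> B \<preceq> A"
  by (rule surj_leI[of A B "(=)"]) (simp, simp, intro definable_intros, auto)

lemma surj_eqv_refl: "small A \<Longrightarrow> A \<approx> A"
  by (simp add: surj_eqv_def surj_le_refl)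

lemma surj_eqv_sym: "A \<approx> B \<Longrightarrow> B \<approx> A"
  by (simp add: surj_eqv_def)

lemma surj_eqv_trans [trans]: "A \<approx> B \<Longrightarrow> B \<approx> C \<Longrightarrow> A \<approx> C"
  unfolding surj_eqv_def using surj_le_trans by blast

lemma equipollent_refl: "small A \<Longrightarrow> A \<simeq> A"
  by (rule equipollentI[of A A "(=)"]) (simp_all, intro definable_intros)

lemma equipollent_sym: "A \<simeq> B \<Longrightarrow> B \<simeq> A"
  by (meson bij_rel_conversep definable2_conversep equipollentE equipollent_bij_rel equipollent_def)

lemma equipollent_trans [trans]: "A \<simeq> B \<Longrightarrow> B \<simeq> C \<Longrightarrow> A \<simeq> C"
  by (meson bij_rel_relcompp definable2_relcompp equipollentE equipollent_bij_rel equipollent_def)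

lemma equipollent_imp_surj_eqv:
  assumes "A \<simeq> B"
  shows "A \<approx> B"
proof -
  obtain R where "definable2 R" "onto R A B" "onto R\<inverse>\<inverse> B A"
    using assms by (meson bij_rel_def equipollentE)
  moreover have "small A" "small B"
    using assms by (simp_all add: equipollent_def)
  ultimately show ?thesis
    unfolding surj_eqv_def using surj_le_onto definable2_conversep by blast
qed

lemma definable_surj_le [definable_intros]:
  assumes "definable (\<lambda>s. s 0 \<in> A (\<lambda>i. s (Suc i)))" "definable (\<lambda>s. s 0 \<in> B (\<lambda>i. s (Suc i)))"
  shows "definable (\<lambda>s. A s \<preceq> B s)"
proof -
  have "definable2 (\<lambda>x y. elts x \<preceq> elts y)"
    unfolding surj_le_def onto_def right_unique_def by (intro definable_intros)
  then have "definable (\<lambda>s. small (A s) \<and> small (B s) \<and> elts (set_of (A s)) \<preceq> elts (set_of (B s)))"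
    by (intro definable_conj definable_small definable2_app[of "\<lambda>x y. elts x \<preceq> elts y"]
        definable_term_set_of assms)
  moreover have "small A \<and> small B \<and> elts (set_of A) \<preceq> elts (set_of B) \<longleftrightarrow> A \<preceq> B" for A B
    using surj_le_small by auto
  ultimately show ?thesis by simp
qed

lemma definable_surj_eqv [definable_intros]:
  "definable (\<lambda>s. s 0 \<in> A (\<lambda>i. s (Suc i))) \<Longrightarrow> definable (\<lambda>s. s 0 \<in> B (\<lambda>i. s (Suc i))) \<Longrightarrow>
    definable (\<lambda>s. A s \<approx> B s)"
  unfolding surj_eqv_def by (intro definable_conj definable_surj_le)

lemma definable_equipollent_elts [definable_intros]:
  "definable_term t \<Longrightarrow> definable_term u \<Longrightarrow> definable (\<lambda>s. elts (t s) \<simeq> elts (u s))"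
  by (rule definable2_app)
    (unfold equipollent_def bij_rel_def onto_def right_unique_def, intro definable_intros)

subsection \<open>Binary sums\<close>

definition plus :: "'a set \<Rightarrow> 'a set \<Rightarrow> 'a set" (infixr "\<oplus>" 65) where
  "A \<oplus> B = A \<otimes> {\<zero>} \<union> B \<otimes> {\<one>}"

lemma pair_in_plus [simp]: "\<langle>x, \<zero>\<rangle> \<in> A \<oplus> B \<longleftrightarrow> x \<in> A" "\<langle>x, \<one>\<rangle> \<in> A \<oplus> B \<longleftrightarrow> x \<in> B"
  by (auto simp: plus_def)

lemma in_plusE:
  assumes "p \<in> A \<oplus> B"
  obtains (left) x where "x \<in> A" "p = \<langle>x, \<zero>\<rangle>" | (right) y where "y \<in> B" "p = \<langle>y, \<one>\<rangle>"
  using assms by (auto simp: plus_def elim!: in_timesE)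

lemma definable_plus [definable_intros]:
  "definable (\<lambda>s. t s \<in> A s \<otimes> {\<zero>} \<union> B s \<otimes> {\<one>}) \<Longrightarrow> definable (\<lambda>s. t s \<in> A s \<oplus> B s)"
  by (simp add: plus_def)

lemma small_plus_iff [simp]: "small (A \<oplus> B) \<longleftrightarrow> small A \<and> small B"
proof
  assume sum: "small (A \<oplus> B)"
  then obtain r where r: "elts r = A \<oplus> B"
    by (metis elts_set_of)
  have "small {x. \<exists>y. graph r x y}"
    by (rule small_subset[OF small_field[of r]]) (blast, intro definable_intros)
  moreover have "A \<subseteq> {x. \<exists>y. graph r x y}" "B \<subseteq> {x. \<exists>y. graph r x y}"
    unfolding r using pair_in_plus by blast+
  moreover have "definable1 (\<lambda>x. \<langle>x, \<zero>\<rangle> \<in> A \<oplus> B)" "definable1 (\<lambda>x. \<langle>x, \<one>\<rangle> \<in> A \<oplus> B)"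
    by (rule definable1I, rule definable_small_set[OF sum], intro definable_intros)+
  ultimately show "small A \<and> small B"
    using small_subset by simp
qed (simp add: plus_def)

definition rel_plus :: "('a \<Rightarrow> 'a \<Rightarrow> bool) \<Rightarrow> ('a \<Rightarrow> 'a \<Rightarrow> bool) \<Rightarrow> 'a \<Rightarrow> 'a \<Rightarrow> bool" where
  "rel_plus R S p q \<longleftrightarrow> (\<exists>x y. p = \<langle>x, \<zero>\<rangle> \<and> q = \<langle>y, \<zero>\<rangle> \<and> R x y) \<or>
    (\<exists>x y. p = \<langle>x, \<one>\<rangle> \<and> q = \<langle>y, \<one>\<rangle> \<and> S x y)"

lemma definable2_rel_plus:
  assumes R: "definable2 R" and S: "definable2 S"
  shows "definable2 (rel_plus R S)"
  unfolding rel_plus_def by (intro definable_intros definable2_app[OF R] definable2_app[OF S])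

lemma conversep_rel_plus: "(rel_plus R S)\<inverse>\<inverse> = rel_plus R\<inverse>\<inverse> S\<inverse>\<inverse>"
  by (auto simp: rel_plus_def fun_eq_iff)

lemma onto_rel_plus:
  assumes R: "onto R A B" and S: "onto S A' B'"
  shows "onto (rel_plus R S) (A \<oplus> A') (B \<oplus> B')"
  unfolding onto_def
proof (intro conjI allI impI ballI)
  fix p q
  assume "rel_plus R S p q"
  then show "p \<in> A \<oplus> A'" "q \<in> B \<oplus> B'"
    using ontoD(1,2)[OF R] ontoD(1,2)[OF S] by (auto simp: rel_plus_def)
next
  show "right_unique (rel_plus R S)"
    using right_uniqueD[OF ontoD(3)[OF R]] right_uniqueD[OF ontoD(3)[OF S]]
    by (auto simp: right_unique_def rel_plus_def)
next
  fix q
  assume "q \<in> B \<oplus> B'"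
  then show "\<exists>p. rel_plus R S p q"
    using ontoD(4)[OF R] ontoD(4)[OF S] by (cases rule: in_plusE) (auto simp: rel_plus_def)
qed

lemma plus_mono: "A \<preceq> B \<Longrightarrow> A' \<preceq> B' \<Longrightarrow> A \<oplus> A' \<preceq> B \<oplus> B'"
  by (meson definable2_rel_plus onto_rel_plus small_plus_iff surj_leE surj_le_onto surj_le_small)

lemma plus_surj_eqv: "A \<approx> B \<Longrightarrow> A' \<approx> B' \<Longrightarrow> A \<oplus> A' \<approx> B \<oplus> B'"
  by (simp add: surj_eqv_def plus_mono)

lemma plus_equipollent:
  assumes "A \<simeq> B" "A' \<simeq> B'"
  shows "A \<oplus> A' \<simeq> B \<oplus> B'"
proof -
  obtain R S where "definable2 R" "bij_rel R A B" "definable2 S" "bij_rel S A' B'"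
    using assms by (elim equipollentE)
  then have "definable2 (rel_plus R S)" "bij_rel (rel_plus R S) (A \<oplus> A') (B \<oplus> B')"
    by (simp_all add: definable2_rel_plus bij_rel_def conversep_rel_plus onto_rel_plus)
  then show ?thesis
    using assms by (intro equipollent_bij_rel) (simp_all add: equipollent_def)
qed

lemma times_singleton_equipollent:
  assumes "small A"
  shows "A \<otimes> {i} \<simeq> A"
proof (rule equipollentI)
  show "definable2 (\<lambda>p x. p = \<langle>x, i\<rangle>)"
    by (intro definable_intros)
qed (use assms in \<open>auto elim!: in_timesE\<close>)

lemma plus_commute:
  assumes "small A" "small B"
  shows "A \<oplus> B \<simeq> B \<oplus> A"
proof (rule equipollentI)
  let ?swap = "\<lambda>p q. \<exists>x. p = \<langle>x, \<zero>\<rangle> \<and> q = \<langle>x, \<one>\<rangle> \<or> p = \<langle>x, \<one>\<rangle> \<and> q = \<langle>x, \<zero>\<rangle>"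
  show "definable2 ?swap"
    by (intro definable_intros)
  show "\<exists>q\<in>B \<oplus> A. ?swap p q" if "p \<in> A \<oplus> B" for p
    using that by (elim in_plusE) force+
  show "\<exists>p\<in>A \<oplus> B. ?swap p q" if "q \<in> B \<oplus> A" for q
    using that by (elim in_plusE) force+
qed (use assms in auto)

lemma plus_assoc:
  assumes "small A" "small B" "small C"
  shows "(A \<oplus> B) \<oplus> C \<simeq> A \<oplus> (B \<oplus> C)"
proof (rule equipollentI)
  let ?assoc = "\<lambda>p q. \<exists>x. p = \<langle>\<langle>x, \<zero>\<rangle>, \<zero>\<rangle> \<and> q = \<langle>x, \<zero>\<rangle> \<or>
    p = \<langle>\<langle>x, \<one>\<rangle>, \<zero>\<rangle> \<and> q = \<langle>\<langle>x, \<zero>\<rangle>, \<one>\<rangle> \<or> p = \<langle>x, \<one>\<rangle> \<and> q = \<langle>\<langle>x, \<one>\<rangle>, \<one>\<rangle>"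
  show "definable2 ?assoc"
    by (intro definable_intros)
  show "\<exists>q\<in>A \<oplus> (B \<oplus> C). ?assoc p q" if "p \<in> (A \<oplus> B) \<oplus> C" for p
    using that by (elim in_plusE) force+
  show "\<exists>p\<in>(A \<oplus> B) \<oplus> C. ?assoc p q" if "q \<in> A \<oplus> (B \<oplus> C)" for q
    using that by (elim in_plusE) force+
qed (use assms in auto)

lemma Un_disjoint_equipollent:
  assumes "small A" "small B" "A \<inter> B = {}"
  shows "A \<union> B \<simeq> A \<oplus> B"
proof (rule equipollentI)
  let ?inject = "\<lambda>x p. x \<in> A \<and> p = \<langle>x, \<zero>\<rangle> \<or> x \<in> B \<and> p = \<langle>x, \<one>\<rangle>"
  show "definable2 ?inject"
    by (intro definable_intros definable_small_set assms(1,2))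
  show "\<exists>x\<in>A \<union> B. ?inject x p" if "p \<in> A \<oplus> B" for p
    using that by (elim in_plusE) auto
qed (use assms in auto)

lemma Un_surj_le_plus:
  assumes "small A" "small B"
  shows "A \<union> B \<preceq> A \<oplus> B"
proof (rule surj_leI)
  show "definable2 (\<lambda>p x. p = \<langle>x, \<zero>\<rangle> \<or> p = \<langle>x, \<one>\<rangle>)"
    by (intro definable_intros)
qed (use assms in auto)

lemma surj_le_plus1: "small A \<Longrightarrow> small B \<Longrightarrow> A \<preceq> A \<oplus> B"
  using Un_surj_le_plus[of A B] subset_imp_surj_le[of "A \<union> B" A] surj_le_trans by simp

lemma surj_le_plus2: "small A \<Longrightarrow> small B \<Longrightarrow> B \<preceq> A \<oplus> B"
  using Un_surj_le_plus[of A B] subset_imp_surj_le[of "A \<union> B" B] surj_le_trans by simp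

subsection \<open>Countable sums\<close>

definition family :: "('a \<Rightarrow> 'a set) \<Rightarrow> bool" where
  "family F \<longleftrightarrow> (\<forall>n. small (F n)) \<and> definable2 (\<lambda>n x. x \<in> F n)"

lemma familyI: "(\<And>n. small (F n)) \<Longrightarrow> definable2 (\<lambda>n x. x \<in> F n) \<Longrightarrow> family F"
  by (simp add: family_def)

lemma small_family: "family F \<Longrightarrow> small (F n)"
  by (simp add: family_def)

lemma definable_family:
  "family F \<Longrightarrow> definable_term t \<Longrightarrow> definable_term u \<Longrightarrow> definable (\<lambda>s. t s \<in> F (u s))"
  unfolding family_def by (auto intro: definable2_app[of "\<lambda>n x. x \<in> F n"])

lemma family_const: "small A \<Longrightarrow> family (\<lambda>_. A)"
  by (rule familyI) (assumption, intro definable_intros definable_small_set)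

lemma family_elts:
  assumes F: "definable_fun F"
  shows "family (\<lambda>n. elts (F n))"
  by (rule familyI) (simp, intro definable_intros definable_fun_app[OF F])

lemma family_comp:
  assumes F: "family F" and G: "definable_fun G"
  shows "family (\<lambda>n. F (G n))"
  by (rule familyI)
    (rule small_family[OF F], intro definable_intros definable_family[OF F] definable_fun_app[OF G])

lemma family_plus:
  assumes F: "family F" and G: "family G"
  shows "family (\<lambda>n. F n \<oplus> G n)"
  by (rule familyI)
    (simp add: small_family F G, intro definable_intros definable_family[OF F] definable_family[OF G])

lemma family_subset:
  assumes F: "family F" and G: "definable2 (\<lambda>n x. x \<in> G n)" and "\<And>n. G n \<subseteq> F n"
  shows "family G"
proof (rule familyI)
  show "small (G n)" for n
    by (rule small_subset[OF small_family[OF F]])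
      (use assms(3) in blast, intro definable_intros definable2_app[OF G])
qed (rule G)

definition Oplus :: "('a \<Rightarrow> 'a set) \<Rightarrow> 'a set" (binder "\<Oplus>" 10) where
  "(\<Oplus>n. F n) = (\<Union>n\<in>\<omega>. F n \<otimes> {n})"

lemma pair_in_Oplus [simp]: "\<langle>x, n\<rangle> \<in> (\<Oplus>n. F n) \<longleftrightarrow> n \<in> \<omega> \<and> x \<in> F n"
  by (auto simp: Oplus_def)

lemma in_OplusE:
  assumes "p \<in> (\<Oplus>n. F n)"
  obtains n x where "n \<in> \<omega>" "x \<in> F n" "p = \<langle>x, n\<rangle>"
  using assms by (auto simp: Oplus_def elim!: in_timesE)

lemma definable_Oplus [definable_intros]:
  "definable (\<lambda>s. t s \<in> (\<Union>n\<in>\<omega>. F s n \<otimes> {n})) \<Longrightarrow> definable (\<lambda>s. t s \<in> (\<Oplus>n. F s n))"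
  by (simp add: Oplus_def)

lemma small_UN_family [simp]: "family F \<Longrightarrow> small (\<Union>n\<in>\<omega>. F n)"
  by (rule small_UN) (simp_all add: family_def)

lemma small_Oplus [simp]:
  assumes "family F"
  shows "small (\<Oplus>n. F n)"
  unfolding Oplus_def
  by (intro small_UN small_elts small_times small_insert small_empty small_family assms
      definable_intros definable_family[OF assms])

lemma Oplus_cong: "(\<And>n. n \<in> \<omega> \<Longrightarrow> F n = G n) \<Longrightarrow> (\<Oplus>n. F n) = (\<Oplus>n. G n)"
  by (simp add: Oplus_def)

definition rel_Oplus :: "('a \<Rightarrow> 'a \<Rightarrow> 'a \<Rightarrow> bool) \<Rightarrow> 'a \<Rightarrow> 'a \<Rightarrow> bool" where
  "rel_Oplus R p q \<longleftrightarrow> (\<exists>n\<in>\<omega>. \<exists>x y. p = \<langle>x, n\<rangle> \<and> q = \<langle>y, n\<rangle> \<and> R n x y)"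

lemma definable2_rel_Oplus:
  assumes R: "definable3 R"
  shows "definable2 (rel_Oplus R)"
  unfolding rel_Oplus_def by (intro definable_intros definable3_app[OF R])

lemma conversep_rel_Oplus: "(rel_Oplus R)\<inverse>\<inverse> = rel_Oplus (\<lambda>n. (R n)\<inverse>\<inverse>)"
  by (auto simp: rel_Oplus_def fun_eq_iff)

lemma onto_rel_Oplus:
  assumes R: "\<And>n. n \<in> \<omega> \<Longrightarrow> onto (R n) (F n) (G n)"
  shows "onto (rel_Oplus R) (\<Oplus>n. F n) (\<Oplus>n. G n)"
  unfolding onto_def
proof (intro conjI allI impI ballI)
  fix p q
  assume "rel_Oplus R p q"
  then show "p \<in> (\<Oplus>n. F n)" "q \<in> (\<Oplus>n. G n)"
    using ontoD(1,2)[OF R] by (auto simp: rel_Oplus_def)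
next
  show "right_unique (rel_Oplus R)"
    using right_uniqueD[OF ontoD(3)[OF R]] by (auto simp: right_unique_def rel_Oplus_def)
next
  fix q
  assume "q \<in> (\<Oplus>n. G n)"
  then obtain n y where q: "n \<in> \<omega>" "y \<in> G n" "q = \<langle>y, n\<rangle>"
    by (rule in_OplusE)
  then obtain x where "R n x y"
    using ontoD(4)[OF R] by blast
  then show "\<exists>p. rel_Oplus R p q"
    using q unfolding rel_Oplus_def by blast
qed

lemma UN_surj_le_Oplus:
  assumes "family F"
  shows "(\<Union>n\<in>\<omega>. F n) \<preceq> (\<Oplus>n. F n)"
proof (rule surj_leI)
  show "definable2 (\<lambda>p x. \<exists>n. p = \<langle>x, n\<rangle>)"
    by (intro definable_intros)
  show "\<exists>p\<in>\<Oplus>n. F n. \<exists>n. p = \<langle>x, n\<rangle>" if "x \<in> (\<Union>n\<in>\<omega>. F n)" for x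
    using that pair_in_Oplus by blast
qed (use assms in auto)

lemma surj_le_Oplus:
  assumes "family F" "n \<in> \<omega>"
  shows "F n \<preceq> (\<Oplus>n. F n)"
proof -
  have "F n \<preceq> (\<Union>n\<in>\<omega>. F n)"
    using assms by (intro subset_imp_surj_le) (auto simp: small_family)
  also have "\<dots> \<preceq> (\<Oplus>n. F n)"
    by (rule UN_surj_le_Oplus[OF assms(1)])
  finally show ?thesis .
qed

lemma disjoint_UN_equipollent_Oplus:
  assumes "family F" and disjoint: "\<And>m n x. m \<in> \<omega> \<Longrightarrow> n \<in> \<omega> \<Longrightarrow> x \<in> F m \<Longrightarrow> x \<in> F n \<Longrightarrow> m = n"
  shows "(\<Union>n\<in>\<omega>. F n) \<simeq> (\<Oplus>n. F n)"
proof (rule equipollentI)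
  let ?inject = "\<lambda>x p. \<exists>n\<in>\<omega>. x \<in> F n \<and> p = \<langle>x, n\<rangle>"
  show "definable2 ?inject"
    by (intro definable_intros definable_family[OF assms(1)])
  show "\<exists>p\<in>\<Oplus>n. F n. ?inject x p" if "x \<in> (\<Union>n\<in>\<omega>. F n)" for x
    using that by force
  show "\<exists>x\<in>\<Union>n\<in>\<omega>. F n. ?inject x p" if "p \<in> (\<Oplus>n. F n)" for p
    using that by (elim in_OplusE) auto
  show "p = q" if "?inject x p" "?inject x q" for x p q
    using that disjoint by blast
qed (use assms(1) in auto)

lemma Oplus_split_first:
  assumes "family F"
  shows "(\<Oplus>n. F n) \<simeq> F \<zero> \<oplus> (\<Oplus>n. F (suc n))"
proof (rule equipollentI)
  let ?shift = "\<lambda>p q. \<exists>x n. p = \<langle>x, n\<rangle> \<and>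
    (n = \<zero> \<and> q = \<langle>x, \<zero>\<rangle> \<or> (\<exists>m\<in>\<omega>. n = suc m \<and> q = \<langle>\<langle>x, m\<rangle>, \<one>\<rangle>))"
  show "definable2 ?shift"
    by (intro definable_intros)
  show "\<exists>q\<in>F \<zero> \<oplus> (\<Oplus>n. F (suc n)). ?shift p q" if p: "p \<in> (\<Oplus>n. F n)" for p
  proof -
    obtain n x where n: "n \<in> \<omega>" "x \<in> F n" "p = \<langle>x, n\<rangle>"
      using p by (elim in_OplusE)
    from n(1) show ?thesis
    proof (cases rule: omega_cases)
      case zero
      then show ?thesis
        using n by (intro bexI[of _ "\<langle>x, \<zero>\<rangle>"]) auto
    next
      case (successor m)
      then show ?thesis
        using n by (intro bexI[of _ "\<langle>\<langle>x, m\<rangle>, \<one>\<rangle>"]) auto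
    qed
  qed
  show "\<exists>p\<in>\<Oplus>n. F n. ?shift p q" if "q \<in> F \<zero> \<oplus> (\<Oplus>n. F (suc n))" for q
    using that
  proof (cases rule: in_plusE)
    case (left x)
    then show ?thesis
      by (intro bexI[of _ "\<langle>x, \<zero>\<rangle>"]) auto
  next
    case (right y)
    then obtain n x where "n \<in> \<omega>" "x \<in> F (suc n)" "y = \<langle>x, n\<rangle>"
      by (elim in_OplusE)
    then show ?thesis
      using right by (intro bexI[of _ "\<langle>x, suc n\<rangle>"]) auto
  qed
  have "family (\<lambda>n. F (suc n))"
    by (rule family_comp[OF assms]) (intro definable_intros)
  then show "small (F \<zero> \<oplus> (\<Oplus>n. F (suc n)))"
    using small_family[OF assms] by simp
qed (use assms in auto)

lemma Oplus_plus_distrib: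
  assumes "family F" "family G"
  shows "(\<Oplus>n. F n \<oplus> G n) \<simeq> (\<Oplus>n. F n) \<oplus> (\<Oplus>n. G n)"
proof (rule equipollentI)
  let ?swap = "\<lambda>p q. \<exists>x n i. p = \<langle>\<langle>x, i\<rangle>, n\<rangle> \<and> q = \<langle>\<langle>x, n\<rangle>, i\<rangle>"
  show "definable2 ?swap"
    by (intro definable_intros)
  show "\<exists>q\<in>(\<Oplus>n. F n) \<oplus> (\<Oplus>n. G n). ?swap p q" if "p \<in> (\<Oplus>n. F n \<oplus> G n)" for p
    using that by (auto simp: Oplus_def plus_def times_def)
  show "\<exists>p\<in>\<Oplus>n. F n \<oplus> G n. ?swap p q" if "q \<in> (\<Oplus>n. F n) \<oplus> (\<Oplus>n. G n)" for q
    using that by (auto simp: Oplus_def plus_def times_def)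
qed (use assms in \<open>auto simp: family_plus\<close>)

end

context zf_ac
begin

lemma choose_onto:
  assumes F: "family F" and G: "family G" and le: "\<And>n. n \<in> \<omega> \<Longrightarrow> F n \<preceq> G n"
  obtains R where "definable3 R" "\<forall>n\<in>\<omega>. onto (R n) (G n) (F n)"
proof -
  have "definable2 (\<lambda>n r. onto (graph r) (G n) (F n))"
    unfolding onto_def right_unique_def by (intro definable_intros definable_family[OF F] definable_family[OF G])
  moreover have "\<exists>r. onto (graph r) (G n) (F n)" if "n \<in> \<omega>" for n
    using le[OF that] unfolding surj_le_def by blast
  ultimately obtain h where h: "definable_fun h" "\<forall>n\<in>\<omega>. onto (graph (h n)) (G n) (F n)"
    by (rule countable_choice)
  have "definable3 (\<lambda>n. graph (h n))"
    by (intro definable_intros definable_fun_app[OF h(1)])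
  then show thesis
    by (rule that[OF _ h(2)])
qed

lemma choose_bij_rel:
  assumes F: "family F" and G: "family G" and eq: "\<And>n. n \<in> \<omega> \<Longrightarrow> F n \<simeq> G n"
  obtains R where "definable3 R" "\<forall>n\<in>\<omega>. bij_rel (R n) (F n) (G n)"
proof -
  have "definable2 (\<lambda>n r. bij_rel (graph r) (F n) (G n))"
    unfolding bij_rel_def onto_def right_unique_def
    by (intro definable_intros definable_family[OF F] definable_family[OF G])
  moreover have "\<exists>r. bij_rel (graph r) (F n) (G n)" if "n \<in> \<omega>" for n
    using eq[OF that] unfolding equipollent_def by blast
  ultimately obtain h where h: "definable_fun h" "\<forall>n\<in>\<omega>. bij_rel (graph (h n)) (F n) (G n)"
    by (rule countable_choice)
  have "definable3 (\<lambda>n. graph (h n))"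
    by (intro definable_intros definable_fun_app[OF h(1)])
  then show thesis
    by (rule that[OF _ h(2)])
qed

lemma Oplus_mono:
  assumes "family F" "family G" "\<And>n. n \<in> \<omega> \<Longrightarrow> F n \<preceq> G n"
  shows "(\<Oplus>n. F n) \<preceq> (\<Oplus>n. G n)"
proof -
  obtain R where "definable3 R" "\<forall>n\<in>\<omega>. onto (R n) (G n) (F n)"
    by (rule choose_onto[OF assms])
  then show ?thesis
    using assms(1,2) by (intro surj_le_onto[of _ _ "rel_Oplus R"])
      (simp_all add: definable2_rel_Oplus onto_rel_Oplus)
qed

lemma Oplus_surj_eqv:
  "family F \<Longrightarrow> family G \<Longrightarrow> (\<And>n. n \<in> \<omega> \<Longrightarrow> F n \<approx> G n) \<Longrightarrow> (\<Oplus>n. F n) \<approx> (\<Oplus>n. G n)"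
  unfolding surj_eqv_def using Oplus_mono by blast

lemma Oplus_equipollent:
  assumes "family F" "family G" "\<And>n. n \<in> \<omega> \<Longrightarrow> F n \<simeq> G n"
  shows "(\<Oplus>n. F n) \<simeq> (\<Oplus>n. G n)"
proof -
  obtain R where R: "definable3 R" "\<forall>n\<in>\<omega>. bij_rel (R n) (F n) (G n)"
    by (rule choose_bij_rel[OF assms])
  then have "bij_rel (rel_Oplus R) (\<Oplus>n. F n) (\<Oplus>n. G n)"
    by (simp add: bij_rel_def conversep_rel_Oplus onto_rel_Oplus)
  then show ?thesis
    using assms(1,2) R(1) by (intro equipollent_bij_rel) (simp_all add: definable2_rel_Oplus)
qed

end

context zf
begin

section \<open>Surjective cardinals\<close>

lemma domain_of_eq_iff: "domain_of mem f = X \<longleftrightarrow> (\<forall>x. x \<in> elts X \<longleftrightarrow> (\<exists>y. graph f x y))"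
  using elts_inject[of "domain_of mem f" X] by (auto simp: elts_domain_of)

lemma range_of_eq_iff: "range_of mem f = Y \<longleftrightarrow> (\<forall>y. y \<in> elts Y \<longleftrightarrow> (\<exists>x. graph f x y))"
  using elts_inject[of "range_of mem f" Y] by (auto simp: elts_range_of)

lemma function_of_graph:
  assumes "onto (graph r) (elts X) (elts Y)"
  obtains f where "is_function mem f" "graph f = graph r"
proof -
  have "x \<in> elts X \<and> y \<in> elts Y" if "graph r x y" for x y
    using ontoD(1,2)[OF assms that] by blast
  then obtain f where "graph f = graph r" "\<forall>p\<in>elts f. \<exists>x y. p = \<langle>x, y\<rangle>"
    by (rule small_graph[OF small_elts small_elts definable2_graph])
  moreover from this(1) have "right_unique (graph f)"
    using ontoD(3)[OF assms] by simp
  ultimately have "is_function mem f"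
    unfolding is_function_iff by blast
  then show thesis
    using \<open>graph f = graph r\<close> by (rule that)
qed

lemma equipotent_iff: "equipotent mem X Y \<longleftrightarrow> elts X \<simeq> elts Y"
proof -
  have bij_rel_iff: "domain_of mem f = X \<and> range_of mem f = Y \<and>
      (\<forall>x x'. x \<epsilon> X \<and> x' \<epsilon> X \<and> app mem f x = app mem f x' \<longrightarrow> x = x') \<longleftrightarrow>
      bij_rel (graph f) (elts X) (elts Y)" if f: "is_function mem f" for f
  proof (cases "domain_of mem f = X")
    case True
    then have app: "graph f x y \<longleftrightarrow> x \<in> elts X \<and> app mem f x = y" for x y
      using graph_iff_app[OF f] by simp
    show ?thesis
      unfolding range_of_eq_iff bij_rel_def onto_def right_unique_def conversep_iff app
      using True by (auto simp: elts_iff)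
  next
    case False
    moreover have "domain_of mem f = X" if "bij_rel (graph f) (elts X) (elts Y)"
      using that unfolding domain_of_eq_iff bij_rel_def onto_def conversep_iff by blast
    ultimately show ?thesis by blast
  qed
  show ?thesis
  proof
    assume "equipotent mem X Y"
    then show "elts X \<simeq> elts Y"
      unfolding equipotent_def equipollent_def using bij_rel_iff small_elts by blast
  next
    assume "elts X \<simeq> elts Y"
    then obtain r where r: "bij_rel (graph r) (elts X) (elts Y)"
      unfolding equipollent_def by blast
    then obtain f where "is_function mem f" "graph f = graph r"
      using function_of_graph unfolding bij_rel_def by blast
    then show "equipotent mem X Y"
      unfolding equipotent_def using bij_rel_iff r by metis
  qed
qed

lemma partial_surjection_exists_iff: "(\<exists>f. partial_surjection mem f X Y) \<longleftrightarrow> elts Y \<preceq> elts X"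
proof -
  have onto_iff: "partial_surjection mem f X Y \<longleftrightarrow> onto (graph f) (elts X) (elts Y)"
    if "is_function mem f" for f
    using that unfolding partial_surjection_def is_function_iff onto_def range_of_eq_iff
      subset_of_iff elts_domain_of by blast
  show ?thesis
  proof
    assume "\<exists>f. partial_surjection mem f X Y"
    then show "elts Y \<preceq> elts X"
      using onto_iff unfolding surj_le_def partial_surjection_def by (metis small_elts)
  next
    assume "elts Y \<preceq> elts X"
    then obtain r where r: "onto (graph r) (elts X) (elts Y)"
      unfolding surj_le_def by blast
    then obtain f where "is_function mem f" "graph f = graph r"
      by (rule function_of_graph)
    then show "\<exists>f. partial_surjection mem f X Y"
      using onto_iff r by metis
  qed
qed

lemma definable_term_card_of [definable_intros]:
  "definable_term t \<Longrightarrow> definable_term (\<lambda>s. card_of mem (t s))"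
  by (rule definable_fun_app) (unfold card_of_def equipotent_iff, intro definable_intros)

lemma card_of_eq_iff: "card_of mem X = card_of mem Y \<longleftrightarrow> elts X \<simeq> elts Y"
proof -
  let ?class = "\<lambda>X Z. elts X \<simeq> elts Z"
  have definable: "definable1 (?class Z)" for Z
    by (intro definable_intros)
  have refl: "?class Z Z" for Z
    by (simp add: equipollent_refl)
  have class_eq: "?class X = ?class Y" if "?class X Z" "?class Y Z" for X Y Z
    using that equipollent_trans equipollent_sym by blast
  have "scott mem (?class X) = scott mem (?class Y) \<longleftrightarrow> ?class X = ?class Y"
    by (rule scott_eq_iff[OF definable definable refl refl class_eq])
  also have "\<dots> \<longleftrightarrow> elts X \<simeq> elts Y"
    using class_eq refl by metis
  finally show ?thesis
    unfolding card_of_def equipotent_iff .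
qed

lemma cardinal_card_of [simp]: "cardinal mem (card_of mem X)"
  unfolding cardinal_def by blast

lemma eq_star_iff: "eq_star mem a b \<longleftrightarrow>
    (\<exists>X Y. card_of mem X = a \<and> card_of mem Y = b \<and> elts X \<approx> elts Y)"
  unfolding eq_star_def partial_surjection_exists_iff surj_eqv_def by blast

lemma eq_star_card_of_iff: "eq_star mem (card_of mem X) (card_of mem Y) \<longleftrightarrow> elts X \<approx> elts Y"
proof
  assume "eq_star mem (card_of mem X) (card_of mem Y)"
  then obtain X' Y' where "elts X' \<simeq> elts X" "elts Y' \<simeq> elts Y" "elts X' \<approx> elts Y'"
    unfolding eq_star_iff card_of_eq_iff by blast
  then show "elts X \<approx> elts Y"
    by (meson equipollent_imp_surj_eqv surj_eqv_sym surj_eqv_trans)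
qed (auto simp: eq_star_iff)

lemma definable_cardinal [definable_intros]:
  "definable_term t \<Longrightarrow> definable (\<lambda>s. cardinal mem (t s))"
  by (rule definable1_app) (unfold cardinal_def, intro definable_intros)

lemma definable_eq_star [definable_intros]:
  "definable_term t \<Longrightarrow> definable_term u \<Longrightarrow> definable (\<lambda>s. eq_star mem (t s) (u s))"
  by (rule definable2_app) (unfold eq_star_iff, intro definable_intros)

lemma surj_class_card_of_eq_iff:
  "surj_class mem (card_of mem X) = surj_class mem (card_of mem Y) \<longleftrightarrow> elts X \<approx> elts Y"
proof -
  let ?class = "\<lambda>X b. cardinal mem b \<and> eq_star mem (card_of mem X) b"
  have definable: "definable1 (?class Z)" for Z
    by (intro definable_intros)
  have refl: "?class Z (card_of mem Z)" for Z
    by (simp add: eq_star_card_of_iff surj_eqv_refl)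
  have class_eq: "?class X = ?class Y" if "elts X \<approx> elts Y" for X Y
  proof
    fix b
    have "eq_star mem (card_of mem X) (card_of mem Z) \<longleftrightarrow> eq_star mem (card_of mem Y) (card_of mem Z)" for Z
      unfolding eq_star_card_of_iff using that surj_eqv_sym surj_eqv_trans by blast
    then show "?class X b \<longleftrightarrow> ?class Y b"
      unfolding cardinal_def by blast
  qed
  have eqv: "elts X \<approx> elts Y" if "?class X b" "?class Y b" for X Y b
    using that eq_star_card_of_iff surj_eqv_sym surj_eqv_trans unfolding cardinal_def by blast
  have "scott mem (?class X) = scott mem (?class Y) \<longleftrightarrow> ?class X = ?class Y"
    by (rule scott_eq_iff[OF definable definable refl refl class_eq[OF eqv]])
  also have "\<dots> \<longleftrightarrow> elts X \<approx> elts Y"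
    using class_eq eqv refl by metis
  finally show ?thesis
    unfolding surj_class_def .
qed

definition surj_card :: "'a set \<Rightarrow> 'a" ("\<parallel>_\<parallel>") where
  "\<parallel>A\<parallel> = surj_class mem (card_of mem (set_of A))"

lemma definable_term_surj_card [definable_intros]:
  assumes "definable (\<lambda>s. s 0 \<in> A (\<lambda>i. s (Suc i)))"
  shows "definable_term (\<lambda>s. \<parallel>A s\<parallel>)"
proof -
  have "definable_fun (\<lambda>X. surj_class mem (card_of mem X))"
    unfolding surj_class_def by (intro definable_intros)
  then show ?thesis
    unfolding surj_card_def by (rule definable_fun_app) (intro definable_intros assms)
qed

lemma surj_card_eq_iff: "small A \<Longrightarrow> small B \<Longrightarrow> \<parallel>A\<parallel> = \<parallel>B\<parallel> \<longleftrightarrow> A \<approx> B"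
  by (simp add: surj_card_def surj_class_card_of_eq_iff)

lemma surj_card_eqI: "A \<approx> B \<Longrightarrow> \<parallel>A\<parallel> = \<parallel>B\<parallel>"
  using surj_card_eq_iff surj_le_small unfolding surj_eqv_def by blast

lemma equipollent_imp_surj_card_eq: "A \<simeq> B \<Longrightarrow> \<parallel>A\<parallel> = \<parallel>B\<parallel>"
  by (rule surj_card_eqI[OF equipollent_imp_surj_eqv])

lemma surj_le_antisym: "A \<preceq> B \<Longrightarrow> B \<preceq> A \<Longrightarrow> \<parallel>A\<parallel> = \<parallel>B\<parallel>"
  by (rule surj_card_eqI) (simp add: surj_eqv_def)

lemma surj_le_cong:
  assumes "A \<preceq> B" "small A'" "small B'" "\<parallel>A'\<parallel> = \<parallel>A\<parallel>" "\<parallel>B'\<parallel> = \<parallel>B\<parallel>"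
  shows "A' \<preceq> B'"
proof -
  have "A' \<approx> A" "B' \<approx> B"
    using assms(2-5) surj_le_small[OF assms(1)] surj_card_eq_iff by blast+
  then show ?thesis
    using assms(1) surj_le_trans unfolding surj_eqv_def by blast
qed

lemma surjective_cardinal_surj_card [simp]: "surjective_cardinal mem \<parallel>A\<parallel>"
  unfolding surjective_cardinal_def surj_card_def using cardinal_card_of by blast

lemma surjective_cardinalE:
  assumes "surjective_cardinal mem a"
  obtains A where "small A" "a = \<parallel>A\<parallel>"
proof -
  obtain X where "a = \<parallel>elts X\<parallel>"
    using assms unfolding surjective_cardinal_def cardinal_def surj_card_def by auto
  then show thesis
    using that small_elts by blast
qed

subsection \<open>Addition\<close>

abbreviation surj_plus :: "'a \<Rightarrow> 'a \<Rightarrow> 'a" (infixl "\<boxplus>" 65) where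
  "a \<boxplus> b \<equiv> surj_add mem a b"

lemma card_add_card_of:
  "card_add mem (card_of mem X) (card_of mem Y) = card_of mem (set_of (elts X \<oplus> elts Y))"
proof -
  have sum_set: "the_set mem (\<lambda>p. (\<exists>x. x \<epsilon> X \<and> p = \<langle>x, \<zero>\<rangle>) \<or> (\<exists>y. y \<epsilon> Y \<and> p = \<langle>y, \<one>\<rangle>)) =
      set_of (elts X \<oplus> elts Y)" for X Y
    unfolding the_set_eq_set_of plus_def times_def
    by (intro arg_cong[where f = set_of]) (auto simp: elts_iff)
  have unique: "card_of mem (set_of (elts X' \<oplus> elts Y')) = card_of mem (set_of (elts X \<oplus> elts Y))"
    if "card_of mem X' = card_of mem X" "card_of mem Y' = card_of mem Y" for X' Y'
    using that by (simp add: card_of_eq_iff plus_equipollent)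
  show ?thesis
    unfolding card_add_def sum_set
    by (rule the_equality) (blast, use unique in blast)
qed

lemma surj_card_plus:
  assumes "small A" "small B"
  shows "\<parallel>A \<oplus> B\<parallel> = \<parallel>A\<parallel> \<boxplus> \<parallel>B\<parallel>"
proof -
  have unique: "\<parallel>A \<oplus> B\<parallel> = surj_class mem (card_add mem a b)"
    if "cardinal mem a" "cardinal mem b" "surj_class mem a = \<parallel>A\<parallel>" "surj_class mem b = \<parallel>B\<parallel>" for a b
  proof -
    from that(1,2) obtain X Y where X: "a = card_of mem X" "b = card_of mem Y"
      unfolding cardinal_def by blast
    then have "elts X \<approx> A" "elts Y \<approx> B"
      using that(3,4) assms by (simp_all add: surj_card_def X surj_class_card_of_eq_iff)
    then have "\<parallel>elts X \<oplus> elts Y\<parallel> = \<parallel>A \<oplus> B\<parallel>"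
      by (intro surj_card_eqI plus_surj_eqv)
    then show ?thesis
      unfolding X card_add_card_of by (simp flip: surj_card_def)
  qed
  show ?thesis
    unfolding surj_add_def
  proof (rule the_equality[symmetric])
    let ?a = "card_of mem (set_of A)" and ?b = "card_of mem (set_of B)"
    have "surj_class mem ?a = \<parallel>A\<parallel>" "surj_class mem ?b = \<parallel>B\<parallel>"
      by (simp_all only: surj_card_def)
    then show "\<exists>a b. cardinal mem a \<and> cardinal mem b \<and> surj_class mem a = \<parallel>A\<parallel> \<and>
        surj_class mem b = \<parallel>B\<parallel> \<and> \<parallel>A \<oplus> B\<parallel> = surj_class mem (card_add mem a b)"
      by (intro exI[of _ ?a] exI[of _ ?b] conjI unique cardinal_card_of)
  qed (elim exE conjE, simp only: unique)
qed

lemma surjective_cardinal_surj_add [simp]: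
  "surjective_cardinal mem a \<Longrightarrow> surjective_cardinal mem b \<Longrightarrow> surjective_cardinal mem (a \<boxplus> b)"
  by (elim surjective_cardinalE) (simp flip: surj_card_plus)

lemma surj_add_commute:
  assumes "surjective_cardinal mem a" "surjective_cardinal mem b"
  shows "a \<boxplus> b = b \<boxplus> a"
proof -
  obtain A B where "small A" "small B" "a = \<parallel>A\<parallel>" "b = \<parallel>B\<parallel>"
    using assms by (elim surjective_cardinalE)
  then show ?thesis
    using equipollent_imp_surj_card_eq[OF plus_commute] by (simp flip: surj_card_plus)
qed

lemma surj_add_assoc:
  assumes "surjective_cardinal mem a" "surjective_cardinal mem b" "surjective_cardinal mem c"
  shows "(a \<boxplus> b) \<boxplus> c = a \<boxplus> (b \<boxplus> c)"
proof -
  obtain A B C where "small A" "small B" "small C" "a = \<parallel>A\<parallel>" "b = \<parallel>B\<parallel>" "c = \<parallel>C\<parallel>"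
    using assms by (elim surjective_cardinalE)
  then show ?thesis
    using equipollent_imp_surj_card_eq[OF plus_assoc] by (simp flip: surj_card_plus)
qed

lemma surj_add_left_commute:
  "surjective_cardinal mem a \<Longrightarrow> surjective_cardinal mem b \<Longrightarrow> surjective_cardinal mem c \<Longrightarrow>
    a \<boxplus> (b \<boxplus> c) = b \<boxplus> (a \<boxplus> c)"
  by (metis surj_add_assoc surj_add_commute)

lemmas surj_add_ac = surj_add_assoc surj_add_commute surj_add_left_commute

lemma surj_card_Un_disjoint:
  "small A \<Longrightarrow> small B \<Longrightarrow> A \<inter> B = {} \<Longrightarrow> \<parallel>A \<union> B\<parallel> = \<parallel>A\<parallel> \<boxplus> \<parallel>B\<parallel>"
  using equipollent_imp_surj_card_eq[OF Un_disjoint_equipollent] by (simp add: surj_card_plus)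

lemma surj_card_Diff:
  assumes "small A" "small B" "B \<subseteq> A"
  shows "\<parallel>A\<parallel> = \<parallel>B\<parallel> \<boxplus> \<parallel>A - B\<parallel>"
proof -
  have "\<parallel>B \<union> (A - B)\<parallel> = \<parallel>B\<parallel> \<boxplus> \<parallel>A - B\<parallel>"
    using assms by (intro surj_card_Un_disjoint) auto
  then show ?thesis
    using assms(3) by (simp add: Un_absorb1)
qed

lemma surj_card_partition2:
  assumes "small P" "small V" "small W" "P \<subseteq> V \<union> W" "V \<inter> W = {}"
  shows "\<parallel>P\<parallel> = \<parallel>P \<inter> V\<parallel> \<boxplus> \<parallel>P \<inter> W\<parallel>"
proof -
  have "\<parallel>P \<inter> V \<union> P \<inter> W\<parallel> = \<parallel>P \<inter> V\<parallel> \<boxplus> \<parallel>P \<inter> W\<parallel>"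
    by (rule surj_card_Un_disjoint) (use assms in auto)
  moreover have "P \<inter> V \<union> P \<inter> W = P"
    using assms(4) by blast
  ultimately show ?thesis by simp
qed

lemma surj_card_partition3:
  assumes "small P" "small U" "small V" "small W" "P \<subseteq> U \<union> V \<union> W" "U \<inter> V = {}" "(U \<union> V) \<inter> W = {}"
  shows "\<parallel>P\<parallel> = \<parallel>P \<inter> U\<parallel> \<boxplus> \<parallel>P \<inter> V\<parallel> \<boxplus> \<parallel>P \<inter> W\<parallel>"
proof -
  have "\<parallel>P\<parallel> = \<parallel>P \<inter> (U \<union> V)\<parallel> \<boxplus> \<parallel>P \<inter> W\<parallel>"
    by (rule surj_card_partition2) (use assms in auto)
  moreover have "\<parallel>P \<inter> U \<union> P \<inter> V\<parallel> = \<parallel>P \<inter> U\<parallel> \<boxplus> \<parallel>P \<inter> V\<parallel>"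
    by (rule surj_card_Un_disjoint) (use assms in auto)
  ultimately show ?thesis
    by (simp add: Int_Un_distrib)
qed

lemma surj_card_times_singleton: "small A \<Longrightarrow> \<parallel>A \<otimes> {i}\<parallel> = \<parallel>A\<parallel>"
  by (rule equipollent_imp_surj_card_eq[OF times_singleton_equipollent])

lemma surj_add_empty:
  assumes "surjective_cardinal mem a"
  shows "a \<boxplus> \<parallel>{}\<parallel> = a"
proof -
  obtain A where "small A" "a = \<parallel>A\<parallel>"
    using assms by (elim surjective_cardinalE)
  then show ?thesis
    using surj_card_Un_disjoint[of A "{}"] by simp
qed

subsection \<open>Countable sums\<close>

lemma surj_card_Oplus_split_first:
  assumes "family F"
  shows "\<parallel>\<Oplus>n. F n\<parallel> = \<parallel>F \<zero>\<parallel> \<boxplus> \<parallel>\<Oplus>n. F (suc n)\<parallel>"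
proof -
  have "family (\<lambda>n. F (suc n))"
    by (rule family_comp[OF assms]) (intro definable_intros)
  then show ?thesis
    using equipollent_imp_surj_card_eq[OF Oplus_split_first[OF assms]] small_family[OF assms]
    by (simp add: surj_card_plus)
qed

lemma surj_card_Oplus_plus:
  "family F \<Longrightarrow> family G \<Longrightarrow> \<parallel>\<Oplus>n. F n \<oplus> G n\<parallel> = \<parallel>\<Oplus>n. F n\<parallel> \<boxplus> \<parallel>\<Oplus>n. G n\<parallel>"
  using equipollent_imp_surj_card_eq[OF Oplus_plus_distrib] by (simp add: surj_card_plus)

end

context zf_ac
begin

lemma card_sum_eq:
  assumes F: "family F" and a: "sequence mem a"
    and a_F: "\<And>n. n \<in> \<omega> \<Longrightarrow> app mem a n = card_of mem (set_of (F n))"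
  shows "card_sum mem a = card_of mem (set_of (\<Oplus>n. F n))"
proof -
  have sum_set: "the_set mem (\<lambda>p. \<exists>n x. n \<epsilon> omega mem \<and> x \<epsilon> app mem X n \<and> p = \<langle>x, n\<rangle>) =
      set_of (\<Oplus>n. elts (app mem X n))" for X
    unfolding the_set_eq_set_of Oplus_def times_def
    by (intro arg_cong[where f = set_of]) (auto simp: elts_iff)
  have set_of_F: "definable_fun (\<lambda>n. set_of (F n))"
    by (intro definable_intros definable_family[OF F])
  have unique: "card_of mem (set_of (\<Oplus>n. elts (app mem X n))) = card_of mem (set_of (\<Oplus>n. F n))"
    if X: "sequence mem X" "\<And>n. n \<in> \<omega> \<Longrightarrow> card_of mem (app mem X n) = app mem a n" for X
  proof -
    have "elts (app mem X n) \<simeq> F n" if "n \<in> \<omega>" for n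
      using X(2)[OF that] a_F[OF that] small_family[OF F] by (simp add: card_of_eq_iff)
    moreover have "family (\<lambda>n. elts (app mem X n))"
      by (intro family_elts definable_fun_app_sequence X(1))
    ultimately have "(\<Oplus>n. elts (app mem X n)) \<simeq> (\<Oplus>n. F n)"
      using F by (intro Oplus_equipollent)
    then show ?thesis
      by (simp add: card_of_eq_iff equipollent_def)
  qed
  show ?thesis
    unfolding card_sum_def sum_set
  proof (rule the_equality)
    let ?X = "seq_of mem (\<lambda>n. set_of (F n))"
    have "sequence mem ?X" "\<And>n. n \<in> \<omega> \<Longrightarrow> card_of mem (app mem ?X n) = app mem a n"
      by (simp_all add: sequence_seq_of[OF set_of_F] app_seq_of[OF set_of_F] a_F)
    then show "\<exists>X. sequence mem X \<and> (\<forall>n. n \<epsilon> omega mem \<longrightarrow> card_of mem (app mem X n) = app mem a n) \<and>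
        card_of mem (set_of (\<Oplus>n. F n)) = card_of mem (set_of (\<Oplus>n. elts (app mem X n)))"
      using unique[of ?X] by (intro exI[of _ ?X]) (simp add: elts_iff)
  qed (use unique in \<open>auto simp: elts_iff\<close>)
qed

lemma surj_sum_eq:
  assumes F: "family F" and S: "sequence mem S" and S_F: "\<And>n. n \<in> \<omega> \<Longrightarrow> app mem S n = \<parallel>F n\<parallel>"
  shows "surj_sum mem S = \<parallel>\<Oplus>n. F n\<parallel>"
proof -
  have card_F: "definable_fun (\<lambda>n. card_of mem (set_of (F n)))"
    by (intro definable_intros definable_family[OF F])
  have unique: "surj_class mem (card_sum mem a) = \<parallel>\<Oplus>n. F n\<parallel>"
    if a: "sequence mem a" "\<And>n. n \<in> \<omega> \<Longrightarrow> cardinal mem (app mem a n)"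
      "\<And>n. n \<in> \<omega> \<Longrightarrow> surj_class mem (app mem a n) = app mem S n" for a
  proof -
    have "definable2 (\<lambda>n X. app mem a n = card_of mem X)"
      by (intro definable_intros definable_fun_app[OF definable_fun_app_sequence[OF a(1)]])
    moreover have "\<exists>X. app mem a n = card_of mem X" if "n \<in> \<omega>" for n
      using a(2)[OF that] unfolding cardinal_def .
    ultimately obtain X where X: "definable_fun X" "\<forall>n\<in>\<omega>. app mem a n = card_of mem (X n)"
      by (rule countable_choice)
    then have fam_X: "family (\<lambda>n. elts (X n))"
      by (intro family_elts)
    then have "card_sum mem a = card_of mem (set_of (\<Oplus>n. elts (X n)))"
      using a(1) X(2) by (intro card_sum_eq) simp_all
    moreover have "elts (X n) \<approx> F n" if "n \<in> \<omega>" for n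
      using a(3)[OF that] X(2) S_F[OF that] that small_family[OF F]
      by (simp add: surj_card_def surj_class_card_of_eq_iff)
    then have "(\<Oplus>n. elts (X n)) \<approx> (\<Oplus>n. F n)"
      using fam_X F by (intro Oplus_surj_eqv)
    ultimately show ?thesis
      using surj_card_eqI by (simp flip: surj_card_def)
  qed
  show ?thesis
    unfolding surj_sum_def
  proof (rule the_equality)
    let ?a = "seq_of mem (\<lambda>n. card_of mem (set_of (F n)))"
    have a: "sequence mem ?a" "\<And>n. n \<in> \<omega> \<Longrightarrow> cardinal mem (app mem ?a n)"
      "\<And>n. n \<in> \<omega> \<Longrightarrow> surj_class mem (app mem ?a n) = app mem S n"
      by (simp_all add: sequence_seq_of[OF card_F] app_seq_of[OF card_F] S_F surj_card_def)
    then show "\<exists>a. sequence mem a \<and>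
        (\<forall>n. n \<epsilon> omega mem \<longrightarrow> cardinal mem (app mem a n) \<and> surj_class mem (app mem a n) = app mem S n) \<and>
        \<parallel>\<Oplus>n. F n\<parallel> = surj_class mem (card_sum mem a)"
      using unique[of ?a] by (intro exI[of _ ?a]) (simp add: elts_iff)
  qed (use unique in \<open>auto simp: elts_iff\<close>)
qed

lemma surj_sum_seq_of:
  assumes F: "family F" and t: "\<And>n. n \<in> \<omega> \<Longrightarrow> t n = \<parallel>F n\<parallel>"
  shows "surj_sum mem (seq_of mem t) = \<parallel>\<Oplus>n. F n\<parallel>"
proof -
  have card_F: "definable_fun (\<lambda>n. \<parallel>F n\<parallel>)"
    by (intro definable_intros definable_family[OF F])
  have "seq_of mem t = seq_of mem (\<lambda>n. \<parallel>F n\<parallel>)"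
    by (rule seq_of_cong[OF t])
  then show ?thesis
    using surj_sum_eq[OF F sequence_seq_of[OF card_F] app_seq_of[OF card_F]] by simp
qed

lemma sequence_in_surjective_cardinalsE:
  assumes "sequence_in mem (surjective_cardinal mem) S"
  obtains F where "family F" "\<forall>n\<in>\<omega>. app mem S n = \<parallel>F n\<parallel>" "surj_sum mem S = \<parallel>\<Oplus>n. F n\<parallel>"
proof -
  have S: "sequence mem S"
    using assms by (simp add: sequence_in_def)
  have "definable2 (\<lambda>n X. app mem S n = \<parallel>elts X\<parallel>)"
    by (intro definable_intros definable_fun_app[OF definable_fun_app_sequence[OF S]])
  moreover have "\<exists>X. app mem S n = \<parallel>elts X\<parallel>" if "n \<in> \<omega>" for n
  proof -
    have "surjective_cardinal mem (app mem S n)"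
      using assms that by (simp add: sequence_in_def elts_iff)
    then show ?thesis
      by (metis smallE surjective_cardinalE)
  qed
  ultimately obtain X where X: "definable_fun X" "\<forall>n\<in>\<omega>. app mem S n = \<parallel>elts (X n)\<parallel>"
    by (rule countable_choice)
  have "family (\<lambda>n. elts (X n))"
    by (rule family_elts[OF X(1)])
  then show thesis
    using X(2) by (intro that[OF _ X(2)] surj_sum_eq S) simp_all
qed

end

context zf
begin

section \<open>Absorption\<close>

definition absorbs :: "'a set \<Rightarrow> 'a set \<Rightarrow> bool" where
  "absorbs A Y \<longleftrightarrow> A \<oplus> Y \<preceq> A"

lemma absorbs_small: "absorbs A Y \<Longrightarrow> small A" "absorbs A Y \<Longrightarrow> small Y"
  unfolding absorbs_def using surj_le_small small_plus_iff by blast+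

lemma absorbs_iff:
  assumes "small A" "small Y"
  shows "absorbs A Y \<longleftrightarrow> \<parallel>A\<parallel> \<boxplus> \<parallel>Y\<parallel> = \<parallel>A\<parallel>"
proof -
  have "A \<preceq> A \<oplus> Y"
    using assms by (rule surj_le_plus1)
  then have "absorbs A Y \<longleftrightarrow> A \<oplus> Y \<approx> A"
    by (simp add: absorbs_def surj_eqv_def)
  also have "\<dots> \<longleftrightarrow> \<parallel>A\<parallel> \<boxplus> \<parallel>Y\<parallel> = \<parallel>A\<parallel>"
    using assms by (simp add: surj_card_eq_iff flip: surj_card_plus)
  finally show ?thesis .
qed

lemma absorbsD: "absorbs A Y \<Longrightarrow> \<parallel>A\<parallel> \<boxplus> \<parallel>Y\<parallel> = \<parallel>A\<parallel>"
  using absorbs_iff absorbs_small by blast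

lemma definable_absorbs [definable_intros]:
  "definable (\<lambda>s. s 0 \<in> A (\<lambda>i. s (Suc i))) \<Longrightarrow> definable (\<lambda>s. s 0 \<in> Y (\<lambda>i. s (Suc i))) \<Longrightarrow>
    definable (\<lambda>s. s 0 \<in> A (\<lambda>i. s (Suc i)) \<oplus> Y (\<lambda>i. s (Suc i))) \<Longrightarrow>
    definable (\<lambda>s. absorbs (A s) (Y s))"
  unfolding absorbs_def by (rule definable_surj_le)

lemma absorbs_mono:
  assumes "absorbs A Y" "Y' \<preceq> Y"
  shows "absorbs A Y'"
proof -
  have "A \<oplus> Y' \<preceq> A \<oplus> Y"
    using assms absorbs_small by (intro plus_mono surj_le_refl)
  also have "A \<oplus> Y \<preceq> A"
    using assms(1) by (simp add: absorbs_def)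
  finally show ?thesis
    by (simp add: absorbs_def)
qed

lemma absorbs_subset: "absorbs A Y \<Longrightarrow> small Y' \<Longrightarrow> Y' \<subseteq> Y \<Longrightarrow> absorbs A Y'"
  by (rule absorbs_mono[OF _ subset_imp_surj_le[OF absorbs_small(2)]])

lemma absorbs_surj_le: "absorbs A Y \<Longrightarrow> Y \<preceq> A"
  by (meson absorbs_def absorbs_small surj_le_plus2 surj_le_trans)

lemma absorbs_cong: "\<parallel>A\<parallel> = \<parallel>B\<parallel> \<Longrightarrow> absorbs A Y \<Longrightarrow> small B \<Longrightarrow> absorbs B Y"
  using absorbs_iff[of B Y] absorbsD[of A Y] absorbs_small(2)[of A Y] by simp

lemma absorbs_plus_left:
  assumes "absorbs A Y" "small B"
  shows "absorbs (A \<oplus> B) Y"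
proof -
  note small = absorbs_small[OF assms(1)] assms(2)
  have "(\<parallel>A\<parallel> \<boxplus> \<parallel>B\<parallel>) \<boxplus> \<parallel>Y\<parallel> = (\<parallel>A\<parallel> \<boxplus> \<parallel>Y\<parallel>) \<boxplus> \<parallel>B\<parallel>"
    by (simp add: surj_add_ac)
  then show ?thesis
    using small absorbsD[OF assms(1)] by (simp add: absorbs_iff surj_card_plus)
qed

lemma absorbs_plus:
  assumes "absorbs A Y" "absorbs A Z"
  shows "absorbs A (Y \<oplus> Z)"
proof -
  note small = absorbs_small[OF assms(1)] absorbs_small[OF assms(2)]
  have "\<parallel>A\<parallel> \<boxplus> (\<parallel>Y\<parallel> \<boxplus> \<parallel>Z\<parallel>) = (\<parallel>A\<parallel> \<boxplus> \<parallel>Y\<parallel>) \<boxplus> \<parallel>Z\<parallel>"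
    by (simp add: surj_add_assoc)
  then show ?thesis
    using small absorbsD[OF assms(1)] absorbsD[OF assms(2)] by (simp add: absorbs_iff surj_card_plus)
qed

lemma absorbs_Un: "absorbs A Y \<Longrightarrow> absorbs A Z \<Longrightarrow> absorbs A (Y \<union> Z)"
  by (rule absorbs_mono[OF absorbs_plus Un_surj_le_plus]) (simp_all add: absorbs_small)

lemma absorbs_superset:
  assumes "absorbs A Y" "A \<subseteq> B" "small B"
  shows "absorbs B Y"
proof -
  have A: "small A"
    by (rule absorbs_small(1)[OF assms(1)])
  then have "\<parallel>A \<oplus> (B - A)\<parallel> = \<parallel>B\<parallel>"
    using surj_card_Diff[OF assms(3) _ assms(2)] assms(3) by (simp add: surj_card_plus)
  moreover have "absorbs (A \<oplus> (B - A)) Y"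
    using assms A by (intro absorbs_plus_left small_Diff)
  ultimately show ?thesis
    by (rule absorbs_cong[OF _ _ assms(3)])
qed

subsection \<open>Recursion on sets\<close>

definition set_rec :: "'a set \<Rightarrow> 'a set \<Rightarrow> ('a \<Rightarrow> 'a set \<Rightarrow> 'a set) \<Rightarrow> 'a \<Rightarrow> 'a set" where
  "set_rec C S step n = elts (omega_rec (\<lambda>n u. set_of (C \<inter> step n (elts u))) (set_of (C \<inter> S)) n)"

lemma
  assumes C: "small C" and S: "definable1 (\<lambda>x. x \<in> S)"
    and step: "definable3 (\<lambda>n u x. x \<in> step n (elts u))"
  shows family_set_rec: "family (set_rec C S step)"
    and set_rec_zero: "set_rec C S step \<zero> = C \<inter> S"
    and set_rec_suc: "n \<in> \<omega> \<Longrightarrow> set_rec C S step (suc n) = C \<inter> step n (set_rec C S step n)"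
proof -
  have H: "definable_fun2 (\<lambda>n u. set_of (C \<inter> step n (elts u)))"
    by (intro definable_intros definable_small_set[OF C] definable3_app[OF step])
  show "family (set_rec C S step)"
    unfolding set_rec_def by (rule family_elts[OF definable_omega_rec[OF H]])
  have "small {x \<in> C. x \<in> S}"
    by (rule small_Collect[OF C S])
  then show "set_rec C S step \<zero> = C \<inter> S"
    by (simp add: set_rec_def omega_rec_zero[OF H] Collect_conj_eq)
  have "small {x \<in> C. x \<in> step n (elts u)}" for n u
    by (rule small_Collect[OF C]) (intro definable_intros definable3_app[OF step])
  then have "elts (set_of (C \<inter> step n (elts u))) = C \<inter> step n (elts u)" for n u
    by (simp add: Collect_conj_eq)
  then show "set_rec C S step (suc n) = C \<inter> step n (set_rec C S step n)" if "n \<in> \<omega>"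
    unfolding set_rec_def omega_rec_suc[OF H that] .
qed

subsection \<open>Absorption of countable sums\<close>

definition stay :: "('a \<Rightarrow> 'a \<Rightarrow> bool) \<Rightarrow> 'a set \<Rightarrow> 'a \<Rightarrow> 'a \<Rightarrow> bool" where
  "stay R A x a \<longleftrightarrow> R x \<langle>a, \<zero>\<rangle> \<or> x \<in> A \<and> a = x \<and> \<not> (\<exists>q. R x q)"

definition leave :: "('a \<Rightarrow> 'a \<Rightarrow> bool) \<Rightarrow> 'a \<Rightarrow> 'a \<Rightarrow> bool" where
  "leave R x y \<longleftrightarrow> R x \<langle>y, \<one>\<rangle>"

lemma onto_stay:
  assumes R: "onto R A (A \<oplus> Y)"
  shows "onto (stay R A) A A"
  unfolding onto_def
proof (intro conjI allI impI ballI)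
  show "x \<in> A" "a \<in> A" if "stay R A x a" for x a
    using that ontoD(1)[OF R] ontoD(2)[OF R, of x "\<langle>a, \<zero>\<rangle>"] by (auto simp: stay_def)
  show "right_unique (stay R A)"
  proof (rule right_uniqueI)
    show "a = b" if "stay R A x a" "stay R A x b" for x a b
      using that right_uniqueD[OF ontoD(3)[OF R], of x "\<langle>a, \<zero>\<rangle>" "\<langle>b, \<zero>\<rangle>"] by (auto simp: stay_def)
  qed
  show "\<exists>x. stay R A x a" if "a \<in> A" for a
    using that ontoD(4)[OF R, of "\<langle>a, \<zero>\<rangle>"] by (auto simp: stay_def)
qed

lemma leave_inject: "onto R A (A \<oplus> Y) \<Longrightarrow> leave R x y \<Longrightarrow> leave R x z \<Longrightarrow> y = z"
  unfolding leave_def using right_uniqueD[OF ontoD(3), of R _ _ x "\<langle>y, \<one>\<rangle>" "\<langle>z, \<one>\<rangle>"] by simp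

lemma leave_not_stay: "onto R A (A \<oplus> Y) \<Longrightarrow> leave R x y \<Longrightarrow> \<not> stay R A x a"
  unfolding leave_def stay_def
  using right_uniqueD[OF ontoD(3), of R _ _ x "\<langle>y, \<one>\<rangle>" "\<langle>a, \<zero>\<rangle>"] by auto

lemma leave_exists:
  assumes "onto R A (A \<oplus> Y)" "y \<in> Y"
  obtains x where "x \<in> A" "leave R x y"
  using ontoD(1,4)[OF assms(1)] assms(2) unfolding leave_def by (metis pair_in_plus(2))

lemma doubling_recursion:
  assumes A: "small A" and K: "definable3 K"
  obtains G where "definable3 G" "\<forall>x y. G \<zero> x y \<longleftrightarrow> x \<in> A \<and> y = x"
    "\<forall>n\<in>\<omega>. \<forall>x y. G (suc n) x y \<longleftrightarrow> x \<in> A \<and> y \<in> A \<and> (G n OO K n OO G n) x y"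
proof -
  define diagonal where "diagonal = {p. \<exists>x. p = \<langle>x, x\<rangle>}"
  define step where "step n U = {p. \<exists>x a b c. p = \<langle>x, c\<rangle> \<and> \<langle>x, a\<rangle> \<in> U \<and> K n a b \<and> \<langle>b, c\<rangle> \<in> U}" for n U
  define F where "F = set_rec (A \<otimes> A) diagonal step"
  define G where "G n x y \<longleftrightarrow> \<langle>x, y\<rangle> \<in> F n" for n x y
  have diagonal: "definable1 (\<lambda>p. p \<in> diagonal)"
    unfolding diagonal_def by (intro definable_intros)
  have step: "definable3 (\<lambda>n u p. p \<in> step n (elts u))"
    unfolding step_def by (intro definable_intros definable3_app[OF K])
  note recursion = small_times[OF A A] diagonal step
  show thesis
  proof (rule that)
    show "definable3 G"
      unfolding G_def F_def by (intro definable_intros definable_family[OF family_set_rec[OF recursion]])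
    show "\<forall>x y. G \<zero> x y \<longleftrightarrow> x \<in> A \<and> y = x"
      unfolding G_def F_def set_rec_zero[OF recursion] by (auto simp: diagonal_def)
    have "G (suc n) x y \<longleftrightarrow> x \<in> A \<and> y \<in> A \<and> (G n OO K n OO G n) x y" if "n \<in> \<omega>" for n x y
      unfolding G_def F_def set_rec_suc[OF recursion that] by (auto simp: step_def)
    then show "\<forall>n\<in>\<omega>. \<forall>x y. G (suc n) x y \<longleftrightarrow> x \<in> A \<and> y \<in> A \<and> (G n OO K n OO G n) x y"
      by blast
  qed
qed

lemma doubling_iteration:
  assumes A: "small A" and K: "definable3 K" and onto: "\<forall>n\<in>\<omega>. onto (K n) A A"
  obtains G where "definable3 G" "\<forall>n\<in>\<omega>. G (suc n) = G n OO K n OO G n" "\<forall>n\<in>\<omega>. onto (G n) A A"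
proof -
  obtain G where G: "definable3 G" and G_zero: "\<forall>x y. G \<zero> x y \<longleftrightarrow> x \<in> A \<and> y = x"
    and G_suc_iff: "\<forall>n\<in>\<omega>. \<forall>x y. G (suc n) x y \<longleftrightarrow> x \<in> A \<and> y \<in> A \<and> (G n OO K n OO G n) x y"
    using A K by (rule doubling_recursion)
  have onto_suc: "onto (G n OO K n OO G n) A A" if "n \<in> \<omega>" "onto (G n) A A" for n
    using that onto by (intro onto_relcompp) auto
  have G_suc: "G (suc n) = G n OO K n OO G n" if n: "n \<in> \<omega>" and "onto (G n) A A" for n
  proof (intro ext)
    fix x y
    show "G (suc n) x y \<longleftrightarrow> (G n OO K n OO G n) x y"
      using bspec[OF G_suc_iff n] ontoD(1,2)[OF onto_suc[OF that]] by blast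
  qed
  have "onto (G n) A A" if "n \<in> \<omega>" for n
    using that
  proof (induction rule: omega_induct)
    case definable
    show ?case
      unfolding onto_def right_unique_def
      by (intro definable_intros definable_small_set[OF A] definable3_app[OF G])
  next
    case zero
    show ?case
      using G_zero by (auto simp: onto_def right_unique_def)
  next
    case (suc n)
    then show ?case
      using G_suc onto_suc by simp
  qed
  then show thesis
    using G G_suc by (intro that[of G]) auto
qed

end

locale absorption_schedule = zf +
  fixes A Y R G
  assumes small_A: "small A" and family_Y: "family Y"
    and R: "definable3 R" and onto_R: "\<And>n. n \<in> \<omega> \<Longrightarrow> onto (R n) A (A \<oplus> Y n)"
    and G: "definable3 G" and onto_G: "\<And>n. n \<in> \<omega> \<Longrightarrow> onto (G n) A A"
    and G_suc: "n \<in> \<omega> \<Longrightarrow> G (suc n) = G n OO stay (R n) A OO G n"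
begin

definition alive :: "'a \<Rightarrow> 'a \<Rightarrow> bool" where
  "alive n x \<longleftrightarrow> (\<exists>a. G n x a)"

lemma definable_stay: "definable3 (\<lambda>n. stay (R n) A)"
  unfolding stay_def by (intro definable_intros definable_small_set[OF small_A] definable3_app[OF R])

lemma definable_leave: "definable3 (\<lambda>n. leave (R n))"
  unfolding leave_def by (intro definable_intros definable3_app[OF R])

lemma definable_alive: "definable2 alive"
  unfolding alive_def by (intro definable_intros definable3_app[OF G])

lemma alive_sucE:
  assumes "n \<in> \<omega>" "alive (suc n) x"
  obtains a b where "G n x a" "stay (R n) A a b" "alive n b"
  using assms G_suc by (auto simp: alive_def)

lemma alive_suc_imp_alive: "n \<in> \<omega> \<Longrightarrow> alive (suc n) x \<Longrightarrow> alive n x"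
  by (meson alive_def alive_sucE)

lemma alive_antimono:
  assumes "m \<in> \<omega>" "n \<in> elts m" "alive m x"
  shows "alive (suc n) x"
proof -
  have "\<forall>n\<in>elts m. alive m x \<longrightarrow> alive (suc n) x"
    using assms(1)
  proof (induction rule: omega_induct)
    case definable
    show ?case by (intro definable_intros definable2_app[OF definable_alive])
  next
    case (suc m)
    then show ?case
      using alive_suc_imp_alive[OF suc(1)] by auto
  qed simp
  then show ?thesis
    using assms(2,3) by blast
qed

lemma leaves_once:
  assumes "m \<in> \<omega>" "n \<in> \<omega>" "alive m x" "\<not> alive (suc m) x" "alive n x" "\<not> alive (suc n) x"
  shows "m = n"
  using omega_linear[OF assms(1,2)] alive_antimono assms by blast

definition destination :: "'a \<Rightarrow> 'a \<Rightarrow> bool" where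
  "destination x b \<longleftrightarrow> x \<in> A \<and> (\<forall>n\<in>\<omega>. alive n x) \<and> b = \<langle>x, \<zero>\<rangle> \<or>
    (\<exists>n\<in>\<omega>. \<exists>a. G n x a \<and> \<not> alive (suc n) x \<and>
      ((\<exists>y. leave (R n) a y \<and> b = \<langle>\<langle>y, n\<rangle>, \<one>\<rangle>) \<or> (\<exists>c. stay (R n) A a c \<and> b = \<langle>c, \<zero>\<rangle>)))"

lemma definable_destination: "definable2 destination"
  unfolding destination_def
  by (intro definable_intros definable_small_set[OF small_A] definable3_app[OF G]
      definable3_app[OF definable_stay] definable3_app[OF definable_leave] definable2_app[OF definable_alive])

lemma destination_unique:
  assumes "destination x b" "destination x c"
  shows "b = c"
proof (cases "\<forall>n\<in>\<omega>. alive n x")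
  case True
  then show ?thesis
    using assms suc_in_omega unfolding destination_def by blast
next
  case False
  let ?leads = "\<lambda>n a b. (\<exists>y. leave (R n) a y \<and> b = \<langle>\<langle>y, n\<rangle>, \<one>\<rangle>) \<or>
    (\<exists>d. stay (R n) A a d \<and> b = \<langle>d, \<zero>\<rangle>)"
  obtain m a where m: "m \<in> \<omega>" "G m x a" "\<not> alive (suc m) x" "?leads m a b"
    using False assms(1) unfolding destination_def by blast
  obtain n a' where n: "n \<in> \<omega>" "G n x a'" "\<not> alive (suc n) x" "?leads n a' c"
    using False assms(2) unfolding destination_def by blast
  have "m = n"
    using leaves_once m n unfolding alive_def by blast
  moreover have "a = a'"
    using right_uniqueD[OF ontoD(3)[OF onto_G[OF n(1)]]] m(2) n(2) \<open>m = n\<close> by blast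
  ultimately show ?thesis
    using m(4) n(4) leave_inject[OF onto_R[OF n(1)]] leave_not_stay[OF onto_R[OF n(1)]]
      right_uniqueD[OF ontoD(3)[OF onto_stay[OF onto_R[OF n(1)]]]] by metis
qed

lemma destination_exists:
  assumes "n \<in> \<omega>" "a \<in> A" "\<And>b. stay (R n) A a b \<Longrightarrow> \<not> alive n b"
  obtains x where "x \<in> A" "G n x a" "\<not> alive (suc n) x"
proof -
  obtain x where x: "G n x a"
    using ontoD(4)[OF onto_G[OF assms(1)] assms(2)] by blast
  have "\<not> alive (suc n) x"
    using alive_sucE[OF assms(1)] right_uniqueD[OF ontoD(3)[OF onto_G[OF assms(1)]] x] assms(3) by metis
  then show thesis
    using that ontoD(1)[OF onto_G[OF assms(1)] x] x by blast
qed

lemma destination_stay: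
  assumes "c \<in> A"
  shows "\<exists>x\<in>A. destination x \<langle>c, \<zero>\<rangle>"
proof (cases "\<forall>n\<in>\<omega>. alive n c")
  case True
  then show ?thesis
    using assms unfolding destination_def by blast
next
  case False
  then obtain n where n: "n \<in> \<omega>" "\<not> alive n c" by blast
  note onto = onto_stay[OF onto_R[OF n(1)]]
  obtain a where a: "stay (R n) A a c"
    using ontoD(4)[OF onto assms] by blast
  then obtain x where "x \<in> A" "G n x a" "\<not> alive (suc n) x"
    using destination_exists[OF n(1)] ontoD(1)[OF onto a] right_uniqueD[OF ontoD(3)[OF onto] a] n(2) by metis
  then show ?thesis
    using n(1) a unfolding destination_def by blast
qed

lemma destination_leave:
  assumes "n \<in> \<omega>" "y \<in> Y n"
  shows "\<exists>x\<in>A. destination x \<langle>\<langle>y, n\<rangle>, \<one>\<rangle>"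
proof -
  obtain a where a: "a \<in> A" "leave (R n) a y"
    using leave_exists[OF onto_R[OF assms(1)] assms(2)] by blast
  then obtain x where "x \<in> A" "G n x a" "\<not> alive (suc n) x"
    using destination_exists[OF assms(1)] leave_not_stay[OF onto_R[OF assms(1)]] by metis
  then show ?thesis
    using assms(1) a(2) unfolding destination_def by blast
qed

lemma absorbs_Oplus_family: "absorbs A (\<Oplus>n. Y n)"
  unfolding absorbs_def
proof (rule surj_leI)
  show "\<exists>x\<in>A. destination x b" if "b \<in> A \<oplus> (\<Oplus>n. Y n)" for b
    using that
  proof (cases rule: in_plusE)
    case (right p)
    then show ?thesis
      using destination_leave by (elim in_OplusE) blast
  qed (use destination_stay in blast)
qed (use small_A family_Y definable_destination destination_unique in auto)

end

context zf_ac
begin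

text \<open>
  If \<open>R\<^sub>n\<close> witnesses that \<open>A\<close> absorbs \<open>Y\<^sub>n\<close>, run the schedule \<open>G\<^sub>n\<^sub>+\<^sub>1 = G\<^sub>n R\<^sub>n G\<^sub>n\<close>.
  The points that leave \<open>A\<close> during the second run of \<open>G\<^sub>n\<close> are mapped by \<open>R\<^sub>n G\<^sub>n\<close> onto the points
  that leave \<open>A\<close> during the first one, so the points that leave at all cover themselves and
  every \<open>Y\<^sub>n\<close>.
\<close>

lemma absorbs_Oplus:
  assumes A: "small A" and Y: "family Y" and absorbs: "\<And>n. n \<in> \<omega> \<Longrightarrow> absorbs A (Y n)"
  shows "absorbs A (\<Oplus>n. Y n)"
proof -
  have "family (\<lambda>n. A \<oplus> Y n)" "family (\<lambda>_. A)"
    by (intro family_plus family_const A Y)+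
  moreover have "A \<oplus> Y n \<preceq> A" if "n \<in> \<omega>" for n
    using absorbs[OF that] unfolding absorbs_def .
  ultimately obtain R where R: "definable3 R" "\<forall>n\<in>\<omega>. onto (R n) A (A \<oplus> Y n)"
    by (rule choose_onto)
  have "definable3 (\<lambda>n. stay (R n) A)"
    unfolding stay_def by (intro definable_intros definable_small_set[OF A] definable3_app[OF R(1)])
  moreover have "\<forall>n\<in>\<omega>. onto (stay (R n) A) A A"
    using onto_stay R(2) by blast
  ultimately obtain G where "definable3 G" "\<forall>n\<in>\<omega>. G (suc n) = G n OO stay (R n) A OO G n"
    "\<forall>n\<in>\<omega>. onto (G n) A A"
    by (rule doubling_iteration[OF A])
  then interpret absorption_schedule mem A Y R G
    using A Y R by unfold_locales auto
  show ?thesis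
    by (rule absorbs_Oplus_family)
qed

lemma absorbs_UN:
  assumes "small A" "family Y" "\<And>n. n \<in> \<omega> \<Longrightarrow> absorbs A (Y n)"
  shows "absorbs A (\<Union>n\<in>\<omega>. Y n)"
  by (rule absorbs_mono[OF absorbs_Oplus[OF assms] UN_surj_le_Oplus[OF assms(2)]])

end

context zf
begin

section \<open>Orbits of partial functions\<close>

text \<open>
  Paths have a length in the natural numbers of the structure, so this is not the transitive
  closure of HOL.
\<close>

definition reach :: "('a \<Rightarrow> 'a \<Rightarrow> bool) \<Rightarrow> 'a \<Rightarrow> 'a \<Rightarrow> bool" where
  "reach R x y \<longleftrightarrow> (\<forall>S. x \<in> elts S \<and> (\<forall>u v. u \<in> elts S \<and> R u v \<longrightarrow> v \<in> elts S) \<longrightarrow> y \<in> elts S)"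

definition bounded_rel :: "('a \<Rightarrow> 'a \<Rightarrow> bool) \<Rightarrow> bool" where
  "bounded_rel R \<longleftrightarrow> definable2 R \<and> (\<exists>C. small C \<and> (\<forall>x y. R x y \<longrightarrow> y \<in> C))"

lemma bounded_relD: "bounded_rel R \<Longrightarrow> definable2 R"
  by (simp add: bounded_rel_def)

definition images :: "('a \<Rightarrow> 'a \<Rightarrow> bool) \<Rightarrow> 'a set \<Rightarrow> 'a \<Rightarrow> 'a set" where
  "images R S = set_rec (S \<union> {y. \<exists>x. R x y}) S (\<lambda>n U. {y. \<exists>x\<in>U. R x y})"

lemma
  assumes R: "bounded_rel R" and S: "small S"
  shows family_images: "family (images R S)"
    and images_zero: "images R S \<zero> = S"
    and images_suc: "n \<in> \<omega> \<Longrightarrow> images R S (suc n) = {y. \<exists>x\<in>images R S n. R x y}"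
proof -
  obtain C where C: "small C" "\<forall>x y. R x y \<longrightarrow> y \<in> C"
    using R unfolding bounded_rel_def by blast
  note definable_R = definable2_app[OF bounded_relD[OF R]]
  have "small {y. \<exists>x. R x y}"
    by (rule small_subset[OF C(1)]) (use C(2) in blast, intro definable_intros definable_R)
  then have "small (S \<union> {y. \<exists>x. R x y})"
    using S by simp
  moreover have "definable1 (\<lambda>x. x \<in> S)"
    by (intro definable_intros definable_small_set S)
  moreover have "definable3 (\<lambda>n u y. y \<in> {y. \<exists>x\<in>elts u. R x y})"
    by (intro definable_intros definable_R)
  ultimately show "family (images R S)" "images R S \<zero> = S"
    "n \<in> \<omega> \<Longrightarrow> images R S (suc n) = {y. \<exists>x\<in>images R S n. R x y}"
    unfolding images_def by (simp_all add: family_set_rec set_rec_zero set_rec_suc) blast+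
qed

lemma definable2_reach:
  assumes R: "definable2 R"
  shows "definable2 (reach R)"
  unfolding reach_def by (intro definable_intros definable2_app[OF R])

lemma reach_refl: "reach R x x"
  by (simp add: reach_def)

lemma reach_step: "R x y \<Longrightarrow> reach R y z \<Longrightarrow> reach R x z"
  unfolding reach_def by blast

lemma reach_snoc: "reach R x y \<Longrightarrow> R y z \<Longrightarrow> reach R x z"
  unfolding reach_def by blast

lemma reach_trans: "reach R x y \<Longrightarrow> reach R y z \<Longrightarrow> reach R x z"
  unfolding reach_def by blast

lemma reach_mono: "R \<le> R' \<Longrightarrow> reach R x y \<Longrightarrow> reach R' x y"
  unfolding reach_def by blast

lemma reach_closed:
  assumes "reach R x y" "small S" "x \<in> S" "\<And>u v. u \<in> S \<Longrightarrow> R u v \<Longrightarrow> v \<in> S"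
  shows "y \<in> S"
proof -
  obtain s where "elts s = S"
    using assms(2) by (metis elts_set_of)
  then show ?thesis
    using assms(1,3,4) unfolding reach_def by blast
qed

lemma reach_induct [consumes 2, case_names definable refl step]:
  assumes "reach R x y" "bounded_rel R" "definable1 P" "P x" "\<And>u v. P u \<Longrightarrow> R u v \<Longrightarrow> P v"
  shows "P y"
proof -
  obtain C where C: "small C" "\<forall>x y. R x y \<longrightarrow> y \<in> C"
    using assms(2) unfolding bounded_rel_def by blast
  have "y \<in> {z \<in> insert x C. P z}"
    using assms(1)
  proof (rule reach_closed)
    show "small {z \<in> insert x C. P z}"
      by (intro small_Collect small_insert C(1) assms(3))
  qed (use assms(4,5) C(2) in auto)
  then show ?thesis by simp
qed

lemma reach_cases:
  assumes "reach R x y" "bounded_rel R"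
  shows "x = y \<or> (R OO reach R) x y"
  using assms
proof (induction rule: reach_induct)
  case definable
  note R = bounded_relD[OF assms(2)]
  show ?case
    by (intro definable_intros definable2_app[OF R] definable2_app[OF definable2_reach[OF R]])
next
  case (step u v)
  then show ?case
    using reach_refl[of R v] reach_snoc[of R _ u v] by blast
qed simp

lemma reach_relcompp:
  assumes "bounded_rel R" "reach R x y" "R y z"
  shows "(R OO reach R) x z"
  using reach_cases[OF assms(2,1)]
proof
  assume "x = y"
  then show ?thesis
    using assms(3) reach_refl by blast
next
  assume "(R OO reach R) x y"
  then show ?thesis
    using assms(3) reach_snoc[of R _ y z] by blast
qed

lemma reach_converse_induct [consumes 2, case_names definable refl step]:
  assumes "reach R x y" "bounded_rel R" "definable1 P" "P y" "\<And>u v. P v \<Longrightarrow> R u v \<Longrightarrow> P u"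
  shows "P x"
proof -
  have "P y \<longrightarrow> P x"
    using assms(1,2)
  proof (induction rule: reach_induct)
    case definable
    show ?case by (intro definable_intros definable1_app[OF assms(3)])
  qed (use assms(5) in auto)
  then show ?thesis
    using assms(4) by blast
qed

lemma reach_terminal_unique:
  assumes "right_unique R" "bounded_rel R"
    and "reach R x y" "\<And>v. \<not> R y v" and "reach R x z" "\<And>v. \<not> R z v"
  shows "y = z"
proof -
  have "reach R z y"
    using assms(5,2)
  proof (induction rule: reach_induct)
    case definable
    show ?case
      by (intro definable_intros definable2_app[OF definable2_reach[OF bounded_relD[OF assms(2)]]])
  next
    case (step u v)
    then show ?case
      using reach_cases[OF step(1) assms(2)] assms(4) right_uniqueD[OF assms(1)] by blast
  qed (rule assms(3))
  then show ?thesis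
    using reach_cases[OF _ assms(2)] assms(6) by blast
qed

subsection \<open>First returns\<close>

definition off :: "('a \<Rightarrow> 'a \<Rightarrow> bool) \<Rightarrow> 'a set \<Rightarrow> 'a \<Rightarrow> 'a \<Rightarrow> bool" where
  "off R X x y \<longleftrightarrow> x \<notin> X \<and> R x y"

definition first_visit :: "('a \<Rightarrow> 'a \<Rightarrow> bool) \<Rightarrow> 'a set \<Rightarrow> 'a \<Rightarrow> 'a \<Rightarrow> bool" where
  "first_visit R X x y \<longleftrightarrow> reach (off R X) x y \<and> y \<in> X"

lemma bounded_rel_off:
  assumes "bounded_rel R" "small X"
  shows "bounded_rel (off R X)"
proof -
  have "definable2 (off R X)"
    unfolding off_def
    by (intro definable_intros definable_small_set assms(2) definable2_app[OF bounded_relD[OF assms(1)]])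
  then show ?thesis
    using assms(1) unfolding bounded_rel_def off_def by blast
qed

lemma definable2_first_visit:
  assumes "bounded_rel R" "small X"
  shows "definable2 (first_visit R X)"
  unfolding first_visit_def
  by (intro definable_intros definable_small_set assms(2)
      definable2_app[OF definable2_reach[OF bounded_relD[OF bounded_rel_off[OF assms]]]])

lemma right_unique_first_visit:
  assumes "right_unique R" "bounded_rel R" "small X"
  shows "right_unique (first_visit R X)"
proof (rule right_uniqueI)
  fix x y z
  assume visits: "first_visit R X x y" "first_visit R X x z"
  show "y = z"
  proof (rule reach_terminal_unique)
    show "right_unique (off R X)"
      using assms(1) unfolding right_unique_def off_def by blast
  qed (use visits in \<open>auto simp: first_visit_def off_def[of R X y] off_def[of R X z] bounded_rel_off assms(2,3)\<close>)
qed

lemma first_visit_imp_reach: "first_visit R X x y \<Longrightarrow> reach R x y"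
  unfolding first_visit_def by (auto intro: reach_mono[of "off R X"] simp: off_def)

lemma first_return_exists:
  assumes R: "bounded_rel R" and X: "small X" "z \<in> X" "w \<in> X" and zw: "(R OO reach R) z w"
  shows "\<exists>x\<in>X. reach R z x \<and> (R OO first_visit R X) x w"
proof -
  note D = bounded_relD[OF R] definable2_first_visit[OF R X(1)]
  obtain p where p: "R z p" "reach R p w"
    using zw by blast
  have "first_visit R X p w \<or> (\<exists>x\<in>X. reach R p x \<and> (R OO first_visit R X) x w)"
    using p(2) R
  proof (induction rule: reach_converse_induct)
    case definable
    show ?case
      by (intro definable_intros definable_small_set[OF X(1)] definable2_app[OF definable2_reach[OF D(1)]]
          definable2_app[OF D(1)] definable2_app[OF D(2)])
  next
    case refl
    show ?case
      using X(3) by (simp add: first_visit_def reach_refl)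
  next
    case (step u v)
    show ?case
    proof (cases "u \<in> X")
      case True
      then show ?thesis
        using step reach_refl[of R u] reach_step[of R u v] by blast
    next
      case False
      then have "first_visit R X v w \<Longrightarrow> first_visit R X u w"
        using step(2) reach_step[of "off R X" u v] unfolding first_visit_def off_def[of R X u] by blast
      then show ?thesis
        using step reach_step[of R u v] by blast
    qed
  qed
  then show ?thesis
    using p(1) X(2) reach_refl[of R z] reach_step[of R z p] by blast
qed

lemma absorbsI_rel:
  assumes "small W" "small Z" "W \<inter> Z = {}" "definable2 R" "right_unique R"
    and "\<And>w. w \<in> W \<union> Z \<Longrightarrow> \<exists>u\<in>W. R u w"
  shows "absorbs W Z"
proof -
  have "W \<oplus> Z \<preceq> W \<union> Z"
    using equipollent_imp_surj_eqv[OF Un_disjoint_equipollent[OF assms(1-3)]] by (simp add: surj_eqv_def)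
  also have "W \<union> Z \<preceq> W"
    using assms(1,2,4,6) right_uniqueD[OF assms(5)] by (intro surj_leI[of W _ R]) auto
  finally show ?thesis
    by (simp add: absorbs_def)
qed

lemma absorbs_terminal:
  assumes R: "right_unique R" "bounded_rel R" and small: "small W" "small Z" and "W \<inter> Z = {}"
    and terminal: "\<And>z v. z \<in> Z \<Longrightarrow> \<not> R z v"
    and ancestor: "\<And>w z. w \<in> W \<union> Z \<Longrightarrow> z \<in> Z \<Longrightarrow> reach R w z \<Longrightarrow> \<exists>u\<in>W. (R OO reach R) u w"
  shows "absorbs W Z"
proof -
  define K where "K = {w \<in> W. \<exists>z\<in>Z. reach R w z}"
  have K: "small K"
    unfolding K_def
    by (intro small_Collect small definable_intros definable_small_set[OF small(2)]
        definable2_app[OF definable2_reach[OF bounded_relD[OF R(2)]]])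
  then have X: "small (K \<union> Z)"
    using small by simp
  have "absorbs K Z"
  proof (rule absorbsI_rel)
    show "definable2 (R OO first_visit R (K \<union> Z))"
      by (intro definable2_relcompp bounded_relD definable2_first_visit R X)
    show "right_unique (R OO first_visit R (K \<union> Z))"
      by (intro right_unique_OO right_unique_first_visit R X)
    show "\<exists>x\<in>K. (R OO first_visit R (K \<union> Z)) x w" if w: "w \<in> K \<union> Z" for w
    proof -
      obtain z where z: "z \<in> Z" "reach R w z"
        using w reach_refl[of R] unfolding K_def by blast
      then obtain u where u: "u \<in> W" "(R OO reach R) u w"
        using ancestor[of w z] w unfolding K_def by blast
      then have "reach R u z"
        using z(2) reach_step[of R u] reach_trans[of R _ w z] by blast
      then have "u \<in> K \<union> Z"
        using u(1) z(1) unfolding K_def by blast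
      then show ?thesis
        using first_return_exists[OF R(2) X _ w u(2)] terminal by blast
    qed
  qed (use K assms in \<open>auto simp: K_def\<close>)
  then show ?thesis
    by (rule absorbs_superset) (use small in \<open>auto simp: K_def\<close>)
qed

section \<open>Splitting an absorbed set\<close>

definition confined :: "('a \<Rightarrow> 'a \<Rightarrow> bool) \<Rightarrow> 'a set \<Rightarrow> 'a \<Rightarrow> bool" where
  "confined R P u \<longleftrightarrow> (\<forall>w. reach R w u \<longrightarrow> w \<in> P)"

lemma definable1_confined:
  assumes R: "definable2 R" and P: "small P"
  shows "definable1 (confined R P)"
  unfolding confined_def
  by (intro definable_intros definable_small_set[OF P] definable2_app[OF definable2_reach[OF R]])

lemma confined_preimage: "confined R P w \<Longrightarrow> R v w \<Longrightarrow> confined R P v"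
  unfolding confined_def using reach_snoc[of R _ v w] by blast

lemma confined_mem: "confined R P u \<Longrightarrow> u \<in> P"
  unfolding confined_def using reach_refl[of R u] by blast

lemma absorbs_confined:
  assumes R: "right_unique R" "bounded_rel R" and small: "small P" "small Z" and disjoint: "P \<inter> Z = {}"
    and terminal: "\<And>z v. z \<in> Z \<Longrightarrow> \<not> R z v" and preimage: "\<And>w. w \<in> P \<Longrightarrow> \<exists>v. R v w"
    and confined: "\<And>z. z \<in> Z \<Longrightarrow> \<exists>u. confined R P u \<and> reach R u z"
  shows "absorbs P Z"
proof -
  let ?Q = "{u \<in> P. confined R P u}"
  have "absorbs ?Q Z"
  proof (rule absorbs_terminal[OF R _ small(2)])
    show "small ?Q"
      by (rule small_Collect[OF small(1) definable1_confined[OF bounded_relD[OF R(2)] small(1)]])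
    show "\<exists>u\<in>?Q. (R OO reach R) u w" if "w \<in> ?Q \<union> Z" for w
      using that
    proof
      assume w: "w \<in> ?Q"
      then obtain v where "R v w"
        using preimage by blast
      moreover from this have "confined R P v"
        using w by (blast intro: confined_preimage[of R P w v])
      ultimately show ?thesis
        using confined_mem reach_refl[of R w] by blast
    next
      assume w: "w \<in> Z"
      then obtain u where u: "confined R P u" "reach R u w"
        using confined by blast
      then have "u \<in> P"
        by (intro confined_mem)
      then show ?thesis
        using reach_cases[OF u(2) R(2)] u(1) w disjoint by blast
    qed
  qed (use terminal disjoint in auto)
  then show ?thesis
    by (rule absorbs_superset) (use small in auto)
qed

text \<open>
  A point of \<open>Z\<close> that has an ancestor whose whole past lies in \<open>P\<^sub>2\<close> is absorbed by \<open>P\<^sub>2\<close>;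
  every other point of \<open>Z\<close>, and every point on the way to it, has ancestors in \<open>P\<^sub>1\<close>.
\<close>

lemma absorbs_split_disjoint:
  assumes small: "small P1" "small P2" "small Z"
    and disjoint: "P1 \<inter> P2 = {}" "P1 \<inter> Z = {}" "P2 \<inter> Z = {}"
    and le: "P1 \<union> P2 \<union> Z \<preceq> P1 \<union> P2"
  obtains Z1 Z2 where "Z1 \<union> Z2 = Z" "Z1 \<inter> Z2 = {}" "absorbs P1 Z1" "absorbs P2 Z2"
proof -
  obtain R where R: "definable2 R" "onto R (P1 \<union> P2) (P1 \<union> P2 \<union> Z)"
    using le by (rule surj_leE)
  note onto = ontoD[OF R(2)]
  have bounded: "bounded_rel R"
    unfolding bounded_rel_def using R(1) onto(2) surj_le_small(1)[OF le] by blast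
  have terminal: "\<not> R z v" if "z \<in> Z" for z v
    using onto(1) disjoint that by blast
  define Z2 where "Z2 = {z \<in> Z. \<exists>u. confined R P2 u \<and> reach R u z}"
  have Z2: "small Z2"
    unfolding Z2_def
    by (intro small_Collect small definable_intros definable1_app[OF definable1_confined[OF R(1) small(2)]]
        definable2_app[OF definable2_reach[OF R(1)]])
  have "absorbs P2 Z2"
    by (rule absorbs_confined[OF onto(3) bounded small(2) Z2])
      (use disjoint terminal onto(4) in \<open>auto simp: Z2_def\<close>)
  moreover have "absorbs P1 (Z - Z2)"
  proof (rule absorbs_terminal[OF onto(3) bounded small(1)])
    show "\<exists>u\<in>P1. (R OO reach R) u w" if w: "w \<in> P1 \<union> (Z - Z2)" "z \<in> Z - Z2" "reach R w z" for w z
    proof -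
      obtain v where v: "R v w"
        using onto(4) w(1) by blast
      then have "\<not> confined R P2 v"
        using w(2,3) reach_step[of R v w z] unfolding Z2_def by blast
      then obtain u where u: "reach R u v" "u \<notin> P2"
        unfolding confined_def by blast
      then have "u \<in> P1"
        using reach_cases[OF u(1) bounded] onto(1) v by blast
      then show ?thesis
        using reach_relcompp[OF bounded u(1) v] by blast
    qed
  qed (use terminal disjoint small Z2 in auto)
  ultimately show thesis
    by (intro that[of "Z - Z2" Z2]) (auto simp: Z2_def)
qed

lemma absorbs_split:
  assumes small: "small A1" "small A2" and absorbs: "absorbs (A1 \<oplus> A2) Y"
  obtains Y1 Y2 where "Y1 \<union> Y2 = Y" "Y1 \<inter> Y2 = {}" "absorbs A1 Y1" "absorbs A2 Y2"
proof -
  note Y = absorbs_small(2)[OF absorbs]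
  let ?P1 = "A1 \<otimes> {\<zero>}" and ?P2 = "A2 \<otimes> {\<one>}" and ?Z = "Y \<otimes> {suc \<one>}"
  note tag = surj_card_times_singleton
  have disjoint: "?P1 \<inter> ?P2 = {}" "?P1 \<inter> ?Z = {}" "?P2 \<inter> ?Z = {}"
    by (auto elim!: in_timesE)
  have small_P: "small ?P1" "small ?P2" "small ?Z"
    using small Y by simp_all
  have card_P: "\<parallel>?P1 \<union> ?P2\<parallel> = \<parallel>A1 \<oplus> A2\<parallel>"
    using small small_P disjoint by (simp add: surj_card_Un_disjoint surj_card_plus tag)
  then have "\<parallel>?P1 \<union> ?P2 \<union> ?Z\<parallel> = \<parallel>(A1 \<oplus> A2) \<oplus> Y\<parallel>"
    using small Y small_P disjoint by (simp add: surj_card_Un_disjoint Int_Un_distrib2 surj_card_plus tag)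
  then have "?P1 \<union> ?P2 \<union> ?Z \<preceq> ?P1 \<union> ?P2"
    using absorbs[unfolded absorbs_def] small_P card_P by (auto intro: surj_le_cong[of "(A1 \<oplus> A2) \<oplus> Y" "A1 \<oplus> A2"])
  then obtain Z1 Z2 where Z: "Z1 \<union> Z2 = ?Z" "Z1 \<inter> Z2 = {}" "absorbs ?P1 Z1" "absorbs ?P2 Z2"
    by (rule absorbs_split_disjoint[OF small_P disjoint])
  define untag where "untag Z = {y \<in> Y. \<langle>y, suc \<one>\<rangle> \<in> Z}" for Z
  have "absorbs A (untag Z)" if "absorbs (A \<otimes> {i}) Z" "Z \<subseteq> ?Z" "small A" for A i Z
  proof -
    have "small (untag Z)"
      unfolding untag_def
      by (intro small_Collect Y definable_intros definable_small_set[OF absorbs_small(2)[OF that(1)]])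
    moreover have "untag Z \<otimes> {suc \<one>} = Z"
      using that(2) unfolding untag_def times_def by blast
    ultimately have "untag Z \<preceq> Z"
      using equipollent_imp_surj_eqv[OF times_singleton_equipollent] unfolding surj_eqv_def by metis
    then have "absorbs (A \<otimes> {i}) (untag Z)"
      by (rule absorbs_mono[OF that(1)])
    then show ?thesis
      by (rule absorbs_cong[OF tag[OF that(3)] _ that(3)])
  qed
  then have "absorbs A1 (untag Z1)" "absorbs A2 (untag Z2)"
    using Z small by blast+
  then show thesis
    by (rule that[rotated 2]) (use Z(1,2) in \<open>auto simp: untag_def\<close>)
qed

section \<open>Subsets matched by a pair of surjections\<close>

definition minimal :: "('a \<Rightarrow> 'a \<Rightarrow> bool) \<Rightarrow> 'a set \<Rightarrow> 'a set" where
  "minimal R X = {x \<in> X. \<not> (\<exists>u\<in>X. (R OO reach R) u x)}"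

lemma small_minimal:
  assumes R: "definable2 R" and X: "small X"
  shows "small (minimal R X)"
  unfolding minimal_def
  by (intro small_Collect X definable_intros definable_small_set
      definable2_app[OF R] definable2_app[OF definable2_reach[OF R]])

end

locale surjection_pair = zf +
  fixes f g :: "'a \<Rightarrow> 'a \<Rightarrow> bool" and A B :: "'a set"
  assumes small: "small A" "small B" and definable: "definable2 f" "definable2 g"
    and onto: "onto f A B" "onto g B A"
begin

abbreviation step :: "'a \<Rightarrow> 'a \<Rightarrow> bool" where
  "step \<equiv> f OO g"

lemma onto_step: "onto step A A"
  by (rule onto_relcompp[OF onto])

lemma definable2_step: "definable2 step"
  by (rule definable2_relcompp[OF definable])

lemma bounded_rel_step: "bounded_rel step"
  unfolding bounded_rel_def using small(1) ontoD(2)[OF onto_step] definable2_step by blast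

lemma absorbs_minimal:
  assumes X: "small X" "X \<subseteq> A"
  shows "absorbs A (minimal step X)"
proof -
  define U where "U = {u \<in> A. \<exists>x\<in>minimal step X. (step OO reach step) u x}"
  have U: "small U"
    unfolding U_def
    by (intro small_Collect small definable_intros definable_small_set[OF small_minimal[OF definable2_step X(1)]]
        definable2_app[OF definable2_step] definable2_app[OF definable2_reach[OF definable2_step]])
  have "absorbs U (minimal step X)"
  proof (rule absorbsI_rel[OF U small_minimal[OF definable2_step X(1)] _ definable2_step ontoD(3)[OF onto_step]])
    show "\<exists>u\<in>U. step u w" if w: "w \<in> U \<union> minimal step X" for w
    proof -
      obtain x where x: "x \<in> minimal step X" "reach step w x"
        using w reach_refl[of step] reach_step[of step] unfolding U_def by blast
      have "w \<in> A"
        using w X(2) unfolding U_def minimal_def by blast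
      then obtain u where "step u w"
        using ontoD(4)[OF onto_step] by blast
      then show ?thesis
        using x ontoD(1)[OF onto_step] unfolding U_def by blast
    qed
  qed (unfold U_def minimal_def, blast)
  then show ?thesis
    by (rule absorbs_superset) (use small in \<open>auto simp: U_def\<close>)
qed

lemma return_from_outside:
  assumes X: "small X" and V: "small V" "minimal step X \<subseteq> V" "\<And>u v. u \<in> V \<Longrightarrow> step u v \<Longrightarrow> v \<in> V"
    and w: "w \<in> X - V"
  obtains x t where "x \<in> X" "f x t" "(g OO first_visit step X) t w" "\<not> (\<exists>v\<in>V. f v t)"
proof -
  obtain u where "u \<in> X" "(step OO reach step) u w"
    using w V(2) unfolding minimal_def by blast
  then obtain x where x: "x \<in> X" "(step OO first_visit step X) x w"
    using first_return_exists[OF bounded_rel_step X] w by blast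
  then obtain t where t: "f x t" "(g OO first_visit step X) t w"
    by blast
  have False if v: "v \<in> V" "f v t" for v
  proof -
    have "(step OO first_visit step X) v w"
      using v(2) t(2) by blast
    then obtain v' where v': "v' \<in> V" "reach step v' w"
      using V(3)[OF v(1)] first_visit_imp_reach by blast
    have "w \<in> V"
      by (rule reach_closed[OF v'(2) V(1) v'(1)]) (rule V(3))
    then show False
      using w by blast
  qed
  then show thesis
    using that[OF x(1) t] by blast
qed

lemma remainders_surj_eqv:
  assumes X: "small X" and T: "small T" "T \<subseteq> B" and XT: "\<And>x y. f x y \<Longrightarrow> x \<in> X \<longleftrightarrow> y \<in> T"
    and V: "small V" "minimal step X \<subseteq> V" "\<And>u v. u \<in> V \<Longrightarrow> step u v \<Longrightarrow> v \<in> V"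
  shows "X - V \<approx> T - {t. \<exists>v\<in>X \<inter> V. f v t}"
proof -
  let ?Y = "{t. \<exists>v\<in>X \<inter> V. f v t}"
  have "small ?Y"
    by (rule surj_le_small(1)[OF image_surj_le[OF _ definable(1) ontoD(3)[OF onto(1)]]]) (use X V(1) in simp)
  then have TY: "small (T - ?Y)"
    using T(1) by simp
  have XV: "small (X - V)"
    using X V(1) by simp
  have "T - ?Y \<preceq> X - V"
  proof (rule surj_leI[OF XV TY definable(1)])
    show "\<exists>x\<in>X - V. f x t" if "t \<in> T - ?Y" for t
      using that ontoD(4)[OF onto(1), of t] XT T(2) by blast
  qed (use right_uniqueD[OF ontoD(3)[OF onto(1)]] in blast)
  moreover have "X - V \<preceq> T - ?Y"
  proof (rule surj_leI[OF TY XV])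
    let ?return = "g OO first_visit step X"
    show "definable2 ?return"
      by (intro definable2_relcompp definable definable2_first_visit bounded_rel_step X)
    have "right_unique ?return"
      by (intro right_unique_OO ontoD(3)[OF onto(2)] right_unique_first_visit bounded_rel_step X
          ontoD(3)[OF onto_step])
    then show "y = z" if "?return t y" "?return t z" for t y z
      using that by (rule right_uniqueD)
    show "\<exists>t\<in>T - ?Y. ?return t w" if w: "w \<in> X - V" for w
    proof -
      obtain x t where "x \<in> X" "f x t" "?return t w" "\<not> (\<exists>v\<in>V. f v t)"
        by (rule return_from_outside[OF X V w])
      then show ?thesis
        using XT by blast
    qed
  qed
  ultimately show ?thesis
    by (simp add: surj_eqv_def)
qed

end

context zf_ac
begin

lemma absorbs_forward_closure:
  assumes R: "bounded_rel R" "right_unique R" and S: "absorbs A S"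
  obtains W where "absorbs A W" "S \<subseteq> W" "\<And>x y. x \<in> W \<Longrightarrow> R x y \<Longrightarrow> y \<in> W"
proof -
  note small = absorbs_small[OF S]
  let ?F = "images R S"
  have F: "family ?F" and F_zero: "?F \<zero> = S"
    by (rule family_images[OF R(1) small(2)], rule images_zero[OF R(1) small(2)])
  have F_suc: "?F (suc n) = {y. \<exists>x\<in>?F n. R x y}" if "n \<in> \<omega>" for n
    by (rule images_suc[OF R(1) small(2) that])
  have "absorbs A (?F n)" if "n \<in> \<omega>" for n
    using that
  proof (induction rule: omega_induct)
    case definable
    show ?case
      by (intro definable_intros definable_small_set[OF small(1)] definable_family[OF F])
  next
    case zero
    show ?case
      using S by (simp add: F_zero)
  next
    case (suc n)
    have "?F (suc n) \<preceq> ?F n"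
      unfolding F_suc[OF suc(1)] by (rule image_surj_le[OF small_family[OF F] bounded_relD[OF R(1)] R(2)])
    then show ?case
      by (rule absorbs_mono[OF suc(2)])
  qed
  then have "absorbs A (\<Union>n\<in>\<omega>. ?F n)"
    by (rule absorbs_UN[OF small(1) F])
  moreover have "S \<subseteq> (\<Union>n\<in>\<omega>. ?F n)"
    using F_zero zero_in_omega by blast
  moreover have "y \<in> (\<Union>n\<in>\<omega>. ?F n)" if "x \<in> (\<Union>n\<in>\<omega>. ?F n)" "R x y" for x y
    using that F_suc suc_in_omega by blast
  ultimately show thesis
    by (rule that)
qed

lemma surj_eqv_modulo_absorbed:
  assumes fg: "surjection_pair mem f g A B" and X: "small X" "X \<subseteq> A" and T: "small T" "T \<subseteq> B"
    and XT: "\<And>x y. f x y \<Longrightarrow> x \<in> X \<longleftrightarrow> y \<in> T"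
  obtains V Y where "V \<subseteq> X" "absorbs A V" "Y \<subseteq> T" "absorbs A Y" "X - V \<approx> T - Y"
proof -
  interpret surjection_pair mem f g A B
    by (rule fg)
  obtain W where W: "absorbs A W" "minimal step X \<subseteq> W" "\<And>x y. x \<in> W \<Longrightarrow> step x y \<Longrightarrow> y \<in> W"
    using absorbs_forward_closure[OF bounded_rel_step ontoD(3)[OF onto_step] absorbs_minimal[OF X]]
    by blast
  note small_W = absorbs_small(2)[OF W(1)]
  let ?Y = "{t. \<exists>v\<in>X \<inter> W. f v t}"
  have XW: "absorbs A (X \<inter> W)"
    using X(1) small_W by (intro absorbs_subset[OF W(1)]) auto
  have "?Y \<subseteq> T"
    using XT by blast
  have "?Y \<preceq> X \<inter> W"
    by (rule image_surj_le[OF absorbs_small(2)[OF XW] definable(1) ontoD(3)[OF onto(1)]])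
  then have "absorbs A ?Y"
    by (rule absorbs_mono[OF XW])
  moreover have "X - W \<approx> T - ?Y"
    by (rule remainders_surj_eqv[OF X(1) T XT small_W W(2)]) (assumption, rule W(3))
  then have "X - X \<inter> W \<approx> T - ?Y"
    by (simp add: Diff_Int)
  ultimately show thesis
    using XW \<open>?Y \<subseteq> T\<close> by (intro that[of "X \<inter> W" ?Y]) auto
qed

end

context zf
begin

subsection \<open>Equality up to absorbed sets\<close>

definition eqv_modulo :: "'a set \<Rightarrow> 'a set \<Rightarrow> 'a set \<Rightarrow> bool" where
  "eqv_modulo A X Y \<longleftrightarrow> (\<exists>j. absorbs A (elts j) \<and> X \<oplus> elts j \<approx> Y \<oplus> elts j)"

lemma eqv_modulo_small: "eqv_modulo A X Y \<Longrightarrow> small X" "eqv_modulo A X Y \<Longrightarrow> small Y"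
  unfolding eqv_modulo_def surj_eqv_def using surj_le_small small_plus_iff by blast+

lemma eqv_moduloI:
  assumes "small X" "small Y" "absorbs A J" "\<parallel>X\<parallel> \<boxplus> \<parallel>J\<parallel> = \<parallel>Y\<parallel> \<boxplus> \<parallel>J\<parallel>"
  shows "eqv_modulo A X Y"
proof -
  have "X \<oplus> J \<approx> Y \<oplus> J"
    using assms absorbs_small(2)[OF assms(3)] by (simp add: surj_card_plus flip: surj_card_eq_iff)
  then show ?thesis
    unfolding eqv_modulo_def using assms(3) absorbs_small(2)[OF assms(3)] elts_set_of by metis
qed

lemma eqv_moduloE:
  assumes "eqv_modulo A X Y"
  obtains J where "absorbs A J" "\<parallel>X\<parallel> \<boxplus> \<parallel>J\<parallel> = \<parallel>Y\<parallel> \<boxplus> \<parallel>J\<parallel>"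
proof -
  obtain j where "absorbs A (elts j)" "X \<oplus> elts j \<approx> Y \<oplus> elts j"
    using assms unfolding eqv_modulo_def by blast
  then show thesis
    using that[of "elts j"] surj_card_eqI eqv_modulo_small[OF assms] by (simp flip: surj_card_plus)
qed

lemma eqv_modulo_trans:
  assumes "eqv_modulo A X Y" "eqv_modulo A Y Z"
  shows "eqv_modulo A X Z"
proof -
  obtain J K where J: "absorbs A J" "\<parallel>X\<parallel> \<boxplus> \<parallel>J\<parallel> = \<parallel>Y\<parallel> \<boxplus> \<parallel>J\<parallel>"
    and K: "absorbs A K" "\<parallel>Y\<parallel> \<boxplus> \<parallel>K\<parallel> = \<parallel>Z\<parallel> \<boxplus> \<parallel>K\<parallel>"
    using assms by (elim eqv_moduloE)
  have "\<parallel>X\<parallel> \<boxplus> (\<parallel>J\<parallel> \<boxplus> \<parallel>K\<parallel>) = (\<parallel>Y\<parallel> \<boxplus> \<parallel>J\<parallel>) \<boxplus> \<parallel>K\<parallel>"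
    by (simp add: surj_add_assoc flip: J(2))
  also have "\<dots> = (\<parallel>Y\<parallel> \<boxplus> \<parallel>K\<parallel>) \<boxplus> \<parallel>J\<parallel>"
    by (simp add: surj_add_ac)
  also have "\<dots> = \<parallel>Z\<parallel> \<boxplus> (\<parallel>J\<parallel> \<boxplus> \<parallel>K\<parallel>)"
    unfolding K(2) by (simp add: surj_add_ac)
  finally have "\<parallel>X\<parallel> \<boxplus> \<parallel>J \<oplus> K\<parallel> = \<parallel>Z\<parallel> \<boxplus> \<parallel>J \<oplus> K\<parallel>"
    using absorbs_small(2)[OF J(1)] absorbs_small(2)[OF K(1)] by (simp add: surj_card_plus)
  then show ?thesis
    using eqv_modulo_small[OF assms(1)] eqv_modulo_small[OF assms(2)] absorbs_plus[OF J(1) K(1)]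
    by (intro eqv_moduloI)
qed

lemma eqv_modulo_mono:
  assumes "eqv_modulo A X Y" "\<And>J. absorbs A J \<Longrightarrow> absorbs A' J"
  shows "eqv_modulo A' X Y"
  using assms(1) by (rule eqv_moduloE)
    (auto intro: eqv_moduloI assms(2) eqv_modulo_small[OF assms(1)])

lemma eqv_modulo_cong:
  assumes "eqv_modulo A X Y" "\<parallel>Y\<parallel> = \<parallel>Z\<parallel>" "small Z"
  shows "eqv_modulo A X Z"
  using assms(1) by (rule eqv_moduloE)
    (auto intro: eqv_moduloI eqv_modulo_small[OF assms(1)] assms(3) simp: assms(2))

lemma absorbs_eqv_modulo:
  assumes "absorbs A Y" "eqv_modulo A X Y"
  shows "absorbs A X"
proof -
  obtain J where J: "absorbs A J" "\<parallel>X\<parallel> \<boxplus> \<parallel>J\<parallel> = \<parallel>Y\<parallel> \<boxplus> \<parallel>J\<parallel>"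
    using assms(2) by (rule eqv_moduloE)
  note small = eqv_modulo_small[OF assms(2)] absorbs_small(2)[OF J(1)]
  have "X \<preceq> X \<oplus> J"
    using small by (intro surj_le_plus1)
  also have "X \<oplus> J \<preceq> Y \<oplus> J"
    using small J(2) surj_card_eq_iff[of "X \<oplus> J" "Y \<oplus> J"] by (simp add: surj_card_plus surj_eqv_def)
  finally show ?thesis
    by (rule absorbs_mono[OF absorbs_plus[OF assms(1) J(1)]])
qed

end

context zf_ac
begin

lemma matched_eqv_modulo:
  assumes "surjection_pair mem f g A B" "small X" "X \<subseteq> A" "small T" "T \<subseteq> B"
    and "\<And>x y. f x y \<Longrightarrow> x \<in> X \<longleftrightarrow> y \<in> T"
  shows "eqv_modulo A X T"
proof -
  obtain V Y where V: "V \<subseteq> X" "absorbs A V" and Y: "Y \<subseteq> T" "absorbs A Y" and XT: "X - V \<approx> T - Y"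
    by (rule surj_eqv_modulo_absorbed[OF assms])
  note small = absorbs_small[OF V(2)] absorbs_small(2)[OF Y(2)]
  let ?V = "\<Oplus>_. V" and ?Y = "\<Oplus>_. Y"
  have J: "absorbs A (?V \<oplus> ?Y)"
    using small V(2) Y(2) by (intro absorbs_plus absorbs_Oplus family_const)
  have multiple: "\<parallel>?V\<parallel> = \<parallel>V\<parallel> \<boxplus> \<parallel>?V\<parallel>" "\<parallel>?Y\<parallel> = \<parallel>Y\<parallel> \<boxplus> \<parallel>?Y\<parallel>"
    by (rule surj_card_Oplus_split_first[OF family_const[OF small(2)]],
        rule surj_card_Oplus_split_first[OF family_const[OF small(3)]])
  have "\<parallel>X\<parallel> \<boxplus> (\<parallel>?V\<parallel> \<boxplus> \<parallel>?Y\<parallel>) = \<parallel>X - V\<parallel> \<boxplus> ((\<parallel>V\<parallel> \<boxplus> \<parallel>?V\<parallel>) \<boxplus> \<parallel>?Y\<parallel>)"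
    using surj_card_Diff[OF assms(2) small(2) V(1)] by (simp add: surj_add_ac)
  also have "\<dots> = \<parallel>T - Y\<parallel> \<boxplus> (\<parallel>?V\<parallel> \<boxplus> (\<parallel>Y\<parallel> \<boxplus> \<parallel>?Y\<parallel>))"
    using surj_card_eqI[OF XT] by (simp flip: multiple)
  also have "\<dots> = \<parallel>T\<parallel> \<boxplus> (\<parallel>?V\<parallel> \<boxplus> \<parallel>?Y\<parallel>)"
    using surj_card_Diff[OF assms(4) small(3) Y(1)] by (simp add: surj_add_ac)
  finally show ?thesis
    using assms(2,4) small by (intro eqv_moduloI[OF _ _ J]) (simp_all add: surj_card_plus family_const)
qed

lemma eqv_modulo_Oplus:
  assumes A: "small A" and F: "family F" and G: "family G"
    and eqv: "\<And>n. n \<in> \<omega> \<Longrightarrow> eqv_modulo A (F n) (G n)"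
  shows "eqv_modulo A (\<Oplus>n. F n) (\<Oplus>n. G n)"
proof -
  have "definable2 (\<lambda>n j. absorbs A (elts j) \<and> F n \<oplus> elts j \<approx> G n \<oplus> elts j)"
    by (intro definable_intros definable_small_set[OF A] definable_family[OF F] definable_family[OF G])
  moreover have "\<exists>j. absorbs A (elts j) \<and> F n \<oplus> elts j \<approx> G n \<oplus> elts j" if "n \<in> \<omega>" for n
    using eqv[OF that] unfolding eqv_modulo_def .
  ultimately obtain j where j: "definable_fun j"
    "\<forall>n\<in>\<omega>. absorbs A (elts (j n)) \<and> F n \<oplus> elts (j n) \<approx> G n \<oplus> elts (j n)"
    by (rule countable_choice)
  note J = family_elts[OF j(1)]
  have "(\<Oplus>n. F n \<oplus> elts (j n)) \<approx> (\<Oplus>n. G n \<oplus> elts (j n))"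
    using j(2) by (intro Oplus_surj_eqv family_plus F G J) blast
  then have "\<parallel>\<Oplus>n. F n\<parallel> \<boxplus> \<parallel>\<Oplus>n. elts (j n)\<parallel> = \<parallel>\<Oplus>n. G n\<parallel> \<boxplus> \<parallel>\<Oplus>n. elts (j n)\<parallel>"
    using surj_card_eqI by (simp add: F G J flip: surj_card_Oplus_plus)
  moreover have "absorbs A (\<Oplus>n. elts (j n))"
    using j(2) by (intro absorbs_Oplus A J) blast
  ultimately show ?thesis
    by (intro eqv_moduloI) (simp_all add: F G)
qed

end

context zf
begin

section \<open>Finite refinement\<close>

lemma surjection_pair_exists:
  assumes "A \<approx> B"
  obtains f g where "surjection_pair mem f g A B"
proof -
  obtain f where f: "definable2 f" "onto f A B"
    using assms unfolding surj_eqv_def by (blast elim: surj_leE)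
  obtain g where g: "definable2 g" "onto g B A"
    using assms unfolding surj_eqv_def by (blast elim: surj_leE)
  have "surjection_pair mem f g A B"
    using assms f g surj_le_small unfolding surj_eqv_def by unfold_locales blast+
  then show thesis
    by (rule that)
qed

lemma absorbed_card_split:
  assumes A: "small A1" "small A2" "\<parallel>A\<parallel> = \<parallel>A1 \<oplus> A2\<parallel>" and absorbs: "absorbs A Y"
  obtains y1 y2 where "surjective_cardinal mem y1" "surjective_cardinal mem y2"
    "\<parallel>Y\<parallel> = y1 \<boxplus> y2" "\<parallel>A1\<parallel> \<boxplus> y1 = \<parallel>A1\<parallel>" "\<parallel>A2\<parallel> \<boxplus> y2 = \<parallel>A2\<parallel>"
proof -
  have "absorbs (A1 \<oplus> A2) Y"
    using A(1,2) by (intro absorbs_cong[OF A(3) absorbs]) simp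
  then obtain Y1 Y2 where Y: "Y1 \<union> Y2 = Y" "Y1 \<inter> Y2 = {}" "absorbs A1 Y1" "absorbs A2 Y2"
    by (rule absorbs_split[OF A(1,2)])
  have "\<parallel>Y1 \<union> Y2\<parallel> = \<parallel>Y1\<parallel> \<boxplus> \<parallel>Y2\<parallel>"
    by (rule surj_card_Un_disjoint) (use Y absorbs_small in auto)
  then show thesis
    using Y(1,3,4) by (intro that[of "\<parallel>Y1\<parallel>" "\<parallel>Y2\<parallel>"]) (simp_all add: absorbsD)
qed

lemma surj_add_reassemble:
  assumes "a = w \<boxplus> w' \<boxplus> (v \<boxplus> v')" "a \<boxplus> y = a" "a \<boxplus> y' = a"
    and "surjective_cardinal mem w" "surjective_cardinal mem w'" "surjective_cardinal mem v"
      "surjective_cardinal mem v'" "surjective_cardinal mem y" "surjective_cardinal mem y'"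
  shows "a = (w \<boxplus> v \<boxplus> y) \<boxplus> (w' \<boxplus> v' \<boxplus> y')"
proof -
  have "a = (a \<boxplus> y) \<boxplus> y'"
    using assms(2,3) by simp
  also have "\<dots> = (w \<boxplus> v \<boxplus> y) \<boxplus> (w' \<boxplus> v' \<boxplus> y')"
    unfolding assms(1) using assms(4-9) by (simp add: surj_add_ac)
  finally show ?thesis .
qed

end

context zf_ac
begin

lemma partition_modulo_absorbed:
  assumes AB: "A \<approx> T1 \<union> T2" and T: "small T1" "small T2" "T1 \<inter> T2 = {}"
  obtains W1 W2 V Y1 Y2 where "A = W1 \<union> W2 \<union> V" "W1 \<inter> W2 = {}" "(W1 \<union> W2) \<inter> V = {}"
    "small W1" "small W2" "absorbs A V" "absorbs A Y1" "absorbs A Y2"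
    "\<parallel>T1\<parallel> = \<parallel>W1\<parallel> \<boxplus> \<parallel>Y1\<parallel>" "\<parallel>T2\<parallel> = \<parallel>W2\<parallel> \<boxplus> \<parallel>Y2\<parallel>"
proof -
  obtain f g where fg: "surjection_pair mem f g A (T1 \<union> T2)"
    using AB by (rule surjection_pair_exists)
  then interpret surjection_pair mem f g A "T1 \<union> T2" .
  define X2 where "X2 = {x \<in> A. \<exists>y\<in>T2. f x y}"
  have X2: "small X2" "X2 \<subseteq> A"
    unfolding X2_def
    by (intro small_Collect small definable_intros definable_small_set T definable2_app[OF definable(1)]) blast
  then have X1: "small (A - X2)" "A - X2 \<subseteq> A"
    using small(1) by auto
  have f_X2: "x \<in> X2 \<longleftrightarrow> y \<in> T2" if "f x y" for x y
    using that ontoD(1)[OF onto(1)] right_uniqueD[OF ontoD(3)[OF onto(1)] that] unfolding X2_def by blast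
  have f_X1: "x \<in> A - X2 \<longleftrightarrow> y \<in> T1" if "f x y" for x y
    using f_X2[OF that] ontoD(1,2)[OF onto(1) that] T(3) by blast
  obtain V1 Y1 where V1: "V1 \<subseteq> A - X2" "absorbs A V1" "Y1 \<subseteq> T1" "absorbs A Y1" "A - X2 - V1 \<approx> T1 - Y1"
    by (rule surj_eqv_modulo_absorbed[OF fg X1 T(1) _ f_X1]) auto
  obtain V2 Y2 where V2: "V2 \<subseteq> X2" "absorbs A V2" "Y2 \<subseteq> T2" "absorbs A Y2" "X2 - V2 \<approx> T2 - Y2"
    by (rule surj_eqv_modulo_absorbed[OF fg X2 T(2) _ f_X2]) auto
  have card_T: "\<parallel>T\<parallel> = \<parallel>W\<parallel> \<boxplus> \<parallel>Y\<parallel>" if "W \<approx> T - Y" "Y \<subseteq> T" "small T" "absorbs A Y" for T W Y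
    using surj_card_Diff[OF that(3) absorbs_small(2)[OF that(4)] that(2)] surj_card_eqI[OF that(1)]
    by (simp add: surj_add_commute)
  show thesis
  proof (rule that)
    show "absorbs A (V1 \<union> V2)"
      by (rule absorbs_Un[OF V1(2) V2(2)])
    show "\<parallel>T1\<parallel> = \<parallel>A - X2 - V1\<parallel> \<boxplus> \<parallel>Y1\<parallel>" "\<parallel>T2\<parallel> = \<parallel>X2 - V2\<parallel> \<boxplus> \<parallel>Y2\<parallel>"
      by (rule card_T[OF V1(5,3) T(1) V1(4)], rule card_T[OF V2(5,3) T(2) V2(4)])
    show "small (A - X2 - V1)" "small (X2 - V2)"
      using X1 X2 V1(2) V2(2) by (simp_all add: absorbs_small)
  qed (use V1 V2 X2(2) in auto)
qed

lemma refinement_disjoint: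
  assumes AB: "P1 \<union> P2 \<approx> T1 \<union> T2" and small: "small P1" "small P2" "small T1" "small T2"
    and disjoint: "P1 \<inter> P2 = {}" "T1 \<inter> T2 = {}"
  obtains c1 c2 c3 c4 where "surjective_cardinal mem c1" "surjective_cardinal mem c2"
    "surjective_cardinal mem c3" "surjective_cardinal mem c4"
    "\<parallel>P1\<parallel> = c1 \<boxplus> c2" "\<parallel>P2\<parallel> = c3 \<boxplus> c4" "\<parallel>T1\<parallel> = c1 \<boxplus> c3" "\<parallel>T2\<parallel> = c2 \<boxplus> c4"
proof -
  obtain W1 W2 V Y1 Y2 where A: "P1 \<union> P2 = W1 \<union> W2 \<union> V" "W1 \<inter> W2 = {}" "(W1 \<union> W2) \<inter> V = {}"
    and W: "small W1" "small W2"
    and absorbed: "absorbs (P1 \<union> P2) V" "absorbs (P1 \<union> P2) Y1" "absorbs (P1 \<union> P2) Y2"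
    and T: "\<parallel>T1\<parallel> = \<parallel>W1\<parallel> \<boxplus> \<parallel>Y1\<parallel>" "\<parallel>T2\<parallel> = \<parallel>W2\<parallel> \<boxplus> \<parallel>Y2\<parallel>"
    using AB small(3,4) disjoint(2) by (rule partition_modulo_absorbed)
  have V: "small V"
    by (rule absorbs_small(2)[OF absorbed(1)])
  have card_A: "\<parallel>P1 \<union> P2\<parallel> = \<parallel>P1 \<oplus> P2\<parallel>" and card_B: "\<parallel>P1 \<union> P2\<parallel> = \<parallel>T1 \<oplus> T2\<parallel>"
    using surj_card_eqI[OF AB] small disjoint by (simp_all add: surj_card_Un_disjoint surj_card_plus)
  have V_absorbed: "absorbs (P1 \<union> P2) (P1 \<inter> V)" "absorbs (P1 \<union> P2) (P2 \<inter> V)"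
    using absorbed(1) small V by (auto intro: absorbs_subset)
  obtain v11 v12 where v1: "surjective_cardinal mem v11" "surjective_cardinal mem v12"
    "\<parallel>P1 \<inter> V\<parallel> = v11 \<boxplus> v12" "\<parallel>T1\<parallel> \<boxplus> v11 = \<parallel>T1\<parallel>" "\<parallel>T2\<parallel> \<boxplus> v12 = \<parallel>T2\<parallel>"
    by (rule absorbed_card_split[OF small(3,4) card_B V_absorbed(1)])
  obtain v21 v22 where v2: "surjective_cardinal mem v21" "surjective_cardinal mem v22"
    "\<parallel>P2 \<inter> V\<parallel> = v21 \<boxplus> v22" "\<parallel>T1\<parallel> \<boxplus> v21 = \<parallel>T1\<parallel>" "\<parallel>T2\<parallel> \<boxplus> v22 = \<parallel>T2\<parallel>"
    by (rule absorbed_card_split[OF small(3,4) card_B V_absorbed(2)])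
  obtain y11 y21 where y1: "surjective_cardinal mem y11" "surjective_cardinal mem y21"
    "\<parallel>Y1\<parallel> = y11 \<boxplus> y21" "\<parallel>P1\<parallel> \<boxplus> y11 = \<parallel>P1\<parallel>" "\<parallel>P2\<parallel> \<boxplus> y21 = \<parallel>P2\<parallel>"
    by (rule absorbed_card_split[OF small(1,2) card_A absorbed(2)])
  obtain y12 y22 where y2: "surjective_cardinal mem y12" "surjective_cardinal mem y22"
    "\<parallel>Y2\<parallel> = y12 \<boxplus> y22" "\<parallel>P1\<parallel> \<boxplus> y12 = \<parallel>P1\<parallel>" "\<parallel>P2\<parallel> \<boxplus> y22 = \<parallel>P2\<parallel>"
    by (rule absorbed_card_split[OF small(1,2) card_A absorbed(3)])
  have card_P: "\<parallel>P\<parallel> = \<parallel>P \<inter> W1\<parallel> \<boxplus> \<parallel>P \<inter> W2\<parallel> \<boxplus> \<parallel>P \<inter> V\<parallel>" if "small P" "P \<subseteq> P1 \<union> P2" for P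
    by (rule surj_card_partition3[OF that(1) W V]) (use that(2) A in auto)
  have card_W: "\<parallel>W\<parallel> = \<parallel>P1 \<inter> W\<parallel> \<boxplus> \<parallel>P2 \<inter> W\<parallel>" if "small W" "W \<subseteq> P1 \<union> P2" for W
    using surj_card_partition2[OF that(1) small(1,2) that(2) disjoint(1)] by (simp add: Int_commute)
  have W_subset: "W1 \<subseteq> P1 \<union> P2" "W2 \<subseteq> P1 \<union> P2"
    using A(1) by auto
  let ?c = "\<lambda>P W v y. \<parallel>P \<inter> W\<parallel> \<boxplus> v \<boxplus> y"
  have "\<parallel>P1\<parallel> = ?c P1 W1 v11 y11 \<boxplus> ?c P1 W2 v12 y12" "\<parallel>P2\<parallel> = ?c P2 W1 v21 y21 \<boxplus> ?c P2 W2 v22 y22"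
    using card_P[OF small(1)] card_P[OF small(2)] v1 v2 y1 y2 by (auto intro!: surj_add_reassemble)
  moreover have "\<parallel>T1\<parallel> = (\<parallel>P1 \<inter> W1\<parallel> \<boxplus> y11 \<boxplus> v11) \<boxplus> (\<parallel>P2 \<inter> W1\<parallel> \<boxplus> y21 \<boxplus> v21)"
    "\<parallel>T2\<parallel> = (\<parallel>P1 \<inter> W2\<parallel> \<boxplus> y12 \<boxplus> v12) \<boxplus> (\<parallel>P2 \<inter> W2\<parallel> \<boxplus> y22 \<boxplus> v22)"
    using T card_W[OF W(1)] card_W[OF W(2)] W_subset v1 v2 y1 y2 by (auto intro!: surj_add_reassemble)
  then have "\<parallel>T1\<parallel> = ?c P1 W1 v11 y11 \<boxplus> ?c P2 W1 v21 y21" "\<parallel>T2\<parallel> = ?c P1 W2 v12 y12 \<boxplus> ?c P2 W2 v22 y22"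
    using v1 v2 y1 y2 by (simp_all add: surj_add_ac)
  ultimately show thesis
    using v1 v2 y1 y2
    by (intro that[of "?c P1 W1 v11 y11" "?c P1 W2 v12 y12" "?c P2 W1 v21 y21" "?c P2 W2 v22 y22"]) simp_all
qed

lemma finite_refinement:
  assumes "surjective_cardinal mem a1" "surjective_cardinal mem a2" "surjective_cardinal mem b1"
    "surjective_cardinal mem b2" and sum_eq: "a1 \<boxplus> a2 = b1 \<boxplus> b2"
  obtains c1 c2 c3 c4 where "surjective_cardinal mem c1" "surjective_cardinal mem c2"
    "surjective_cardinal mem c3" "surjective_cardinal mem c4"
    "a1 = c1 \<boxplus> c2" "a2 = c3 \<boxplus> c4" "b1 = c1 \<boxplus> c3" "b2 = c2 \<boxplus> c4"
proof -
  obtain A1 A2 B1 B2 where sets: "small A1" "small A2" "small B1" "small B2"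
    "a1 = \<parallel>A1\<parallel>" "a2 = \<parallel>A2\<parallel>" "b1 = \<parallel>B1\<parallel>" "b2 = \<parallel>B2\<parallel>"
    using assms(1-4) by (elim surjective_cardinalE)
  let ?P1 = "A1 \<otimes> {\<zero>}" and ?P2 = "A2 \<otimes> {\<one>}" and ?T1 = "B1 \<otimes> {\<zero>}" and ?T2 = "B2 \<otimes> {\<one>}"
  have small: "small ?P1" "small ?P2" "small ?T1" "small ?T2"
    using sets by simp_all
  have disjoint: "?P1 \<inter> ?P2 = {}" "?T1 \<inter> ?T2 = {}"
    by (auto elim!: in_timesE)
  have "\<parallel>A1 \<oplus> A2\<parallel> = \<parallel>B1 \<oplus> B2\<parallel>"
    using sets sum_eq by (simp add: surj_card_plus)
  then have "?P1 \<union> ?P2 \<approx> ?T1 \<union> ?T2"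
    using sets(1-4) by (simp add: surj_card_eq_iff flip: plus_def)
  then show thesis
    by (rule refinement_disjoint[OF _ small disjoint])
      (use that sets in \<open>simp add: surj_card_times_singleton\<close>)
qed

end

context zf
begin

section \<open>The remainder postulate\<close>

definition tail :: "('a \<Rightarrow> 'a set) \<Rightarrow> 'a \<Rightarrow> 'a set" where
  "tail F m = (\<Oplus>n. F (m +\<^sub>\<omega> n))"

lemma family_shift: "family F \<Longrightarrow> family (\<lambda>n. F (m +\<^sub>\<omega> n))"
  by (rule family_comp) (assumption, intro definable_intros)

lemma small_tail [simp]: "family F \<Longrightarrow> small (tail F m)"
  by (simp add: tail_def family_shift)

lemma definable_tail [definable_intros]:
  "definable (\<lambda>s. t s \<in> (\<Oplus>n. F (u s +\<^sub>\<omega> n))) \<Longrightarrow> definable (\<lambda>s. t s \<in> tail F (u s))"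
  by (simp add: tail_def)

lemma tail_zero: "tail F \<zero> = (\<Oplus>n. F n)"
  unfolding tail_def by (rule Oplus_cong) simp

lemma surj_card_tail:
  assumes "family F"
  shows "\<parallel>tail F m\<parallel> = \<parallel>F m\<parallel> \<boxplus> \<parallel>tail F (suc m)\<parallel>"
proof -
  have "(\<Oplus>n. F (m +\<^sub>\<omega> suc n)) = tail F (suc m)"
    unfolding tail_def by (rule Oplus_cong) simp
  then show ?thesis
    using surj_card_Oplus_split_first[OF family_shift[OF assms], of m] by (simp add: tail_def)
qed

lemma telescope:
  assumes E: "family E" and T: "family T" and m: "m \<in> \<omega>"
    and step: "\<And>n. n \<in> \<omega> \<Longrightarrow> \<parallel>E (suc n)\<parallel> = \<parallel>E n\<parallel> \<boxplus> \<parallel>T n\<parallel>"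
  shows "\<parallel>E m \<oplus> tail T m\<parallel> = \<parallel>E \<zero> \<oplus> (\<Oplus>n. T n)\<parallel>"
  using m
proof (induction rule: omega_induct)
  case definable
  show ?case
    by (intro definable_intros definable_family[OF E] definable_family[OF T] definable_small_set
        small_family[OF E] small_Oplus T)
next
  case (suc n)
  have "\<parallel>E n \<oplus> tail T n\<parallel> = \<parallel>E (suc n) \<oplus> tail T (suc n)\<parallel>"
    using surj_card_tail[OF T, of n] step[OF suc(1)] small_family[OF E] T
    by (simp add: surj_card_plus surj_add_assoc)
  then show ?case
    using suc(2) by simp
qed (simp add: tail_zero)

lemma absorbed_summand_enlarge:
  assumes C: "small C" and A: "\<parallel>A\<parallel> = \<parallel>C \<oplus> K\<parallel>" and L: "absorbs A L" "K \<preceq> L"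
  shows "\<parallel>A\<parallel> = \<parallel>C \<oplus> L\<parallel>"
proof (rule surj_le_antisym)
  note small = C absorbs_small[OF L(1)] surj_le_small[OF L(2)]
  have "\<parallel>(C \<oplus> L) \<oplus> K\<parallel> = \<parallel>A\<parallel> \<boxplus> \<parallel>L\<parallel>"
    using small A by (simp add: surj_card_plus surj_add_ac)
  then have "(C \<oplus> L) \<oplus> K \<preceq> A"
    using small absorbsD[OF L(1)] by (intro surj_le_cong[OF surj_le_refl[OF small(2)]]) auto
  moreover have "C \<oplus> L \<preceq> (C \<oplus> L) \<oplus> K"
    using small by (intro surj_le_plus1) auto
  ultimately show "C \<oplus> L \<preceq> A"
    by (rule surj_le_trans[rotated])
  have "C \<oplus> K \<preceq> C \<oplus> L"
    using small L(2) by (intro plus_mono surj_le_refl)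
  then show "A \<preceq> C \<oplus> L"
    by (rule surj_le_cong) (use small A in auto)
qed

end

context zf_ac
begin

lemma absorbs_split_countable:
  assumes C: "small C" and L: "family L" and absorbs: "\<And>i. i \<in> \<omega> \<Longrightarrow> absorbs (C \<oplus> L i) K"
  obtains k where "k \<subseteq> K" "absorbs C (K - k)" "\<forall>i\<in>\<omega>. absorbs (L i) k"
proof -
  have K: "small K"
    using absorbs_small(2)[OF absorbs] zero_in_omega by blast
  let ?P = "\<lambda>i y. elts y \<subseteq> K \<and> absorbs C (K - elts y) \<and> absorbs (L i) (elts y)"
  have "definable2 ?P"
    by (intro definable_intros definable_small_set[OF C] definable_small_set[OF K] definable_family[OF L])
  moreover have "\<exists>y. ?P i y" if i: "i \<in> \<omega>" for i
  proof -
    obtain Y1 Y2 where Y: "Y1 \<union> Y2 = K" "Y1 \<inter> Y2 = {}" "absorbs C Y1" "absorbs (L i) Y2"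
      by (rule absorbs_split[OF C small_family[OF L] absorbs[OF i]])
    moreover have "K - Y2 = Y1"
      using Y(1,2) by blast
    ultimately have "?P i (set_of Y2)"
      using absorbs_small(2)[OF Y(4)] by auto
    then show ?thesis by blast
  qed
  ultimately obtain Q where Q: "definable_fun Q" "\<forall>i\<in>\<omega>. ?P i (Q i)"
    by (rule countable_choice)
  define k where "k = {x \<in> K. \<forall>i\<in>\<omega>. x \<in> elts (Q i)}"
  have k: "small k"
    unfolding k_def by (intro small_Collect K definable_intros definable_fun_app[OF Q(1)])
  have Q_family: "family (\<lambda>i. K - elts (Q i))"
    by (rule familyI) (use K in simp, intro definable_intros definable_small_set[OF K] definable_fun_app[OF Q(1)])
  have "absorbs C (\<Union>i\<in>\<omega>. K - elts (Q i))"
    using Q(2) by (intro absorbs_UN C Q_family) blast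
  then have "absorbs C (K - k)"
    by (rule absorbs_subset) (use K k in \<open>auto simp: k_def\<close>)
  moreover have "\<forall>i\<in>\<omega>. absorbs (L i) k"
  proof
    fix i
    assume "i \<in> \<omega>"
    then show "absorbs (L i) k"
      using Q(2) by (intro absorbs_subset[of "L i" "elts (Q i)" k] k) (auto simp: k_def)
  qed
  ultimately show thesis
    by (intro that[of k]) (auto simp: k_def)
qed

end

locale decreasing_sequence = zf_ac +
  fixes A B :: "'a \<Rightarrow> 'a set"
  assumes family_A: "family A" and family_B: "family B"
    and card_A: "n \<in> \<omega> \<Longrightarrow> \<parallel>A n\<parallel> = \<parallel>A (suc n)\<parallel> \<boxplus> \<parallel>B n\<parallel>"
begin

lemmas small_A = small_family[OF family_A]

lemma absorbs_suc: "n \<in> \<omega> \<Longrightarrow> absorbs (A (suc n)) Y \<Longrightarrow> absorbs (A n) Y"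
  using absorbs_plus_left[OF _ small_family[OF family_B], of "A (suc n)" Y n]
  by (rule absorbs_cong[rotated]) (simp_all add: surj_card_plus card_A small_A small_family[OF family_B])

lemma absorbs_shift:
  assumes "i \<in> \<omega>" "m \<in> \<omega>" "absorbs (A (m +\<^sub>\<omega> i)) Y"
  shows "absorbs (A m) Y"
proof -
  note small = absorbs_small(2)[OF assms(3)]
  have "absorbs (A (m +\<^sub>\<omega> i)) Y \<longrightarrow> absorbs (A m) Y"
    using assms(1)
  proof (induction rule: omega_induct)
    case definable
    show ?case
      by (intro definable_intros definable_small_set small small_A definable_family[OF family_A])
  next
    case (suc i)
    then show ?case
      using absorbs_suc[of "m +\<^sub>\<omega> i" Y] assms(2) by simp
  qed simp
  then show ?thesis
    using assms(3) by blast
qed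

lemma residue_shift:
  assumes C: "small C" and K: "family K" and residue: "\<forall>m\<in>\<omega>. \<parallel>A m\<parallel> = \<parallel>(C \<oplus> tail B m) \<oplus> K m\<parallel>"
    and i: "i \<in> \<omega>" and j: "j \<in> \<omega>"
  shows "\<parallel>A j\<parallel> = \<parallel>(C \<oplus> tail B j) \<oplus> K (j +\<^sub>\<omega> i)\<parallel>"
proof -
  have "\<forall>j\<in>\<omega>. \<parallel>A j\<parallel> = \<parallel>(C \<oplus> tail B j) \<oplus> K (j +\<^sub>\<omega> i)\<parallel>"
    using i
  proof (induction rule: omega_induct)
    case definable
    show ?case
      by (intro definable_intros definable_small_set[OF C] definable_family[OF family_A]
          definable_family[OF family_B] definable_family[OF K])
  next
    case zero
    show ?case
      using residue by simp
  next
    case (suc i)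
    show ?case
    proof
      fix j
      assume j: "j \<in> \<omega>"
      then have "\<parallel>A (suc j)\<parallel> = \<parallel>(C \<oplus> tail B (suc j)) \<oplus> K (j +\<^sub>\<omega> suc i)\<parallel>"
        using suc by simp
      then show "\<parallel>A j\<parallel> = \<parallel>(C \<oplus> tail B j) \<oplus> K (j +\<^sub>\<omega> suc i)\<parallel>"
        using card_A[OF j] surj_card_tail[OF family_B, of j] C small_family[OF K] family_B
        by (simp add: surj_card_plus surj_add_ac)
    qed
  qed
  then show ?thesis
    using j by blast
qed

lemma common_residue:
  assumes C: "small C" and K: "family K" and residue: "\<forall>m\<in>\<omega>. \<parallel>A m\<parallel> = \<parallel>(C \<oplus> tail B m) \<oplus> K m\<parallel>"
    and absorbed: "\<forall>m\<in>\<omega>. absorbs (A m) (K m)" and j: "j \<in> \<omega>"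
  shows "\<exists>k. (\<forall>n\<in>\<omega>. absorbs (A n) (elts k)) \<and> \<parallel>A j\<parallel> = \<parallel>(C \<oplus> tail B j) \<oplus> elts k\<parallel>"
proof -
  have C_tail: "small (C \<oplus> tail B j)"
    using C family_B by simp
  have "absorbs ((C \<oplus> tail B j) \<oplus> K (j +\<^sub>\<omega> i)) (K j)" if "i \<in> \<omega>" for i
    by (rule absorbs_cong[OF residue_shift[OF C K residue that j]])
      (use absorbed j C_tail small_family[OF K] in auto)
  then obtain k where k: "k \<subseteq> K j" "absorbs (C \<oplus> tail B j) (K j - k)" "\<forall>i\<in>\<omega>. absorbs (K (j +\<^sub>\<omega> i)) k"
    by (rule absorbs_split_countable[OF C_tail family_shift[OF K]])
  have small_k: "small k"
    using k(3) absorbs_small(2) zero_in_omega by blast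
  have "\<parallel>A j\<parallel> = (\<parallel>C \<oplus> tail B j\<parallel> \<boxplus> \<parallel>K j - k\<parallel>) \<boxplus> \<parallel>k\<parallel>"
    using residue j surj_card_Diff[OF small_family[OF K] small_k k(1)] C_tail small_family[OF K]
    by (simp add: surj_card_plus[OF C_tail] surj_add_ac)
  then have "\<parallel>A j\<parallel> = \<parallel>(C \<oplus> tail B j) \<oplus> k\<parallel>"
    using C_tail small_k by (simp add: absorbsD[OF k(2)] surj_card_plus[OF C_tail])
  moreover have "absorbs (A (j +\<^sub>\<omega> i)) k" if "i \<in> \<omega>" for i
  proof (rule absorbs_mono)
    show "absorbs (A (j +\<^sub>\<omega> i)) (K (j +\<^sub>\<omega> i))"
      using absorbed that j by simp
    show "k \<preceq> K (j +\<^sub>\<omega> i)"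
      using absorbs_surj_le k(3) that by blast
  qed
  then have "absorbs (A n) k" if "n \<in> \<omega>" for n
    using omega_le_cases[OF j that] absorbs_shift[OF _ that] zero_in_omega nat_add_zero by metis
  ultimately show ?thesis
    using small_k by (intro exI[of _ "set_of k"]) simp
qed

lemma remainder_from_residues:
  assumes C: "small C"
    and residue: "\<And>m. m \<in> \<omega> \<Longrightarrow> \<exists>K. absorbs (A m) K \<and> \<parallel>A m\<parallel> = \<parallel>(C \<oplus> tail B m) \<oplus> K\<parallel>"
  obtains R where "small R" "\<forall>m\<in>\<omega>. \<parallel>A m\<parallel> = \<parallel>R\<parallel> \<boxplus> \<parallel>tail B m\<parallel>"
proof -
  note definability = definable_intros definable_small_set[OF C] definable_family[OF family_A]
    definable_family[OF family_B]
  have "definable2 (\<lambda>m K. absorbs (A m) (elts K) \<and> \<parallel>A m\<parallel> = \<parallel>(C \<oplus> tail B m) \<oplus> elts K\<parallel>)"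
    by (intro definability)
  moreover have "\<exists>K. absorbs (A m) (elts K) \<and> \<parallel>A m\<parallel> = \<parallel>(C \<oplus> tail B m) \<oplus> elts K\<parallel>" if "m \<in> \<omega>" for m
    using residue[OF that] absorbs_small(2) elts_set_of by metis
  ultimately obtain K where K: "definable_fun K"
    "\<forall>m\<in>\<omega>. absorbs (A m) (elts (K m)) \<and> \<parallel>A m\<parallel> = \<parallel>(C \<oplus> tail B m) \<oplus> elts (K m)\<parallel>"
    by (rule countable_choice)
  have "definable2 (\<lambda>j k. (\<forall>n\<in>\<omega>. absorbs (A n) (elts k)) \<and> \<parallel>A j\<parallel> = \<parallel>(C \<oplus> tail B j) \<oplus> elts k\<parallel>)"
    by (intro definability)
  moreover have "\<exists>k. (\<forall>n\<in>\<omega>. absorbs (A n) (elts k)) \<and> \<parallel>A j\<parallel> = \<parallel>(C \<oplus> tail B j) \<oplus> elts k\<parallel>"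
    if "j \<in> \<omega>" for j
    using K(2) by (intro common_residue[OF C family_elts[OF K(1)] _ _ that]) auto
  ultimately obtain k where k: "definable_fun k"
    "\<forall>j\<in>\<omega>. (\<forall>n\<in>\<omega>. absorbs (A n) (elts (k j))) \<and> \<parallel>A j\<parallel> = \<parallel>(C \<oplus> tail B j) \<oplus> elts (k j)\<parallel>"
    by (rule countable_choice)
  note family_k = family_elts[OF k(1)]
  let ?k = "\<Oplus>j. elts (k j)"
  have small: "small ?k" "small (C \<oplus> tail B m)" for m
    using family_k C family_B by simp_all
  have "\<parallel>A m\<parallel> = \<parallel>(C \<oplus> tail B m) \<oplus> ?k\<parallel>" if m: "m \<in> \<omega>" for m
  proof (rule absorbed_summand_enlarge[OF small(2)])
    show "absorbs (A m) ?k"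
      using k(2) m by (intro absorbs_Oplus small_A family_k) blast
    show "elts (k m) \<preceq> ?k"
      by (rule surj_le_Oplus[OF family_k m])
  qed (use k(2) m in auto)
  then have "\<forall>m\<in>\<omega>. \<parallel>A m\<parallel> = \<parallel>C \<oplus> ?k\<parallel> \<boxplus> \<parallel>tail B m\<parallel>"
    using C small family_B by (simp add: surj_card_plus surj_add_ac)
  then show thesis
    using C small by (intro that[of "C \<oplus> ?k"]) simp_all
qed

end

locale remainder_sequence = zf_ac +
  fixes A B :: "'a \<Rightarrow> 'a set" and f g :: "'a \<Rightarrow> 'a \<Rightarrow> 'a \<Rightarrow> bool"
  assumes family_A: "family A" and family_B: "family B"
    and definable_f: "definable3 f" and definable_g: "definable3 g"
    and pair: "m \<in> \<omega> \<Longrightarrow> surjection_pair mem (f m) (g m) (A m) (A (suc m) \<oplus> B m)"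
begin

lemmas small_A = small_family[OF family_A]

abbreviation step :: "'a \<Rightarrow> 'a \<Rightarrow> 'a \<Rightarrow> bool" where
  "step m \<equiv> f m OO g m"

lemma onto_f: "m \<in> \<omega> \<Longrightarrow> onto (f m) (A m) (A (suc m) \<oplus> B m)"
  using surjection_pair.onto(1)[OF pair] .

lemma f_unique: "m \<in> \<omega> \<Longrightarrow> f m x p \<Longrightarrow> f m x q \<Longrightarrow> p = q"
  using right_uniqueD[OF ontoD(3)[OF onto_f]] .

lemma onto_step: "m \<in> \<omega> \<Longrightarrow> onto (step m) (A m) (A m)"
  using surjection_pair.onto_step[OF pair] .

sublocale decreasing_sequence mem A B
proof unfold_locales
  show "\<parallel>A m\<parallel> = \<parallel>A (suc m)\<parallel> \<boxplus> \<parallel>B m\<parallel>" if m: "m \<in> \<omega>" for m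
  proof -
    have "A m \<approx> A (suc m) \<oplus> B m"
      using surjection_pair.definable[OF pair[OF m]] surjection_pair.onto[OF pair[OF m]]
        surjection_pair.small[OF pair[OF m]] surj_le_onto unfolding surj_eqv_def by blast
    then have "\<parallel>A m\<parallel> = \<parallel>A (suc m) \<oplus> B m\<parallel>"
      by (rule surj_card_eqI)
    then show ?thesis
      by (simp add: surj_card_plus small_A small_family[OF family_B])
  qed
qed (rule family_A family_B)+

definition descend :: "'a \<Rightarrow> 'a \<Rightarrow> bool" where
  "descend p q \<longleftrightarrow> (\<exists>m\<in>\<omega>. \<exists>x y. p = \<langle>x, m\<rangle> \<and> q = \<langle>y, suc m\<rangle> \<and> f m x \<langle>y, \<zero>\<rangle>)"

definition exits :: "'a set" where
  "exits = {p \<in> (\<Oplus>m. A m). \<exists>m x b. p = \<langle>x, m\<rangle> \<and> f m x \<langle>b, \<one>\<rangle>}"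

text \<open>The points of \<open>A\<^sub>m\<close> that the maps \<open>f\<close> send into \<open>B\<^sub>m\<^sub>+\<^sub>k\<close>.\<close>

definition landing :: "'a \<Rightarrow> 'a \<Rightarrow> 'a set" where
  "landing k m = {x. \<langle>x, m\<rangle> \<in> images descend\<inverse>\<inverse> exits k}"

definition stray :: "'a \<Rightarrow> 'a set" where
  "stray m = A m - (\<Union>k\<in>\<omega>. landing k m)"

lemma descend_in_Oplus: "descend p q \<Longrightarrow> p \<in> (\<Oplus>m. A m)"
  using ontoD(1)[OF onto_f] by (auto simp: descend_def)

lemma definable_descend: "definable2 descend"
  unfolding descend_def by (intro definable_intros definable3_app[OF definable_f])

lemma small_exits: "small exits"
  unfolding exits_def
  by (intro small_Collect small_Oplus family_A definable_intros definable3_app[OF definable_f])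

lemma bounded_rel_ascend: "bounded_rel descend\<inverse>\<inverse>"
  unfolding bounded_rel_def
  using definable2_conversep[OF definable_descend] descend_in_Oplus small_Oplus[OF family_A] by auto

lemmas family_stages = family_images[OF bounded_rel_ascend small_exits]

lemma landing_zero_iff: "m \<in> \<omega> \<Longrightarrow> x \<in> landing \<zero> m \<longleftrightarrow> (\<exists>b. f m x \<langle>b, \<one>\<rangle>)"
  using ontoD(1)[OF onto_f] unfolding landing_def images_zero[OF bounded_rel_ascend small_exits]
  by (auto simp: exits_def)

lemma landing_suc_iff:
  "m \<in> \<omega> \<Longrightarrow> k \<in> \<omega> \<Longrightarrow> x \<in> landing (suc k) m \<longleftrightarrow> (\<exists>y\<in>landing k (suc m). f m x \<langle>y, \<zero>\<rangle>)"
  unfolding landing_def by (auto simp: images_suc[OF bounded_rel_ascend small_exits] descend_def)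

lemma definable_landing [definable_intros]:
  "definable_term t \<Longrightarrow> definable_term u \<Longrightarrow> definable_term v \<Longrightarrow> definable (\<lambda>s. t s \<in> landing (u s) (v s))"
  unfolding landing_def by (intro definable_intros definable_family[OF family_stages])

lemma landing_subset:
  assumes "k \<in> \<omega>" and m: "m \<in> \<omega>"
  shows "landing k m \<subseteq> A m"
proof
  fix x
  assume x: "x \<in> landing k m"
  have "\<exists>p. f m x p"
    using assms(1)
  proof (cases rule: omega_cases)
    case zero
    then show ?thesis
      using x landing_zero_iff[OF m] by blast
  next
    case (successor j)
    then show ?thesis
      using x landing_suc_iff[OF m] by blast
  qed
  then show "x \<in> A m"
    using ontoD(1)[OF onto_f[OF m]] by blast
qed

lemma small_landing: "small (landing k m)"
  unfolding landing_def by (rule small_fibre[OF small_family[OF family_stages]])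

lemma preimage_eqv_modulo:
  assumes m: "m \<in> \<omega>" and small: "small X" "small S" and sub: "X \<subseteq> A m" "S \<otimes> {i} \<subseteq> A (suc m) \<oplus> B m"
    and X: "\<And>x. x \<in> X \<longleftrightarrow> (\<exists>y\<in>S. f m x \<langle>y, i\<rangle>)"
  shows "eqv_modulo (A m) X S"
proof (rule eqv_modulo_cong)
  show "eqv_modulo (A m) X (S \<otimes> {i})"
  proof (rule matched_eqv_modulo[OF pair[OF m] small(1) sub(1) _ sub(2)])
    show "x \<in> X \<longleftrightarrow> p \<in> S \<otimes> {i}" if p: "f m x p" for x p
    proof
      assume "x \<in> X"
      then obtain y where "y \<in> S" "f m x \<langle>y, i\<rangle>"
        using X by blast
      then show "p \<in> S \<otimes> {i}"
        using f_unique[OF m p] by force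
    next
      assume "p \<in> S \<otimes> {i}"
      then show "x \<in> X"
        using X p by (elim in_timesE) blast
    qed
  qed (use small in simp)
qed (use small in \<open>simp_all add: surj_card_times_singleton\<close>)

lemma landing_zero_not_descend:
  assumes m: "m \<in> \<omega>" and x: "f m x \<langle>y, \<zero>\<rangle>"
  shows "x \<notin> landing \<zero> m"
proof
  assume "x \<in> landing \<zero> m"
  then obtain b where "f m x \<langle>b, \<one>\<rangle>"
    using landing_zero_iff[OF m] by blast
  from f_unique[OF m x this] show False by simp
qed

lemma landing_descend_iff:
  assumes m: "m \<in> \<omega>" and x: "f m x \<langle>y, \<zero>\<rangle>" and k: "k \<in> \<omega>"
  shows "x \<in> landing (suc k) m \<longleftrightarrow> y \<in> landing k (suc m)"
proof
  assume "x \<in> landing (suc k) m"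
  then obtain z where z: "z \<in> landing k (suc m)" "f m x \<langle>z, \<zero>\<rangle>"
    using landing_suc_iff[OF m k] by blast
  from f_unique[OF m x z(2)] z(1) show "y \<in> landing k (suc m)" by simp
qed (use x landing_suc_iff[OF m k] in blast)

lemma stray_matched:
  assumes m: "m \<in> \<omega>" and x: "f m x p"
  shows "x \<in> stray m \<longleftrightarrow> p \<in> stray (suc m) \<otimes> {\<zero>}"
proof -
  have x_A: "x \<in> A m" and "p \<in> A (suc m) \<oplus> B m"
    by (rule ontoD(1)[OF onto_f[OF m] x], rule ontoD(2)[OF onto_f[OF m] x])
  from this(2) show ?thesis
  proof (cases rule: in_plusE)
    case (left y)
    note x = x[unfolded left(2)]
    have not_zero: "x \<notin> landing \<zero> m"
      by (rule landing_zero_not_descend[OF m x])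
    have suc: "x \<in> landing (suc k) m \<longleftrightarrow> y \<in> landing k (suc m)" if "k \<in> \<omega>" for k
      by (rule landing_descend_iff[OF m x that])
    have "x \<in> (\<Union>k\<in>\<omega>. landing k m) \<longleftrightarrow> y \<in> (\<Union>k\<in>\<omega>. landing k (suc m))"
    proof
      assume "x \<in> (\<Union>k\<in>\<omega>. landing k m)"
      then obtain k where k: "k \<in> \<omega>" "x \<in> landing k m" by blast
      from k(1) show "y \<in> (\<Union>k\<in>\<omega>. landing k (suc m))"
        by (rule omega_cases) (use k(2) not_zero suc in auto)
    next
      assume "y \<in> (\<Union>k\<in>\<omega>. landing k (suc m))"
      then show "x \<in> (\<Union>k\<in>\<omega>. landing k m)"
        using suc suc_in_omega by blast
    qed
    then show ?thesis
      using x_A left by (simp add: stray_def)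
  next
    case (right b)
    then have "x \<in> landing \<zero> m"
      using landing_zero_iff[OF m] x by blast
    then show ?thesis
      using right unfolding stray_def by (auto elim!: in_timesE)
  qed
qed

lemma landing_unique:
  assumes "k \<in> \<omega>" "m \<in> \<omega>" "l \<in> \<omega>" "x \<in> landing k m" "x \<in> landing l m"
  shows "k = l"
proof -
  have zero_suc: False if "m \<in> \<omega>" "j \<in> \<omega>" "x \<in> landing \<zero> m" "x \<in> landing (suc j) m" for m j x
    using that landing_suc_iff[OF that(1,2)] landing_zero_not_descend[OF that(1)] by blast
  have "\<forall>m\<in>\<omega>. \<forall>l\<in>\<omega>. \<forall>x. x \<in> landing k m \<longrightarrow> x \<in> landing l m \<longrightarrow> k = l"
    using assms(1)
  proof (induction rule: omega_induct)
    case definable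
    show ?case by (intro definable_intros)
  next
    case zero
    have "\<zero> = l" if "m \<in> \<omega>" "l \<in> \<omega>" "x \<in> landing \<zero> m" "x \<in> landing l m" for m l x
      using that(2) by (rule omega_cases) (use that zero_suc in blast)+
    then show ?case by blast
  next
    case (suc k)
    have "suc k = l" if x: "m \<in> \<omega>" "l \<in> \<omega>" "x \<in> landing (suc k) m" "x \<in> landing l m" for m l x
      using x(2)
    proof (cases rule: omega_cases)
      case zero
      then show ?thesis
        using x zero_suc[OF x(1) suc(1)] by blast
    next
      case (successor j)
      obtain y where y: "y \<in> landing k (suc m)" "f m x \<langle>y, \<zero>\<rangle>"
        using x(3) landing_suc_iff[OF x(1) suc(1)] by blast
      then have "y \<in> landing j (suc m)"
        using x(4) successor landing_descend_iff[OF x(1) y(2)] by blast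
      then show ?thesis
        using suc(2) y(1) x(1) successor suc_in_omega by blast
    qed
    then show ?case by blast
  qed
  then show ?thesis
    using assms(2-5) by blast
qed

lemma landing_eqv_modulo:
  assumes k: "k \<in> \<omega>" and m: "m \<in> \<omega>"
  shows "eqv_modulo (A m) (landing k m) (B (m +\<^sub>\<omega> k))"
proof -
  have "\<forall>m\<in>\<omega>. eqv_modulo (A m) (landing k m) (B (m +\<^sub>\<omega> k))"
    using k
  proof (induction rule: omega_induct)
    case definable
    show ?case
      unfolding eqv_modulo_def
      by (intro definable_intros definable_family[OF family_A] definable_family[OF family_B])
  next
    case zero
    have "eqv_modulo (A m) (landing \<zero> m) (B m)" if m: "m \<in> \<omega>" for m
    proof (rule preimage_eqv_modulo[OF m small_landing small_family[OF family_B] landing_subset[OF zero_in_omega m]])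
      show "x \<in> landing \<zero> m \<longleftrightarrow> (\<exists>b\<in>B m. f m x \<langle>b, \<one>\<rangle>)" for x
        using landing_zero_iff[OF m] ontoD(2)[OF onto_f[OF m], of x] by fastforce
    qed (simp add: plus_def)
    then show ?case by simp
  next
    case (suc k)
    have "eqv_modulo (A m) (landing (suc k) m) (B (m +\<^sub>\<omega> suc k))" if m: "m \<in> \<omega>" for m
    proof (rule eqv_modulo_trans)
      show "eqv_modulo (A m) (landing (suc k) m) (landing k (suc m))"
      proof (rule preimage_eqv_modulo[OF m small_landing small_landing])
        show "landing (suc k) m \<subseteq> A m"
          by (intro landing_subset suc_in_omega suc(1) m)
        show "landing k (suc m) \<otimes> {\<zero>} \<subseteq> A (suc m) \<oplus> B m"
          using landing_subset[of k "suc m"] suc(1) m by (auto elim!: in_timesE)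
      qed (rule landing_suc_iff[OF m suc(1)])
      have "eqv_modulo (A (suc m)) (landing k (suc m)) (B (suc m +\<^sub>\<omega> k))"
        using suc(2) m suc_in_omega by blast
      then show "eqv_modulo (A m) (landing k (suc m)) (B (m +\<^sub>\<omega> suc k))"
        using suc(1) by (intro eqv_modulo_mono[OF _ absorbs_suc[OF m]]) simp
    qed
    then show ?case by blast
  qed
  then show ?thesis
    using m by blast
qed

lemma card_A_stray:
  assumes m: "m \<in> \<omega>"
  obtains K where "absorbs (A m) K" "\<parallel>A m\<parallel> = \<parallel>stray m\<parallel> \<boxplus> \<parallel>tail B m\<parallel> \<boxplus> \<parallel>K\<parallel>"
proof -
  have family_landing: "family (\<lambda>k. landing k m)"
    by (rule familyI) (rule small_landing, intro definable_intros)
  have "eqv_modulo (A m) (\<Oplus>k. landing k m) (tail B m)"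
    unfolding tail_def
    by (intro eqv_modulo_Oplus small_A family_landing family_shift family_B landing_eqv_modulo m)
  then obtain K where K: "absorbs (A m) K" "\<parallel>\<Oplus>k. landing k m\<parallel> \<boxplus> \<parallel>K\<parallel> = \<parallel>tail B m\<parallel> \<boxplus> \<parallel>K\<parallel>"
    by (rule eqv_moduloE)
  have "(\<Union>k\<in>\<omega>. landing k m) \<simeq> (\<Oplus>k. landing k m)"
    using landing_unique m by (intro disjoint_UN_equipollent_Oplus family_landing) blast
  then have "\<parallel>\<Union>k\<in>\<omega>. landing k m\<parallel> = \<parallel>\<Oplus>k. landing k m\<parallel>"
    by (rule equipollent_imp_surj_card_eq)
  moreover have "\<parallel>A m\<parallel> = \<parallel>\<Union>k\<in>\<omega>. landing k m\<parallel> \<boxplus> \<parallel>stray m\<parallel>"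
    unfolding stray_def using landing_subset m
    by (intro surj_card_Diff small_A small_UN_family family_landing) blast
  ultimately have "\<parallel>A m\<parallel> = \<parallel>\<Oplus>k. landing k m\<parallel> \<boxplus> \<parallel>stray m\<parallel>"
    by simp
  then have "\<parallel>A m\<parallel> = (\<parallel>\<Oplus>k. landing k m\<parallel> \<boxplus> \<parallel>K\<parallel>) \<boxplus> \<parallel>stray m\<parallel>"
    using absorbsD[OF K(1)] by (simp add: surj_add_ac)
  then have "\<parallel>A m\<parallel> = \<parallel>stray m\<parallel> \<boxplus> \<parallel>tail B m\<parallel> \<boxplus> \<parallel>K\<parallel>"
    unfolding K(2) by (simp add: surj_add_ac)
  with K(1) show thesis
    by (rule that)
qed

text \<open>
  The removed parts contain the minimal strays and are closed under the orbits in \<open>A\<^sub>m\<close>, as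
  required by \<open>remainders_surj_eqv\<close>. Closing them under preimages along \<open>f\<^sub>m\<close> as well
  makes the sets \<open>residue m\<close> of remaining strays increase with \<open>m\<close>.
\<close>

definition link :: "'a \<Rightarrow> 'a \<Rightarrow> bool" where
  "link p q \<longleftrightarrow> (\<exists>m\<in>\<omega>. \<exists>x y. p = \<langle>x, m\<rangle> \<and> q = \<langle>y, m\<rangle> \<and> step m x y) \<or> descend q p"

definition minimal_strays :: "'a set" where
  "minimal_strays = (\<Oplus>m. minimal (step m) (stray m))"

definition removed_stage :: "'a \<Rightarrow> 'a \<Rightarrow> 'a set" where
  "removed_stage k m = {x. \<langle>x, m\<rangle> \<in> images link minimal_strays k}"

definition removed :: "'a \<Rightarrow> 'a set" where
  "removed m = (\<Union>k\<in>\<omega>. removed_stage k m)"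

definition residue :: "'a \<Rightarrow> 'a set" where
  "residue m = stray m - removed m"

definition residue_gain :: "'a \<Rightarrow> 'a set" where
  "residue_gain m = {y \<in> residue (suc m). \<exists>x\<in>stray m \<inter> removed m. f m x \<langle>y, \<zero>\<rangle>}"

lemma family_stray: "family stray"
proof (rule family_subset[OF family_A])
  show "definable2 (\<lambda>m x. x \<in> stray m)"
    unfolding stray_def by (intro definable_intros definable_family[OF family_A])
qed (auto simp: stray_def)

lemma bounded_rel_link: "bounded_rel link"
  unfolding bounded_rel_def
proof (intro conjI exI allI impI)
  show "definable2 link"
    unfolding link_def
    by (intro definable_intros definable3_app[OF definable_f] definable3_app[OF definable_g] definable2_app[OF definable_descend])
  show "q \<in> (\<Oplus>m. A m)" if "link p q" for p q
    using that unfolding link_def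
  proof
    assume "\<exists>m\<in>\<omega>. \<exists>x y. p = \<langle>x, m\<rangle> \<and> q = \<langle>y, m\<rangle> \<and> step m x y"
    then obtain m x y where m: "m \<in> \<omega>" "q = \<langle>y, m\<rangle>" "step m x y" by blast
    then show ?thesis
      using ontoD(2)[OF onto_step[OF m(1)] m(3)] by simp
  qed (rule descend_in_Oplus)
qed (rule small_Oplus[OF family_A])

lemma small_minimal_strays: "small minimal_strays"
proof -
  have reach: "definable3 (\<lambda>m. reach (step m))"
    unfolding reach_def by (intro definable_intros definable3_app[OF definable_f] definable3_app[OF definable_g])
  have "family (\<lambda>m. minimal (step m) (stray m))"
  proof (rule family_subset[OF family_stray])
    show "definable2 (\<lambda>m x. x \<in> minimal (step m) (stray m))"
      unfolding minimal_def
      by (intro definable_intros definable_family[OF family_stray] definable3_app[OF definable_f] definable3_app[OF definable_g]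
          definable3_app[OF reach])
  qed (auto simp: minimal_def)
  then show ?thesis
    unfolding minimal_strays_def by (rule small_Oplus)
qed

lemmas family_link_images = family_images[OF bounded_rel_link small_minimal_strays]

lemma definable_removed_stage [definable_intros]:
  "definable_term t \<Longrightarrow> definable_term u \<Longrightarrow> definable_term v \<Longrightarrow>
    definable (\<lambda>s. t s \<in> removed_stage (u s) (v s))"
  unfolding removed_stage_def by (intro definable_intros definable_family[OF family_link_images])

lemma family_removed_stage: "family (\<lambda>k. removed_stage k m)"
proof (rule familyI)
  show "small (removed_stage k m)" for k
    unfolding removed_stage_def by (rule small_fibre[OF small_family[OF family_link_images]])
qed (intro definable_intros)

lemma removed_stage_zero: "m \<in> \<omega> \<Longrightarrow> removed_stage \<zero> m = minimal (step m) (stray m)"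
  unfolding removed_stage_def images_zero[OF bounded_rel_link small_minimal_strays]
  by (simp add: minimal_strays_def)

lemma removed_stage_suc:
  assumes "k \<in> \<omega>" "m \<in> \<omega>"
  shows "removed_stage (suc k) m =
    {x. \<exists>v\<in>removed_stage k m. step m v x} \<union> {x. \<exists>y\<in>removed_stage k (suc m). f m x \<langle>y, \<zero>\<rangle>}"
  unfolding removed_stage_def images_suc[OF bounded_rel_link small_minimal_strays assms(1)] link_def descend_def
  using assms(2) by auto

lemma removed_stage_subset:
  assumes "k \<in> \<omega>" and m: "m \<in> \<omega>"
  shows "removed_stage k m \<subseteq> A m"
  using assms(1)
proof (cases rule: omega_cases)
  case zero
  then show ?thesis
    using removed_stage_zero[OF m] unfolding minimal_def stray_def by blast
next
  case (successor j)
  then show ?thesis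
    using removed_stage_suc[OF successor(1) m] ontoD(2)[OF onto_step[OF m]] ontoD(1)[OF onto_f[OF m]] by blast
qed

lemma absorbs_removed_stage_suc:
  assumes k: "k \<in> \<omega>" and m: "m \<in> \<omega>" and absorbs: "absorbs (A m) (removed_stage k m)"
    "absorbs (A (suc m)) (removed_stage k (suc m))"
  shows "absorbs (A m) (removed_stage (suc k) m)"
proof -
  note small = small_family[OF family_removed_stage]
  let ?forward = "{x. \<exists>v\<in>removed_stage k m. step m v x}"
  let ?back = "{x. \<exists>y\<in>removed_stage k (suc m). f m x \<langle>y, \<zero>\<rangle>}"
  have "?forward \<preceq> removed_stage k m"
    by (rule image_surj_le[OF small surjection_pair.definable2_step[OF pair[OF m]] ontoD(3)[OF onto_step[OF m]]])
  then have "absorbs (A m) ?forward"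
    by (rule absorbs_mono[OF absorbs(1)])
  moreover have "absorbs (A m) ?back"
  proof (rule absorbs_eqv_modulo[OF absorbs_suc[OF m absorbs(2)]])
    have "?back \<subseteq> removed_stage (suc k) m"
      unfolding removed_stage_suc[OF k m] by blast
    then have "small ?back"
      by (rule small_subset[OF small]) (intro definable_intros definable3_app[OF definable_f])
    then show "eqv_modulo (A m) ?back (removed_stage k (suc m))"
    proof (rule preimage_eqv_modulo[OF m _ small])
      show "?back \<subseteq> A m"
        using ontoD(1)[OF onto_f[OF m]] by blast
      show "removed_stage k (suc m) \<otimes> {\<zero>} \<subseteq> A (suc m) \<oplus> B m"
        using removed_stage_subset[OF k, of "suc m"] m by (auto elim!: in_timesE)
    qed simp
  qed
  ultimately show ?thesis
    unfolding removed_stage_suc[OF k m] by (rule absorbs_Un)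
qed

lemma absorbs_removed_stage:
  assumes "k \<in> \<omega>" "m \<in> \<omega>"
  shows "absorbs (A m) (removed_stage k m)"
proof -
  have "\<forall>m\<in>\<omega>. absorbs (A m) (removed_stage k m)"
    using assms(1)
  proof (induction rule: omega_induct)
    case definable
    show ?case by (intro definable_intros definable_family[OF family_A])
  next
    case zero
    show ?case
    proof
      fix m
      assume m: "m \<in> \<omega>"
      have "stray m \<subseteq> A m"
        unfolding stray_def by blast
      then show "absorbs (A m) (removed_stage \<zero> m)"
        unfolding removed_stage_zero[OF m]
        by (rule surjection_pair.absorbs_minimal[OF pair[OF m] small_family[OF family_stray]])
    qed
  next
    case (suc k)
    then show ?case
      using absorbs_removed_stage_suc suc_in_omega by blast
  qed
  then show ?thesis
    using assms(2) by blast
qed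

lemma absorbs_removed: "m \<in> \<omega> \<Longrightarrow> absorbs (A m) (removed m)"
  unfolding removed_def by (intro absorbs_UN small_A family_removed_stage absorbs_removed_stage)

lemma removedI: "k \<in> \<omega> \<Longrightarrow> x \<in> removed_stage k m \<Longrightarrow> x \<in> removed m"
  unfolding removed_def by blast

lemma removedE:
  assumes "x \<in> removed m"
  obtains k where "k \<in> \<omega>" "x \<in> removed_stage k m"
  using assms unfolding removed_def by blast

lemma minimal_subset_removed: "m \<in> \<omega> \<Longrightarrow> minimal (step m) (stray m) \<subseteq> removed m"
  using removedI[OF zero_in_omega] by (auto simp: removed_stage_zero)

lemma removed_step:
  assumes m: "m \<in> \<omega>" and u: "u \<in> removed m" and "step m u v"
  shows "v \<in> removed m"
proof -
  obtain k where k: "k \<in> \<omega>" "u \<in> removed_stage k m"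
    using u by (rule removedE)
  then have "v \<in> removed_stage (suc k) m"
    unfolding removed_stage_suc[OF k(1) m] using assms(3) by blast
  then show ?thesis
    by (rule removedI[OF suc_in_omega[OF k(1)]])
qed

lemma removed_preimage:
  assumes m: "m \<in> \<omega>" and y: "y \<in> removed (suc m)" and "f m x \<langle>y, \<zero>\<rangle>"
  shows "x \<in> removed m"
proof -
  obtain k where k: "k \<in> \<omega>" "y \<in> removed_stage k (suc m)"
    using y by (rule removedE)
  then have "x \<in> removed_stage (suc k) m"
    unfolding removed_stage_suc[OF k(1) m] using assms(3) by blast
  then show ?thesis
    by (rule removedI[OF suc_in_omega[OF k(1)]])
qed

lemma small_removed: "small (removed m)"
  unfolding removed_def by (rule small_UN_family[OF family_removed_stage])

lemma family_residue: "family residue"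
proof (rule family_subset[OF family_stray])
  show "definable2 (\<lambda>m x. x \<in> residue m)"
    unfolding residue_def removed_def by (intro definable_intros definable_family[OF family_stray])
qed (auto simp: residue_def)

lemma family_residue_gain: "family residue_gain"
proof (rule family_subset)
  show "family (\<lambda>m. residue (suc m))"
    by (rule family_comp[OF family_residue]) (intro definable_intros)
  show "definable2 (\<lambda>m x. x \<in> residue_gain m)"
    unfolding residue_gain_def removed_def
    by (intro definable_intros definable_family[OF family_residue] definable_family[OF family_stray]
        definable3_app[OF definable_f])
qed (auto simp: residue_gain_def)

lemma absorbs_residue_gain:
  assumes m: "m \<in> \<omega>"
  shows "absorbs (A m) (residue_gain m)"
proof -
  let ?R = "\<lambda>x y. f m x \<langle>y, \<zero>\<rangle>"
  have "definable2 ?R"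
    by (intro definable_intros definable3_app[OF definable_f])
  moreover have "right_unique ?R"
    using f_unique[OF m] pair_inject unfolding right_unique_def by blast
  ultimately have image: "{y. \<exists>x\<in>removed m. ?R x y} \<preceq> removed m"
    by (rule image_surj_le[OF small_removed])
  have "absorbs (A m) {y. \<exists>x\<in>removed m. ?R x y}"
    by (rule absorbs_mono[OF absorbs_removed[OF m] image])
  then show ?thesis
    by (rule absorbs_subset[OF _ small_family[OF family_residue_gain]]) (auto simp: residue_gain_def)
qed

lemma card_residue:
  assumes m: "m \<in> \<omega>"
  shows "\<parallel>residue (suc m)\<parallel> = \<parallel>residue m\<parallel> \<boxplus> \<parallel>residue_gain m\<parallel>"
proof -
  let ?gone = "{t. \<exists>x\<in>stray m \<inter> removed m. f m x t}"
  have "stray m - removed m \<approx> stray (suc m) \<otimes> {\<zero>} - ?gone"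
  proof (rule surjection_pair.remainders_surj_eqv[OF pair[OF m] small_family[OF family_stray]])
    show "small (stray (suc m) \<otimes> {\<zero>})"
      by (simp add: small_family[OF family_stray])
    show "stray (suc m) \<otimes> {\<zero>} \<subseteq> A (suc m) \<oplus> B m"
      by (auto simp: stray_def elim!: in_timesE)
  qed (rule stray_matched[OF m] small_removed minimal_subset_removed[OF m] removed_step[OF m]; assumption)+
  moreover have "stray (suc m) \<otimes> {\<zero>} - ?gone = (residue (suc m) - residue_gain m) \<otimes> {\<zero>}"
  proof -
    have "\<exists>x\<in>stray m \<inter> removed m. f m x \<langle>y, \<zero>\<rangle>" if y: "y \<in> stray (suc m)" "y \<in> removed (suc m)" for y
    proof -
      have "\<langle>y, \<zero>\<rangle> \<in> A (suc m) \<oplus> B m"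
        using y(1) by (simp add: stray_def)
      then obtain x where x: "f m x \<langle>y, \<zero>\<rangle>"
        using ontoD(4)[OF onto_f[OF m]] by blast
      then have "x \<in> stray m \<inter> removed m"
        using removed_preimage[OF m y(2)] stray_matched[OF m] y(1) by auto
      then show ?thesis
        using x by blast
    qed
    then show ?thesis
      unfolding residue_gain_def residue_def by (auto elim!: in_timesE)
  qed
  ultimately have "\<parallel>residue m\<parallel> = \<parallel>residue (suc m) - residue_gain m\<parallel>"
    using surj_card_eqI small_family[OF family_residue] small_family[OF family_residue_gain]
    by (fastforce simp: surj_card_times_singleton simp flip: residue_def)
  moreover have "\<parallel>residue (suc m)\<parallel> = \<parallel>residue_gain m\<parallel> \<boxplus> \<parallel>residue (suc m) - residue_gain m\<parallel>"
    by (intro surj_card_Diff small_family[OF family_residue] small_family[OF family_residue_gain])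
      (auto simp: residue_gain_def)
  ultimately show ?thesis
    by (simp add: surj_add_commute)
qed

lemma card_A_residue:
  assumes m: "m \<in> \<omega>"
  shows "\<exists>K. absorbs (A m) K \<and> \<parallel>A m\<parallel> = \<parallel>((residue \<zero> \<oplus> (\<Oplus>n. residue_gain n)) \<oplus> tail B m) \<oplus> K\<parallel>"
proof -
  obtain J where J: "absorbs (A m) J" "\<parallel>A m\<parallel> = \<parallel>stray m\<parallel> \<boxplus> \<parallel>tail B m\<parallel> \<boxplus> \<parallel>J\<parallel>"
    using m by (rule card_A_stray)
  let ?C = "residue \<zero> \<oplus> (\<Oplus>n. residue_gain n)" and ?V = "stray m \<inter> removed m"
  note small_families = small_family[OF family_stray] small_family[OF family_residue] small_removed
    absorbs_small(2)[OF J(1)] family_residue_gain family_B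
  have V: "absorbs (A m) ?V"
    using small_families by (intro absorbs_subset[OF absorbs_removed[OF m]]) auto
  have "absorbs (A m) (residue_gain (m +\<^sub>\<omega> n))" if "n \<in> \<omega>" for n
    using m that by (intro absorbs_shift[OF that m] absorbs_residue_gain) simp
  then have gain: "absorbs (A m) (tail residue_gain m)"
    unfolding tail_def by (intro absorbs_Oplus small_A family_shift family_residue_gain)
  have "\<parallel>stray m\<parallel> = \<parallel>?V\<parallel> \<boxplus> \<parallel>residue m\<parallel>"
    using surj_card_Diff[of "stray m" ?V] small_families by (simp add: Diff_Int residue_def)
  moreover have "\<parallel>?C\<parallel> = \<parallel>residue m\<parallel> \<boxplus> \<parallel>tail residue_gain m\<parallel>"
    using telescope[OF family_residue family_residue_gain m card_residue] small_families
    by (simp add: surj_card_plus)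
  moreover have "\<parallel>A m\<parallel> = \<parallel>A m\<parallel> \<boxplus> \<parallel>tail residue_gain m\<parallel>"
    by (rule absorbsD[OF gain, symmetric])
  ultimately have "\<parallel>A m\<parallel> = \<parallel>(?C \<oplus> tail B m) \<oplus> (?V \<oplus> J)\<parallel>"
    using small_families unfolding J(2) by (simp add: surj_card_plus surj_add_ac)
  then show ?thesis
    using absorbs_plus[OF V J(1)] by blast
qed

end

context zf_ac
begin

lemma remainder:
  assumes A: "family A" and B: "family B" and eq: "\<And>n. n \<in> \<omega> \<Longrightarrow> \<parallel>A n\<parallel> = \<parallel>A (suc n)\<parallel> \<boxplus> \<parallel>B n\<parallel>"
  obtains R where "small R" "\<forall>m\<in>\<omega>. \<parallel>A m\<parallel> = \<parallel>R\<parallel> \<boxplus> \<parallel>tail B m\<parallel>"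
proof -
  have A_suc: "family (\<lambda>n. A (suc n))"
    by (rule family_comp[OF A]) (intro definable_intros)
  note AB = family_plus[OF A_suc B]
  have eqv: "A n \<approx> A (suc n) \<oplus> B n" if "n \<in> \<omega>" for n
    using eq[OF that] small_family[OF A] small_family[OF B]
    by (simp add: surj_card_plus flip: surj_card_eq_iff)
  obtain f where f: "definable3 f" "\<forall>n\<in>\<omega>. onto (f n) (A n) (A (suc n) \<oplus> B n)"
    by (rule choose_onto[OF AB A]) (use eqv in \<open>simp add: surj_eqv_def\<close>)
  obtain g where g: "definable3 g" "\<forall>n\<in>\<omega>. onto (g n) (A (suc n) \<oplus> B n) (A n)"
    by (rule choose_onto[OF A AB]) (use eqv in \<open>simp add: surj_eqv_def\<close>)
  have "surjection_pair mem (f m) (g m) (A m) (A (suc m) \<oplus> B m)" if "m \<in> \<omega>" for m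
    using that f(2) g(2) small_family[OF A] small_family[OF AB]
    by unfold_locales (auto intro!: definable_intros definable3_app[OF f(1)] definable3_app[OF g(1)])
  then interpret remainder_sequence mem A B f g
    using A B f(1) g(1)
    by (intro remainder_sequence.intro remainder_sequence_axioms.intro zf_ac_axioms)
  have small: "small (residue \<zero> \<oplus> (\<Oplus>n. residue_gain n))"
    by (simp add: small_family[OF family_residue] family_residue_gain)
  show thesis
    by (rule remainder_from_residues[OF small card_A_residue]) (assumption, rule that)
qed

section \<open>The postulates of surjective cardinal algebras\<close>

lemma surjective_cardinal_surj_sum:
  "sequence_in mem (surjective_cardinal mem) S \<Longrightarrow> surjective_cardinal mem (surj_sum mem S)"
  by (erule sequence_in_surjective_cardinalsE) simp

lemma surj_sum_split_first:
  assumes "sequence_in mem (surjective_cardinal mem) S"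
  shows "surj_sum mem S = app mem S \<zero> \<boxplus> surj_sum mem (seq_of mem (\<lambda>n. app mem S (suc n)))"
proof -
  obtain F where F: "family F" "\<forall>n\<in>\<omega>. app mem S n = \<parallel>F n\<parallel>" "surj_sum mem S = \<parallel>\<Oplus>n. F n\<parallel>"
    using assms by (rule sequence_in_surjective_cardinalsE)
  have "family (\<lambda>n. F (suc n))"
    by (rule family_comp[OF F(1)]) (intro definable_intros)
  then have "surj_sum mem (seq_of mem (\<lambda>n. app mem S (suc n))) = \<parallel>\<Oplus>n. F (suc n)\<parallel>"
    by (rule surj_sum_seq_of) (use F(2) in simp)
  then show ?thesis
    using F by (simp add: surj_card_Oplus_split_first[OF F(1)])
qed

lemma surj_sum_add_distrib:
  assumes "sequence_in mem (surjective_cardinal mem) S" "sequence_in mem (surjective_cardinal mem) T"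
  shows "surj_sum mem (seq_of mem (\<lambda>n. app mem S n \<boxplus> app mem T n)) = surj_sum mem S \<boxplus> surj_sum mem T"
proof -
  obtain F where F: "family F" "\<forall>n\<in>\<omega>. app mem S n = \<parallel>F n\<parallel>" "surj_sum mem S = \<parallel>\<Oplus>n. F n\<parallel>"
    using assms(1) by (rule sequence_in_surjective_cardinalsE)
  obtain G where G: "family G" "\<forall>n\<in>\<omega>. app mem T n = \<parallel>G n\<parallel>" "surj_sum mem T = \<parallel>\<Oplus>n. G n\<parallel>"
    using assms(2) by (rule sequence_in_surjective_cardinalsE)
  have "surj_sum mem (seq_of mem (\<lambda>n. app mem S n \<boxplus> app mem T n)) = \<parallel>\<Oplus>n. F n \<oplus> G n\<parallel>"
    using F(2) G(2) small_family[OF F(1)] small_family[OF G(1)]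
    by (intro surj_sum_seq_of family_plus F(1) G(1)) (simp add: surj_card_plus)
  then show ?thesis
    using F G by (simp add: surj_card_Oplus_plus)
qed

lemma surj_add_neutral:
  "surjective_cardinal mem a \<Longrightarrow> a \<boxplus> \<parallel>{}\<parallel> = a \<and> \<parallel>{}\<parallel> \<boxplus> a = a"
  using surj_add_empty surj_add_commute by simp

lemma surj_sum_remainder:
  assumes "sequence_in mem (surjective_cardinal mem) S" "sequence_in mem (surjective_cardinal mem) T"
    and step: "\<forall>n. n \<epsilon> omega mem \<longrightarrow> app mem S n = app mem S (suc n) \<boxplus> app mem T n"
  shows "\<exists>c. surjective_cardinal mem c \<and> (\<forall>m. m \<epsilon> omega mem \<longrightarrow>
    app mem S m = c \<boxplus> surj_sum mem (seq_of mem (\<lambda>n. app mem T (m +\<^sub>\<omega> n))))"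
proof -
  obtain F where F: "family F" "\<forall>n\<in>\<omega>. app mem S n = \<parallel>F n\<parallel>" "surj_sum mem S = \<parallel>\<Oplus>n. F n\<parallel>"
    using assms(1) by (rule sequence_in_surjective_cardinalsE)
  obtain G where G: "family G" "\<forall>n\<in>\<omega>. app mem T n = \<parallel>G n\<parallel>" "surj_sum mem T = \<parallel>\<Oplus>n. G n\<parallel>"
    using assms(2) by (rule sequence_in_surjective_cardinalsE)
  have eq: "\<parallel>F n\<parallel> = \<parallel>F (suc n)\<parallel> \<boxplus> \<parallel>G n\<parallel>" if "n \<in> \<omega>" for n
  proof -
    have "app mem S n = app mem S (suc n) \<boxplus> app mem T n"
      using that step elts_iff by blast
    then show ?thesis
      using that F(2) G(2) by simp
  qed
  obtain R where R: "small R" "\<forall>m\<in>\<omega>. \<parallel>F m\<parallel> = \<parallel>R\<parallel> \<boxplus> \<parallel>tail G m\<parallel>"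
    by (rule remainder[OF F(1) G(1) eq])
  have "surj_sum mem (seq_of mem (\<lambda>n. app mem T (m +\<^sub>\<omega> n))) = \<parallel>tail G m\<parallel>" if "m \<in> \<omega>" for m
    unfolding tail_def by (rule surj_sum_seq_of[OF family_shift[OF G(1)]]) (use G(2) that in simp)
  then show ?thesis
    using R(2) F(2) by (intro exI[of _ "\<parallel>R\<parallel>"]) (simp add: elts_iff)
qed

end

theorem theorem2p11:
  fixes mem :: "'a \<Rightarrow> 'a \<Rightarrow> bool"
  assumes "ZF mem" and "AC_omega mem"
  shows "surjective_cardinal_algebra mem
           (surjective_cardinal mem) (surj_add mem) (surj_sum mem)"
proof -
  interpret zf_ac mem
    by unfold_locales (rule assms)+
  show ?thesis
    unfolding surjective_cardinal_algebra_def
  proof (intro conjI allI impI; (elim conjE)?)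
    show "\<exists>z. surjective_cardinal mem z \<and>
        (\<forall>a. surjective_cardinal mem a \<longrightarrow> surj_add mem a z = a \<and> surj_add mem z a = a)"
      using surj_add_neutral surjective_cardinal_surj_card by blast
  next
    fix a1 a2 b1 b2
    assume "surjective_cardinal mem a1" "surjective_cardinal mem a2" "surjective_cardinal mem b1"
      "surjective_cardinal mem b2" "surj_add mem a1 a2 = surj_add mem b1 b2"
    then show "\<exists>c1 c2 c3 c4. surjective_cardinal mem c1 \<and> surjective_cardinal mem c2 \<and>
        surjective_cardinal mem c3 \<and> surjective_cardinal mem c4 \<and> a1 = surj_add mem c1 c2 \<and>
        a2 = surj_add mem c3 c4 \<and> b1 = surj_add mem c1 c3 \<and> b2 = surj_add mem c2 c4"
      by (rule finite_refinement) blast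
  qed (rule surjective_cardinal_surj_add surjective_cardinal_surj_sum surj_sum_split_first
      surj_sum_add_distrib surj_sum_remainder; assumption)+
qed

end
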